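(* Let $H\in(0,1/2]$ and $\kappa,M$ as in the context, and let $\mathbf W=\mathbf W(\omega)$ be the Itô model built on two independent standard Brownian motions $W,\bar W$. Then $\exp(|||\mathbf W|||^2)\in L^{0+}(P)$, i.e. there exists $\eta>0$ with $E[\exp(\eta|||\mathbf W|||^2)]<\infty$.
   Context: Let $K^H(s,t)=\sqrt{2H}(t-s)^{H-1/2}1_{0<s<t}$ and $\hat W_t=\int_0^tK^H(s,t)dW_s$. Let $M$ be the smallest integer with $(M+1)H-1/2>0$ and $\kappa>0$ small with $(M+1)(H-\kappa)-1/2-\kappa>0$. The Itô model is $\mathbf W=(W,\bar W,\hat W,\mathbb W^m,\bar{\mathbb W}^m,\ m=1,\dots,M)$ with the Itô integrals $\mathbb W^m(s,t)=\int_s^t(\hat W_r-\hat W_s)^mdW_r$, $\bar{\mathbb W}^m(s,t)=\int_s^t(\hat W_r-\hat W_s)^md\bar W_r$. Its homogeneous norm is $|||\mathbf W|||=\|W\|_{1/2-\kappa}+\|\bar W\|_{1/2-\kappa}+\|\hat W\|_{H-\kappa}+\sum_{m=1}^M\big(\|\mathbb W^m\|^{1/(m+1)}_{m(H-\kappa)+1/2-\kappa}+\|\bar{\mathbb W}^m\|^{1/(m+1)}_{m(H-\kappa)+1/2-\kappa}\big)$, with $\|\cdot\|_\gamma$ the $\gamma$-Hölder seminorm on $[0,1]$ ($\sup_{s<t}|\cdot(s,t)|/|t-s|^\gamma$, using increments for paths). *)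

theory Defs
  imports "HOL-Probability.Probability"
begin

definition std_BM :: "'a measure \<Rightarrow> (real \<Rightarrow> 'a \<Rightarrow> real) \<Rightarrow> bool" where
  "std_BM M W \<longleftrightarrow>
     (\<forall>\<omega>\<in>space M. W 0 \<omega> = 0) \<and>
     (\<forall>\<omega>\<in>space M. continuous_on {0..1} (\<lambda>t. W t \<omega>)) \<and>
     (\<forall>t\<in>{0..1}. W t \<in> borel_measurable M) \<and>
     (\<forall>(n::nat) (tt::nat \<Rightarrow> real). tt 0 \<ge> 0 \<and> tt n \<le> 1 \<and> (\<forall>k<n. tt k < tt (Suc k)) \<longrightarrow>
        prob_space.indep_vars M (\<lambda>_. borel) (\<lambda>k \<omega>. W (tt (Suc k)) \<omega> - W (tt k) \<omega>) {..<n} \<and>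
        (\<forall>k<n. distributed M lborel (\<lambda>\<omega>. W (tt (Suc k)) \<omega> - W (tt k) \<omega>)
                 (\<lambda>x. ennreal (normal_density 0 (sqrt (tt (Suc k) - tt k)) x))))"

definition indep_processes :: "'a measure \<Rightarrow> (real \<Rightarrow> 'a \<Rightarrow> real) \<Rightarrow> (real \<Rightarrow> 'a \<Rightarrow> real) \<Rightarrow> bool" where
  "indep_processes M X Y \<longleftrightarrow>
     prob_space.indep_var M (Pi\<^sub>M UNIV (\<lambda>_. borel)) (\<lambda>\<omega> t. X t \<omega>)
                            (Pi\<^sub>M UNIV (\<lambda>_. borel)) (\<lambda>\<omega> t. Y t \<omega>)"

definition conv_in_prob :: "'a measure \<Rightarrow> (nat \<Rightarrow> 'a \<Rightarrow> real) \<Rightarrow> ('a \<Rightarrow> real) \<Rightarrow> bool" where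
  "conv_in_prob M S X \<longleftrightarrow>
     (\<forall>\<epsilon>>0. (\<lambda>n. measure M {\<omega>\<in>space M. \<bar>S n \<omega> - X \<omega>\<bar> > \<epsilon>}) \<longlonglongrightarrow> 0)"

definition KH :: "real \<Rightarrow> real \<Rightarrow> real \<Rightarrow> real" where
  "KH H s t = (if 0 < s \<and> s < t then sqrt (2*H) * (t - s) powr (H - 1/2) else 0)"

text \<open>Left-point Riemann sums on the uniform partition of [s,t] with n pieces:
  sum_k f(r_k) (X(r_{k+1}) - X(r_k)).  For continuous adapted (here: square-integrable
  deterministic, resp. continuous adapted) integrands these converge in probability to the
  Ito (resp. Wiener) integral of f against the Brownian motion X.\<close>
definition riemann_sum :: "(real \<Rightarrow> 'a \<Rightarrow> real) \<Rightarrow> (real \<Rightarrow> 'a \<Rightarrow> real) \<Rightarrow> real \<Rightarrow> real \<Rightarrow> nat \<Rightarrow> 'a \<Rightarrow> real" where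
  "riemann_sum f X s t n \<omega> =
     (\<Sum>k<n. f (s + real k * (t - s) / real n) \<omega> *
             (X (s + real (Suc k) * (t - s) / real n) \<omega> - X (s + real k * (t - s) / real n) \<omega>))"

definition holder2 :: "real \<Rightarrow> (real \<Rightarrow> real \<Rightarrow> real) \<Rightarrow> ennreal" where
  "holder2 \<gamma> A = (SUP st \<in> {(s,t). 0 \<le> s \<and> s < t \<and> t \<le> 1}.
                     ennreal (\<bar>A (fst st) (snd st)\<bar> / (snd st - fst st) powr \<gamma>))"

definition holder :: "real \<Rightarrow> (real \<Rightarrow> real) \<Rightarrow> ennreal" where
  "holder \<gamma> x = holder2 \<gamma> (\<lambda>s t. x t - x s)"

definition enn_root :: "nat \<Rightarrow> ennreal \<Rightarrow> ennreal" where
  "enn_root p x = (if x = \<infinity> then \<infinity> else ennreal (enn2real x powr (1 / real p)))"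

definition model_norm ::
  "real \<Rightarrow> real \<Rightarrow> nat \<Rightarrow> (real \<Rightarrow> real) \<Rightarrow> (real \<Rightarrow> real) \<Rightarrow> (real \<Rightarrow> real)
     \<Rightarrow> (nat \<Rightarrow> real \<Rightarrow> real \<Rightarrow> real) \<Rightarrow> (nat \<Rightarrow> real \<Rightarrow> real \<Rightarrow> real) \<Rightarrow> ennreal" where
  "model_norm H \<kappa> M w wb wh WW WWb =
     holder (1/2 - \<kappa>) w + holder (1/2 - \<kappa>) wb + holder (H - \<kappa>) wh +
     (\<Sum>m\<in>{1..M}. enn_root (m+1) (holder2 (real m * (H - \<kappa>) + 1/2 - \<kappa>) (WW m)) +
                 enn_root (m+1) (holder2 (real m * (H - \<kappa>) + 1/2 - \<kappa>) (WWb m)))"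

definition enn_exp_sq :: "real \<Rightarrow> ennreal \<Rightarrow> ennreal" where
  "enn_exp_sq \<eta> x = (if x = \<infinity> then \<infinity> else ennreal (exp (\<eta> * (enn2real x)^2)))"

end

theory Submission
  imports Defs
begin

text \<open>
  The proof is a Kolmogorov argument with moment constants that are sharp in the exponent. For a
  Gaussian variable \<open>Z\<close> of variance \<open>h\<close> independent of \<open>(I, f)\<close>, comparing binomial coefficients gives
  \<open>E (I + f Z)^(2q) \<le> E (I\<^sup>2 + (2q - 1) h f\<^sup>2)^q\<close>, so by Minkowski the square of the \<open>L^(2q)\<close> norm of a
  discrete stochastic integral grows by at most \<open>(2q - 1) h\<close> times that of the integrand in each step.
  Applied on dyadic grids, first to the Riemann sums that define \<open>Wh\<close> and then to those that define
  \<open>WW\<close>, this bounds the \<open>L^(2q)\<close> norm of \<open>WW m s t\<close> by \<open>(C q)^((m+1)/2) (t - s)^(m H + 1/2)\<close>;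
  Fatou's lemma carries the bound to the limits. Taking \<open>(m+1)\<close>-th roots, the supremum over all dyadic cells
  of the rescaled increments has \<open>2q\<close>-th moment at most \<open>(C q)^q\<close>, hence a finite square-exponential moment.
  Chen's relation, which is exact for the Riemann sums, lets a deterministic chaining argument pass
  from dyadic cells to all dyadic intervals, and continuity does the rest.
\<close>

subsection \<open>Gaussian moments of affine functions\<close>

text \<open>The shape of the homogeneous norm dictates the constants: \<open>WW m\<close> has degree
  \<open>m + 1\<close> in the Brownian motions, and the root of order \<open>m + 1\<close> leaves
  exactly the growth \<open>q^(1/2)\<close> of a Gaussian norm. A moment inequality with a worse
  power of \<open>q\<close> would destroy the square in the exponent. Two obstacles shape the route.
  The integrals are given only as limits in probability, separately for each pair of times, so
  bounds and identities are proved for finite sums and then transferred to countably many times. And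
  \<open>WW m\<close> is not additive in its interval: joining intervals produces cross terms, so
  the chaining goes by induction on \<open>m\<close> and has to find in every cross term a factor
  that decays with the level. The loss of \<kappa> per degree pays for the supremum: after
  rescaling, the \<open>2q\<close>-th moment on a cell of level \<open>n\<close> carries the factor
  \<open>2^(-2 \<kappa> q n)\<close>, which beats the number \<open>2^n\<close> of cells once
  \<open>\<kappa> q \<ge> 1\<close>.\<close>

lemma choose_gaussian_moment_le:
  fixes q j :: nat
  assumes "j \<le> q"
  shows "real ((2*q) choose (2*j)) * (fact (2*j) / (2^j * fact j))
           \<le> real (q choose j) * (2 * real q - 1)^j"
  using assms
proof (induction j)
  case 0 then show ?case by simp
next
  case (Suc j)
  define A where "A j = real ((2*q) choose (2*j)) * (fact (2*j) / (2^j * fact j))" for j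
  define B where "B j = real (q choose j) * (2 * real q - 1)^j" for j
  have eq: "real (n choose Suc k) * real (Suc k) = real (n choose k) * (real n - real k)" if "k \<le> n" for n k :: nat
  proof -
    have "Suc k * (n choose Suc k) = (n - k) * (n choose k)"
      by (metis binomial_absorb_comp binomial_absorption mult.commute)
    then have "real (Suc k * (n choose Suc k)) = real ((n - k) * (n choose k))" by simp
    then show ?thesis using that by (simp only: of_nat_mult of_nat_diff mult.commute)
  qed
  have jq: "j < q" using Suc.prems by simp
  have e1: "real ((2*q) choose (Suc (2*j))) * real (Suc (2*j)) = real ((2*q) choose (2*j)) * (2 * real q - 2 * real j)"
    using eq[of "2*j" "2*q"] jq by simp
  have e2: "real ((2*q) choose (Suc (Suc (2*j)))) * real (Suc (Suc (2*j))) = real ((2*q) choose (Suc (2*j))) * (2 * real q - 2 * real j - 1)"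
    using eq[of "Suc (2*j)" "2*q"] jq by (simp add: algebra_simps)
  \<comment> \<open>Passing from \<open>j\<close> to \<open>j + 1\<close> multiplies the left side
    by \<open>(q - j) (2 q - 2 j - 1) / (j + 1)\<close> and the right side by
    \<open>(q - j) (2 q - 1) / (j + 1)\<close>, so only these ratios have to be compared. The
    quotient of factorials is the standard Gaussian moment of order \<open>2 j\<close>.\<close>
  have "A (Suc j) = real ((2*q) choose (Suc (Suc (2*j)))) * real (Suc (Suc (2*j))) * real (Suc (2*j)) * (fact (2*j) / (2^j * fact j)) / (2 * real (Suc j))"
    unfolding A_def by (simp add: field_simps)
  also have "\<dots> = A j * ((real q - real j) * (2 * real q - 2 * real j - 1) / real (Suc j))"
  proof -
    have "real ((2*q) choose (Suc (Suc (2*j)))) * real (Suc (Suc (2*j))) * real (Suc (2*j))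
        = real ((2*q) choose (2*j)) * (2 * real q - 2 * real j) * (2 * real q - 2 * real j - 1)"
      unfolding e2 e1[symmetric] by (simp only: mult_ac)
    then show ?thesis
      unfolding A_def by (simp only: times_divide_eq_right times_divide_eq_left) (simp add: divide_simps, simp add: algebra_simps)
  qed
  finally have A: "A (Suc j) = A j * ((real q - real j) * (2 * real q - 2 * real j - 1) / real (Suc j))" .
  have B: "B (Suc j) = B j * ((real q - real j) * (2 * real q - 1) / real (Suc j))"
  proof -
    have "B (Suc j) = real (q choose Suc j) * real (Suc j) * (2 * real q - 1) ^ Suc j / real (Suc j)"
      unfolding B_def by (simp add: field_simps)
    also have "\<dots> = B j * ((real q - real j) * (2 * real q - 1) / real (Suc j))"
      unfolding B_def using jq by (subst eq) (auto simp: field_simps)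
    finally show ?thesis .
  qed
  have "real q - real j \<ge> 1" using jq by linarith
  then have pos: "(real q - real j) * (2 * real q - 2 * real j - 1) / real (Suc j) \<ge> 0"
    by (intro divide_nonneg_nonneg mult_nonneg_nonneg) auto
  have B0: "B j \<ge> 0" unfolding B_def using jq by (intro mult_nonneg_nonneg zero_le_power) auto
  have "A (Suc j) \<le> B j * ((real q - real j) * (2 * real q - 2 * real j - 1) / real (Suc j))"
    unfolding A using Suc jq pos by (intro mult_right_mono) (auto simp: A_def B_def)
  also have "\<dots> \<le> B (Suc j)"
    unfolding B using jq B0 by (intro mult_left_mono divide_right_mono) auto
  finally show ?case unfolding A_def B_def .
qed

text \<open>Odd moments vanish, and the even terms of the binomial expansion of degree
  \<open>2 q\<close> lie one by one below those of an expansion of degree \<open>q\<close> in the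
  squares.\<close>

lemma nn_integral_normal_affine_even_power_le:
  fixes a b h :: real
  assumes h: "h > 0"
  shows "(\<integral>\<^sup>+z. ennreal (normal_density 0 (sqrt h) z) * ennreal ((a + b * z)^(2*q)) \<partial>lborel)
           \<le> ennreal ((a\<^sup>2 + (2 * real q - 1) * h * b\<^sup>2)^q)"
proof -
  define N where "N = normal_density 0 (sqrt h)"
  define \<mu> where "\<mu> i = (if even i then fact i / ((2/h)^(i div 2) * fact (i div 2)) else (0::real))" for i :: nat
  have mom: "has_bochner_integral lborel (\<lambda>z. N z * z^i) (\<mu> i)" for i
  proof (cases "even i")
    case True
    then obtain k where "i = 2*k" by auto
    then show ?thesis
      using normal_moment_even[of "sqrt h" 0 k] h by (simp add: N_def \<mu>_def)
  next
    case False
    then obtain k where "i = 2*k+1" by (auto elim: oddE)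
    then show ?thesis
      using normal_moment_odd[of "sqrt h" 0 k] h by (simp add: N_def \<mu>_def)
  qed
  define g where "g i = real ((2*q) choose i) * b^i * a^(2*q-i)" for i
  have "has_bochner_integral lborel (\<lambda>z. \<Sum>i\<le>2*q. g i * (N z * z^i)) (\<Sum>i\<le>2*q. g i * \<mu> i)"
    by (intro has_bochner_integral_sum has_bochner_integral_mult_right mom)
  moreover have "(\<Sum>i\<le>2*q. g i * (N z * z^i)) = N z * (a + b * z)^(2*q)" for z
    unfolding add.commute[of a] binomial_ring g_def
    by (simp add: sum_distrib_left power_mult_distrib mult_ac)
  ultimately have *: "has_bochner_integral lborel (\<lambda>z. N z * (a + b * z)^(2*q)) (\<Sum>i\<le>2*q. g i * \<mu> i)"
    by simp
  have "(\<integral>\<^sup>+z. ennreal (N z) * ennreal ((a + b * z)^(2*q)) \<partial>lborel)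
      = (\<integral>\<^sup>+z. ennreal (N z * (a + b * z)^(2*q)) \<partial>lborel)"
    by (intro nn_integral_cong) (simp add: ennreal_mult'' N_def)
  also have "\<dots> = ennreal (\<Sum>i\<le>2*q. g i * \<mu> i)"
    using * by (subst nn_integral_eq_integral) (auto simp: has_bochner_integral_iff N_def)
  also have "(\<Sum>i\<le>2*q. g i * \<mu> i) = (\<Sum>i\<in>(\<lambda>j. 2*j) ` {..q}. g i * \<mu> i)"
    by (rule sum.mono_neutral_right) (auto simp: \<mu>_def elim!: evenE)
  also have "\<dots> = (\<Sum>j\<le>q. g (2*j) * \<mu> (2*j))"
    by (subst sum.reindex) (auto simp: inj_on_def)
  also have "\<dots> \<le> (\<Sum>j\<le>q. real (q choose j) * ((2 * real q - 1) * h * b\<^sup>2)^j * (a\<^sup>2)^(q-j))"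
  proof (rule sum_mono)
    fix j assume "j \<in> {..q}"
    then have j: "j \<le> q" by simp
    have "g (2*j) * \<mu> (2*j) = (real ((2*q) choose (2*j)) * (fact (2*j) / (2^j * fact j))) * (h^j * (b\<^sup>2)^j * (a\<^sup>2)^(q-j))"
      using h j by (simp add: g_def \<mu>_def power_divide field_simps power_mult[symmetric] diff_mult_distrib)
    also have "\<dots> \<le> (real (q choose j) * (2 * real q - 1)^j) * (h^j * (b\<^sup>2)^j * (a\<^sup>2)^(q-j))"
      using h by (intro mult_right_mono choose_gaussian_moment_le j) auto
    finally show "g (2*j) * \<mu> (2*j) \<le> real (q choose j) * ((2 * real q - 1) * h * b\<^sup>2)^j * (a\<^sup>2)^(q-j)"
      by (simp add: power_mult_distrib mult_ac)
  qed
  also have "\<dots> = (a\<^sup>2 + (2 * real q - 1) * h * b\<^sup>2)^q"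
    unfolding add.commute[of "a\<^sup>2"] binomial_ring by simp
  finally show ?thesis unfolding N_def by (simp add: ennreal_leI)
qed

text \<open>Convexity of the power with weights \<open>A / (A + B)\<close> and
  \<open>B / (A + B)\<close>. They are chosen so that, when \<open>A\<close> and \<open>B\<close>
  bound the norms of the summands, integrating the right side gives exactly
  \<open>(A + B)^(r + 1)\<close>.\<close>

lemma power_add_weighted_le:
  fixes x y A B :: real
  assumes "x \<ge> 0" "y \<ge> 0" "A > 0" "B > 0"
  shows "(x + y)^Suc r \<le> ((A + B) / A)^r * x^Suc r + ((A + B) / B)^r * y^Suc r"
proof -
  define \<theta> where "\<theta> = A / (A + B)"
  have \<theta>: "0 < \<theta>" "\<theta> < 1" "1 - \<theta> = B / (A + B)" using assms by (auto simp: \<theta>_def field_simps)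
  have "convex_on {0..} (\<lambda>x::real. x^n)" for n
    by (cases "even n") (auto intro: convex_power_odd convex_on_subset[OF convex_power_even])
  from convex_onD[OF this[of "Suc r"], of "1 - \<theta>" "x / \<theta>" "y / (1 - \<theta>)"]
  have "(\<theta> * (x / \<theta>) + (1 - \<theta>) * (y / (1 - \<theta>)))^Suc r \<le> \<theta> * (x / \<theta>)^Suc r + (1 - \<theta>) * (y / (1 - \<theta>))^Suc r"
    using \<theta>(1,2) assms by simp
  then have "(x + y)^Suc r \<le> \<theta> * (x / \<theta>)^Suc r + (1 - \<theta>) * (y / (1 - \<theta>))^Suc r"
    using \<theta>(1,2) by simp
  also have "\<theta> * (x / \<theta>)^Suc r = ((A + B) / A)^r * x^Suc r"
  proof -
    have "\<theta> * (x / \<theta>)^Suc r = x^Suc r * (1/\<theta>)^r"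
      using \<theta>(1) by (simp add: power_divide field_simps)
    then show ?thesis by (simp add: \<theta>_def)
  qed
  also have "(1-\<theta>) * (y / (1-\<theta>))^Suc r = ((A + B) / B)^r * y^Suc r"
  proof -
    have "(1-\<theta>) * (y / (1-\<theta>))^Suc r = y^Suc r * (1/(1-\<theta>))^r"
      using \<theta>(2) by (simp add: power_divide field_simps)
    then show ?thesis by (simp add: \<theta>(3))
  qed
  finally show ?thesis .
qed

text \<open>Minkowski's inequality in \<open>L^q\<close>, with upper bounds in place of the norms so
  that it can be iterated. The weights require positive bounds; a bound 0 forces the function to
  vanish almost everywhere and is treated apart.\<close>

lemma nn_integral_power_add_le:
  fixes x y :: "'a \<Rightarrow> real" and A B :: real
  assumes [measurable]: "x \<in> borel_measurable M" "y \<in> borel_measurable M"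
    and x: "\<And>\<omega>. x \<omega> \<ge> 0" and y: "\<And>\<omega>. y \<omega> \<ge> 0"
    and A: "A \<ge> 0" "(\<integral>\<^sup>+\<omega>. ennreal (x \<omega> ^ q) \<partial>M) \<le> ennreal (A^q)"
    and B: "B \<ge> 0" "(\<integral>\<^sup>+\<omega>. ennreal (y \<omega> ^ q) \<partial>M) \<le> ennreal (B^q)"
    and q: "q \<ge> 1"
  shows "(\<integral>\<^sup>+\<omega>. ennreal ((x \<omega> + y \<omega>) ^ q) \<partial>M) \<le> ennreal ((A + B)^q)"
proof -
  have zero: "AE \<omega> in M. u \<omega> = 0"
    if [measurable]: "u \<in> borel_measurable M" and u: "\<And>\<omega>. u \<omega> \<ge> 0" "(\<integral>\<^sup>+\<omega>. ennreal (u \<omega> ^ q) \<partial>M) \<le> ennreal (0^q)"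
    for u :: "'a \<Rightarrow> real"
  proof -
    have "(\<integral>\<^sup>+\<omega>. ennreal (u \<omega> ^ q) \<partial>M) = 0" using u(2) q by (simp add: power_0_left)
    then have "AE \<omega> in M. ennreal (u \<omega> ^ q) = 0"
      by (subst (asm) nn_integral_0_iff_AE) auto
    then show ?thesis
    proof eventually_elim
      case (elim \<omega>) then show ?case using u(1)[of \<omega>] q by (metis ennreal_eq_zero_iff power_eq_0_iff zero_le_power)
    qed
  qed
  consider "A = 0" | "B = 0" | "A > 0" "B > 0" using A B by linarith
  then show ?thesis
  proof cases
    case 1
    have "AE \<omega> in M. x \<omega> = 0" using zero[of x] x A(2) 1 by simp
    then have "(\<integral>\<^sup>+\<omega>. ennreal ((x \<omega> + y \<omega>) ^ q) \<partial>M) = (\<integral>\<^sup>+\<omega>. ennreal (y \<omega> ^ q) \<partial>M)"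
      by (intro nn_integral_cong_AE) auto
    then show ?thesis using B 1 by simp
  next
    case 2
    have "AE \<omega> in M. y \<omega> = 0" using zero[of y] y B(2) 2 by simp
    then have "(\<integral>\<^sup>+\<omega>. ennreal ((x \<omega> + y \<omega>) ^ q) \<partial>M) = (\<integral>\<^sup>+\<omega>. ennreal (x \<omega> ^ q) \<partial>M)"
      by (intro nn_integral_cong_AE) auto
    then show ?thesis using A 2 by simp
  next
    case 3
    obtain r where r: "q = Suc r" using q by (cases q) auto
    define a where "a = ((A + B) / A)^r"
    define b where "b = ((A + B) / B)^r"
    have ab: "a \<ge> 0" "b \<ge> 0" using 3 by (auto simp: a_def b_def)
    have "(\<integral>\<^sup>+\<omega>. ennreal ((x \<omega> + y \<omega>) ^ q) \<partial>M)
        \<le> (\<integral>\<^sup>+\<omega>. ennreal a * ennreal (x \<omega> ^ q) + ennreal b * ennreal (y \<omega> ^ q) \<partial>M)"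
    proof (rule nn_integral_mono)
      fix \<omega>
      have "(x \<omega> + y \<omega>)^q \<le> a * x \<omega> ^ q + b * y \<omega> ^ q"
        unfolding r a_def b_def using 3 x y by (intro power_add_weighted_le) auto
      then show "ennreal ((x \<omega> + y \<omega>)^q) \<le> ennreal a * ennreal (x \<omega> ^ q) + ennreal b * ennreal (y \<omega> ^ q)"
        using ab x[of \<omega>] y[of \<omega>] by (simp add: ennreal_mult[symmetric] ennreal_plus[symmetric] ennreal_leI del: ennreal_plus)
    qed
    also have "\<dots> = ennreal a * (\<integral>\<^sup>+\<omega>. ennreal (x \<omega> ^ q) \<partial>M) + ennreal b * (\<integral>\<^sup>+\<omega>. ennreal (y \<omega> ^ q) \<partial>M)"
      by (simp add: nn_integral_add nn_integral_cmult)
    also have "\<dots> \<le> ennreal a * ennreal (A^q) + ennreal b * ennreal (B^q)"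
      using A B by (intro add_mono mult_left_mono) auto
    also have "\<dots> = ennreal (a * A^q + b * B^q)"
      using ab A B by (simp add: ennreal_mult[symmetric] ennreal_plus[symmetric] del: ennreal_plus)
    also have "a * A^q + b * B^q = (A + B)^q"
    proof -
      have "a * A^r = (A+B)^r" "b * B^r = (A+B)^r"
        unfolding a_def b_def power_mult_distrib[symmetric] using 3 by auto
      then show ?thesis unfolding r by (simp add: algebra_simps)
    qed
    finally show ?thesis .
  qed
qed

subsection \<open>Moments of discrete stochastic integrals\<close>

text \<open>The discrete filtration, pulled back along the tuple of the first \<open>k\<close>
  variables: grouping an independent family yields the independence of precisely this tuple from
  \<open>X k\<close>.\<close>

definition past_algebra :: "'a measure \<Rightarrow> (nat \<Rightarrow> 'a \<Rightarrow> real) \<Rightarrow> nat \<Rightarrow> 'a measure" where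
  "past_algebra M X k = vimage_algebra (space M) (\<lambda>\<omega>. \<lambda>j\<in>{..<k}. X j \<omega>) (Pi\<^sub>M {..<k} (\<lambda>_. borel))"

lemma space_past_algebra [simp]: "space (past_algebra M X k) = space M"
  by (simp add: past_algebra_def)

lemma measurable_past_algebra:
  assumes "j < k"
  shows "X j \<in> borel_measurable (past_algebra M X k)"
proof -
  have "(\<lambda>\<omega>. \<lambda>j\<in>{..<k}. X j \<omega>) \<in> past_algebra M X k \<rightarrow>\<^sub>M Pi\<^sub>M {..<k} (\<lambda>_. borel)"
    unfolding past_algebra_def by (rule measurable_vimage_algebra1) (auto simp: space_PiM)
  moreover have "(\<lambda>x. x j) \<in> borel_measurable (Pi\<^sub>M {..<k} (\<lambda>_. borel))"
    using assms by (intro measurable_component_singleton) auto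
  ultimately have "(\<lambda>\<omega>. (\<lambda>j\<in>{..<k}. X j \<omega>) j) \<in> borel_measurable (past_algebra M X k)"
    by (rule measurable_compose)
  then show ?thesis using assms by simp
qed

lemma past_algebra_measurable_mono:
  assumes f: "f \<in> borel_measurable (past_algebra M X k)" and "k \<le> l"
  shows "f \<in> borel_measurable (past_algebra M X l)"
proof -
  have "(\<lambda>\<omega>. \<lambda>j\<in>{..<k}. X j \<omega>) \<in> past_algebra M X l \<rightarrow>\<^sub>M Pi\<^sub>M {..<k} (\<lambda>_. borel)"
    using \<open>k \<le> l\<close> by (intro measurable_restrict measurable_past_algebra) auto
  from measurable_sets[OF this] have "sets (past_algebra M X k) \<subseteq> sets (past_algebra M X l)"
    unfolding past_algebra_def[of M X k]
    by (subst sets_vimage_algebra2) (auto simp: space_PiM)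
  then show ?thesis
    using f unfolding measurable_def by auto
qed

lemma past_algebra_measurable_imp:
  assumes X: "\<And>j. j < k \<Longrightarrow> X j \<in> borel_measurable M"
    and f: "f \<in> borel_measurable (past_algebra M X k)"
  shows "f \<in> borel_measurable M"
proof -
  have "(\<lambda>\<omega>. \<lambda>j\<in>{..<k}. X j \<omega>) \<in> M \<rightarrow>\<^sub>M Pi\<^sub>M {..<k} (\<lambda>_. borel)"
    using X by (intro measurable_restrict) auto
  from measurable_sets[OF this] have "sets (past_algebra M X k) \<subseteq> sets M"
    unfolding past_algebra_def[of M X k]
    by (subst sets_vimage_algebra2) (auto simp: space_PiM)
  then show ?thesis
    using f unfolding measurable_def by auto
qed

context prob_space
begin

text \<open>The dummy second component is there because \<^const>\<open>indep_var\<close> forces both variables to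
  have the same type.\<close>

lemma indep_var_past_algebra:
  assumes ind: "indep_vars (\<lambda>_. borel) X {..<n}" and k: "k < n"
    and a: "a \<in> borel_measurable (past_algebra M X k)" and b: "b \<in> borel_measurable (past_algebra M X k)"
  shows "indep_var (borel \<Otimes>\<^sub>M borel) (\<lambda>\<omega>. (a \<omega>, b \<omega>)) (borel \<Otimes>\<^sub>M borel) (\<lambda>\<omega>. (X k \<omega>, 0 :: real))"
proof -
  let ?T = "\<lambda>\<omega>. \<lambda>j\<in>{..<k}. X j \<omega>" and ?N = "Pi\<^sub>M {..<k} (\<lambda>_. borel :: real measure)"
  have rv: "\<And>j. j < n \<Longrightarrow> X j \<in> borel_measurable M"
    using ind by (auto simp: indep_vars_def)
  have "indep_var ?N ?T (Pi\<^sub>M {k} (\<lambda>_. borel)) (\<lambda>\<omega>. restrict (\<lambda>i. X i \<omega>) {k})"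
    using k by (intro indep_var_restrict[OF ind]) auto
  then have *: "indep_set (sigma_sets (space M) {?T -` A \<inter> space M |A. A \<in> sets ?N})
      (sigma_sets (space M) {(\<lambda>\<omega>. restrict (\<lambda>i. X i \<omega>) {k}) -` A \<inter> space M |A. A \<in> sets (Pi\<^sub>M {k} (\<lambda>_. borel))})"
    (is "indep_set _ ?R") by (simp add: indep_var_eq)
  have subX: "sigma_sets (space M) {(\<lambda>\<omega>. (X k \<omega>, 0 :: real)) -` A \<inter> space M |A. A \<in> sets (borel \<Otimes>\<^sub>M borel)} \<subseteq> ?R"
  proof (rule sigma_sets_mono', safe)
    fix A :: "(real \<times> real) set" assume "A \<in> sets (borel \<Otimes>\<^sub>M borel)"
    moreover have "(\<lambda>x. (x k, 0)) \<in> Pi\<^sub>M {k} (\<lambda>_. borel) \<rightarrow>\<^sub>M borel \<Otimes>\<^sub>M (borel :: real measure)"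
      by measurable
    ultimately have "(\<lambda>x. (x k, 0)) -` A \<inter> space (Pi\<^sub>M {k} (\<lambda>_. borel)) \<in> sets (Pi\<^sub>M {k} (\<lambda>_. borel :: real measure))"
      by (rule measurable_sets[rotated])
    moreover have "(\<lambda>\<omega>. (X k \<omega>, 0 :: real)) -` A \<inter> space M
      = (\<lambda>\<omega>. restrict (\<lambda>i. X i \<omega>) {k}) -` ((\<lambda>x. (x k, 0)) -` A \<inter> space (Pi\<^sub>M {k} (\<lambda>_. borel))) \<inter> space M"
      by (auto simp: space_PiM)
    ultimately show "\<exists>B. (\<lambda>\<omega>. (X k \<omega>, 0 :: real)) -` A \<inter> space M
        = (\<lambda>\<omega>. restrict (\<lambda>i. X i \<omega>) {k}) -` B \<inter> space M \<and> B \<in> sets (Pi\<^sub>M {k} (\<lambda>_. borel))"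
      by blast
  qed
  have am: "a \<in> borel_measurable M" "b \<in> borel_measurable M"
    by (rule past_algebra_measurable_imp[OF _ a] past_algebra_measurable_imp[OF _ b], use k rv in simp)+
  have ab: "(\<lambda>\<omega>. (a \<omega>, b \<omega>)) \<in> past_algebra M X k \<rightarrow>\<^sub>M borel \<Otimes>\<^sub>M borel"
    using a b by (rule measurable_Pair)
  \<comment> \<open>The events of \<open>(a, b)\<close> are among those generated by the tuple, so
    they inherit its independence from \<open>X k\<close>.\<close>
  have "sets (past_algebra M X k) = sigma_sets (space M) {?T -` A \<inter> space M |A. A \<in> sets ?N}"
    unfolding past_algebra_def by (rule sets_vimage_algebra)
  then have sub: "sigma_sets (space M) {(\<lambda>\<omega>. (a \<omega>, b \<omega>)) -` A \<inter> space M |A. A \<in> sets (borel \<Otimes>\<^sub>M borel)}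
      \<subseteq> sigma_sets (space M) {?T -` A \<inter> space M |A. A \<in> sets ?N}"
    using measurable_sets[OF ab] by (auto intro!: sigma_sets_mono)
  have "indep_set (sigma_sets (space M) {(\<lambda>\<omega>. (a \<omega>, b \<omega>)) -` A \<inter> space M |A. A \<in> sets (borel \<Otimes>\<^sub>M borel)})
     (sigma_sets (space M) {(\<lambda>\<omega>. (X k \<omega>, 0 :: real)) -` A \<inter> space M |A. A \<in> sets (borel \<Otimes>\<^sub>M borel)})"
    using * order_trans[OF sub] order_trans[OF subX] subsetD[OF sub] subsetD[OF subX]
    unfolding indep_sets2_eq by (intro conjI ballI) auto
  then show ?thesis
    unfolding indep_var_eq using am rv k by auto
qed

text \<open>Under independence the joint law is a product, so Tonelli's theorem freezes
  \<open>(a, b)\<close> while \<open>Z\<close> is integrated out.\<close>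

lemma nn_integral_gaussian_step_le:
  assumes ind: "indep_var (borel \<Otimes>\<^sub>M borel) (\<lambda>\<omega>. (a \<omega>, b \<omega>)) (borel \<Otimes>\<^sub>M borel) (\<lambda>\<omega>. (Z \<omega>, 0 :: real))"
    and Z: "distributed M lborel Z (\<lambda>x. ennreal (normal_density 0 (sqrt h) x))" and h: "h > 0"
  shows "(\<integral>\<^sup>+\<omega>. ennreal ((a \<omega> + b \<omega> * Z \<omega>)^(2*q)) \<partial>M)
           \<le> (\<integral>\<^sup>+\<omega>. ennreal (((a \<omega>)\<^sup>2 + (2 * real q - 1) * h * (b \<omega>)\<^sup>2)^q) \<partial>M)"
proof -
  let ?D = "distr M (borel \<Otimes>\<^sub>M borel) (\<lambda>\<omega>. (a \<omega>, b \<omega>))"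
  let ?E = "distr M (borel \<Otimes>\<^sub>M borel) (\<lambda>\<omega>. (Z \<omega>, 0 :: real))"
  have [measurable]: "(\<lambda>\<omega>. (a \<omega>, b \<omega>)) \<in> M \<rightarrow>\<^sub>M borel \<Otimes>\<^sub>M borel"
    using ind by (auto simp: indep_var_eq)
  have [measurable]: "Z \<in> borel_measurable M"
    using Z by (simp add: distributed_def)
  have D: "?D \<Otimes>\<^sub>M ?E = distr M ((borel \<Otimes>\<^sub>M borel) \<Otimes>\<^sub>M (borel \<Otimes>\<^sub>M borel)) (\<lambda>x. ((a x, b x), (Z x, 0)))"
    using ind unfolding indep_var_distribution_eq by auto
  have dZ: "distr M lborel Z = density lborel (\<lambda>x. ennreal (normal_density 0 (sqrt h) x))"
    using Z unfolding distributed_def by simp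
  interpret E: prob_space ?E by (rule prob_space_distr) simp
  have "(\<integral>\<^sup>+\<omega>. ennreal ((a \<omega> + b \<omega> * Z \<omega>)^(2*q)) \<partial>M)
      = (\<integral>\<^sup>+p. ennreal ((fst (fst p) + snd (fst p) * fst (snd p))^(2*q)) \<partial>(?D \<Otimes>\<^sub>M ?E))"
    unfolding D by (subst nn_integral_distr) auto
  also have "\<dots> = (\<integral>\<^sup>+p. (\<integral>\<^sup>+z. ennreal ((fst p + snd p * fst z)^(2*q)) \<partial>?E) \<partial>?D)"
    by (subst E.nn_integral_fst[symmetric]) auto
  also have "\<dots> \<le> (\<integral>\<^sup>+p. ennreal (((fst p)\<^sup>2 + (2 * real q - 1) * h * (snd p)\<^sup>2)^q) \<partial>?D)"
  proof (rule nn_integral_mono)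
    fix p :: "real \<times> real"
    have "(\<integral>\<^sup>+z. ennreal ((fst p + snd p * fst z)^(2*q)) \<partial>?E)
       = (\<integral>\<^sup>+z. ennreal ((fst p + snd p * z)^(2*q)) \<partial>distr M lborel Z)"
      by (simp add: nn_integral_distr)
    also have "\<dots> = (\<integral>\<^sup>+z. ennreal (normal_density 0 (sqrt h) z) * ennreal ((fst p + snd p * z)^(2*q)) \<partial>lborel)"
      unfolding dZ by (rule nn_integral_density) auto
    finally show "(\<integral>\<^sup>+z. ennreal ((fst p + snd p * fst z)^(2*q)) \<partial>?E)
        \<le> ennreal (((fst p)\<^sup>2 + (2 * real q - 1) * h * (snd p)\<^sup>2)^q)"
      using nn_integral_normal_affine_even_power_le[OF h] by simp
  qed
  also have "\<dots> = (\<integral>\<^sup>+\<omega>. ennreal (((a \<omega>)\<^sup>2 + (2 * real q - 1) * h * (b \<omega>)\<^sup>2)^q) \<partial>M)"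
    by (subst nn_integral_distr) auto
  finally show ?thesis .
qed

text \<open>A Burkholder inequality whose constant \<open>2 q - 1\<close> has the growth in \<open>q\<close> that Gaussian tails
  require.\<close>

lemma gaussian_martingale_moment_le:
  fixes X :: "nat \<Rightarrow> 'a \<Rightarrow> real" and f :: "nat \<Rightarrow> 'a \<Rightarrow> real"
  assumes ind: "indep_vars (\<lambda>_. borel) X {..<N}"
    and X: "\<And>k. k < N \<Longrightarrow> distributed M lborel (X k) (\<lambda>x. ennreal (normal_density 0 (sqrt h) x))"
    and h: "h > 0" and q: "q \<ge> 1"
    and f: "\<And>k. k < n \<Longrightarrow> f k \<in> borel_measurable (past_algebra M X (i + k))"
    and F: "\<And>k. k < n \<Longrightarrow> F k \<ge> 0"
           "\<And>k. k < n \<Longrightarrow> (\<integral>\<^sup>+\<omega>. ennreal (f k \<omega> ^ (2*q)) \<partial>M) \<le> ennreal (F k ^ q)"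
    and N: "i + n \<le> N"
  shows "(\<integral>\<^sup>+\<omega>. ennreal ((\<Sum>k<n. f k \<omega> * X (i + k) \<omega>)^(2*q)) \<partial>M)
           \<le> ennreal (((2 * real q - 1) * h * (\<Sum>k<n. F k))^q)"
  using f F N
proof (induction n)
  case 0
  then show ?case using q by (simp add: power_0_left)
next
  case (Suc n)
  define a where "a \<omega> = (\<Sum>k<n. f k \<omega> * X (i + k) \<omega>)" for \<omega>
  define c where "c = (2 * real q - 1) * h"
  have c: "c \<ge> 0" using q h by (auto simp: c_def)
  have rv: "X j \<in> borel_measurable M" if "j < N" for j
    using ind that by (auto simp: indep_vars_def)
  have a: "a \<in> borel_measurable (past_algebra M X (i + n))"
    unfolding a_def
  proof (intro borel_measurable_sum borel_measurable_times)
    fix k assume "k \<in> {..<n}"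
    then show "f k \<in> borel_measurable (past_algebra M X (i + n))" "X (i + k) \<in> borel_measurable (past_algebra M X (i + n))"
      using Suc.prems(1)[of k] by (auto intro: past_algebra_measurable_mono measurable_past_algebra)
  qed
  have fn: "f n \<in> borel_measurable (past_algebra M X (i + n))" using Suc.prems by simp
  have [measurable]: "a \<in> borel_measurable M" "f n \<in> borel_measurable M"
    by (rule past_algebra_measurable_imp[OF _ a] past_algebra_measurable_imp[OF _ fn], use Suc.prems(4) rv in simp)+
  have "(\<integral>\<^sup>+\<omega>. ennreal ((\<Sum>k<Suc n. f k \<omega> * X (i + k) \<omega>)^(2*q)) \<partial>M)
     = (\<integral>\<^sup>+\<omega>. ennreal ((a \<omega> + f n \<omega> * X (i + n) \<omega>)^(2*q)) \<partial>M)"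
    by (simp add: a_def)
  also have "\<dots> \<le> (\<integral>\<^sup>+\<omega>. ennreal (((a \<omega>)\<^sup>2 + c * (f n \<omega>)\<^sup>2)^q) \<partial>M)"
    unfolding c_def using Suc.prems
    by (intro nn_integral_gaussian_step_le indep_var_past_algebra[OF ind _ a fn] X h) auto
  \<comment> \<open>\<open>F k\<close> bounds the square of the \<open>L^(2q)\<close> norm of
    \<open>f k\<close>. Minkowski is applied in \<open>L^q\<close> to the squares, which is why
    squared norms add up here and not the norms.\<close>
  also have "\<dots> \<le> ennreal ((c * (\<Sum>k<n. F k) + c * F n)^q)"
  proof (rule nn_integral_power_add_le)
    show "(\<integral>\<^sup>+\<omega>. ennreal (((a \<omega>)\<^sup>2) ^ q) \<partial>M) \<le> ennreal ((c * sum F {..<n}) ^ q)"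
      using Suc.IH Suc.prems by (simp add: a_def c_def power_mult)
    have "(\<integral>\<^sup>+\<omega>. ennreal ((c * (f n \<omega>)\<^sup>2) ^ q) \<partial>M) = ennreal (c^q) * (\<integral>\<^sup>+\<omega>. ennreal (f n \<omega> ^ (2*q)) \<partial>M)"
      using c by (subst nn_integral_cmult[symmetric]) (auto simp: power_mult_distrib power_mult ennreal_mult)
    also have "\<dots> \<le> ennreal (c^q) * ennreal (F n ^ q)"
      using Suc.prems by (intro mult_left_mono) auto
    finally show "(\<integral>\<^sup>+\<omega>. ennreal ((c * (f n \<omega>)\<^sup>2) ^ q) \<partial>M) \<le> ennreal ((c * F n) ^ q)"
      using c Suc.prems by (simp add: power_mult_distrib ennreal_mult)
  qed (use c q Suc.prems in \<open>auto intro!: mult_nonneg_nonneg sum_nonneg\<close>)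
  also have "c * (\<Sum>k<n. F k) + c * F n = (2 * real q - 1) * h * (\<Sum>k<Suc n. F k)"
    by (simp add: c_def algebra_simps)
  finally show ?case .
qed

end

subsection \<open>The fractional kernel on a grid\<close>

text \<open>Comparison with an integral: in each step \<open>n^(2H)\<close> grows by
  \<open>2 H z^(2H - 1)\<close> at an intermediate point \<open>z\<close>, and for
  \<open>H \<le> 1/2\<close> this power is nonincreasing in \<open>z\<close>.\<close>

lemma sum_powr_le_powr:
  fixes H :: real
  assumes "0 < H" "H \<le> 1/2"
  shows "(\<Sum>j=1..n. 2 * H * real j powr (2 * H - 1)) \<le> real n powr (2 * H)"
proof (induction n)
  case 0 then show ?case by simp
next
  case (Suc n)
  have "2 * H * real (Suc n) powr (2 * H - 1) \<le> real (Suc n) powr (2 * H) - real n powr (2 * H)"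
  proof (cases "n = 0")
    case True then show ?thesis using assms by simp
  next
    case False
    have "\<exists>z. real n < z \<and> z < real (Suc n) \<and>
        real (Suc n) powr (2 * H) - real n powr (2 * H) = (real (Suc n) - real n) * (2 * H * z powr (2 * H - 1))"
      using False by (intro MVT2) (auto intro!: derivative_eq_intros simp: powr_diff)
    then obtain z where z: "real n < z" "z < real (Suc n)"
        "real (Suc n) powr (2 * H) - real n powr (2 * H) = 2 * H * z powr (2 * H - 1)" by auto
    have "real (Suc n) powr (2 * H - 1) \<le> z powr (2 * H - 1)"
      using z(1,2) assms False by (intro powr_mono2') auto
    then show ?thesis unfolding z(3) using assms by (intro mult_left_mono) auto
  qed
  then show ?case using Suc.IH by simp
qed

text \<open>For \<open>0 < j < a\<close> the square of the kernel difference is at most the difference of the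
  squares, and these differences telescope.\<close>

lemma KH_increment_square_sum_le:
  fixes H :: real and a b N :: nat
  assumes H: "0 < H" "H \<le> 1/2" and ab: "a \<le> b" and N: "N > 0"
  shows "(\<Sum>j<b. (KH H (real j / real N) (real b / real N) - KH H (real j / real N) (real a / real N))\<^sup>2) / real N
           \<le> 2 * ((real b - real a) / real N) powr (2 * H)"
proof -
  \<comment> \<open>The squared kernel depends only on the distance between its arguments: it equals
    \<open>\<nu> * c (d - j)\<close>, where \<open>\<nu>\<close> carries the grid size.\<close>
  define c where "c j = 2 * H * real j powr (2 * H - 1)" for j :: nat
  define S where "S n = (\<Sum>j=1..n. c j)" for n
  define K where "K j d = KH H (real j / real N) (real d / real N)" for j d :: nat
  define \<nu> where "\<nu> = real N powr (1 - 2 * H)"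
  have c0: "c j \<ge> 0" for j using H by (simp add: c_def)
  have \<nu>0: "\<nu> \<ge> 0" by (simp add: \<nu>_def)
  have K0: "K j d \<ge> 0" for j d using H by (simp add: K_def KH_def)
  have Ksq: "(K j d)\<^sup>2 = \<nu> * c (d - j)" if "0 < j" "j < d" for j d
  proof -
    have "(K j d)\<^sup>2 = 2 * H * ((real d / real N - real j / real N) powr (H - 1/2))\<^sup>2"
      using that N H by (simp add: K_def KH_def divide_strict_right_mono power_mult_distrib)
    also have "((real d / real N - real j / real N) powr (H - 1/2))\<^sup>2 = (real (d - j) / real N) powr (2 * H - 1)"
      using that N by (simp add: powr_realpow[symmetric] powr_powr powr_power of_nat_diff diff_divide_distrib mult.commute)
    also have "\<dots> = real (d - j) powr (2 * H - 1) / real N powr (2 * H - 1)"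
      using that N by (simp add: powr_divide)
    also have "\<dots> = \<nu> * real (d - j) powr (2 * H - 1)"
      using N by (simp add: \<nu>_def powr_diff field_simps)
    finally show ?thesis by (simp add: c_def)
  qed
  \<comment> \<open>The kernel is zero at time 0 as well, so the sums effectively start at
    \<open>j = 1\<close>.\<close>
  have Kz: "K j d = 0" if "\<not> (0 < j \<and> j < d)" for j d
    using that N by (auto simp: K_def KH_def divide_strict_right_mono field_simps)
  have Kmono: "K j b \<le> K j a" if "0 < j" "j < a" for j
  proof -
    have "(real b / real N - real j / real N) powr (H - 1/2) \<le> (real a / real N - real j / real N) powr (H - 1/2)"
      using that ab H N by (intro powr_mono2') (auto simp: divide_strict_right_mono divide_right_mono)
    then show ?thesis using that ab N H by (simp add: K_def KH_def divide_strict_right_mono mult_left_mono)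
  qed
  have reindex: "(\<Sum>j\<in>{l..<u}. c (d - j)) = (\<Sum>j\<in>{d-u<..d-l}. c j)" if "u \<le> d" for l u d
    using that by (intro sum.reindex_bij_witness[of _ "\<lambda>i. d - i" "\<lambda>i. d - i"]) auto
  have S: "(\<Sum>j\<in>{k<..n}. c j) = S n - S k" if "k \<le> n" for k n
  proof -
    have "S n = S k + (\<Sum>j\<in>{k<..n}. c j)"
      unfolding S_def using that
      by (subst sum.union_disjoint[symmetric]) (auto intro!: sum.cong)
    then show ?thesis by simp
  qed
  have Smono: "S k \<le> S n" if "k \<le> n" for k n
    unfolding S_def using that c0 by (intro sum_mono2) auto
  have "(\<Sum>j<b. (K j b - K j a)\<^sup>2) = (\<Sum>j\<in>{..<a}. (K j b - K j a)\<^sup>2) + (\<Sum>j\<in>{a..<b}. (K j b - K j a)\<^sup>2)"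
    using ab by (subst sum.union_disjoint[symmetric]) (auto intro!: sum.cong)
  also have "(\<Sum>j\<in>{..<a}. (K j b - K j a)\<^sup>2) = (\<Sum>j\<in>{1..<a}. (K j b - K j a)\<^sup>2)"
    by (rule sum.mono_neutral_right) (auto simp: Kz not_le)
  also have "\<dots> \<le> (\<Sum>j\<in>{1..<a}. \<nu> * c (a - j) - \<nu> * c (b - j))"
  proof (rule sum_mono)
    fix j assume j: "j \<in> {1..<a}"
    have "(K j b - K j a)\<^sup>2 = (K j a - K j b) * (K j a - K j b)" by (simp add: power2_eq_square algebra_simps)
    also have "\<dots> \<le> (K j a - K j b) * (K j a + K j b)"
      using Kmono[of j] K0[of j b] j by (intro mult_left_mono) auto
    also have "\<dots> = (K j a)\<^sup>2 - (K j b)\<^sup>2" by (simp add: power2_eq_square algebra_simps)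
    finally show "(K j b - K j a)\<^sup>2 \<le> \<nu> * c (a - j) - \<nu> * c (b - j)"
      using Ksq[of j a] Ksq[of j b] j ab by simp
  qed
  also have "\<dots> = \<nu> * (\<Sum>j\<in>{1..<a}. c (a - j)) - \<nu> * (\<Sum>j\<in>{1..<a}. c (b - j))"
    by (simp add: sum_subtractf sum_distrib_left)
  also have "(\<Sum>j\<in>{a..<b}. (K j b - K j a)\<^sup>2) \<le> (\<Sum>j\<in>{a..<b}. \<nu> * c (b - j))"
  proof (rule sum_mono)
    fix j assume j: "j \<in> {a..<b}"
    then have "K j a = 0" by (intro Kz) auto
    then show "(K j b - K j a)\<^sup>2 \<le> \<nu> * c (b - j)"
      using Ksq[of j b] Kz[of j b] j c0[of "b - j"] \<nu>0 by (cases "j = 0") auto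
  qed
  also have "\<dots> = \<nu> * (\<Sum>j\<in>{a..<b}. c (b - j))" by (simp add: sum_distrib_left)
  also have "(\<Sum>j\<in>{a..<b}. c (b - j)) = S (b - a)"
    using S[of 0 "b - a"] by (subst reindex) (auto simp: S_def)
  \<comment> \<open>Counted by distance, the block below \<open>a\<close> contributes
    \<open>S (a - 1) - S (b - 1) + S (b - a)\<close>, at most \<open>S (b - a)\<close> because
    \<open>S\<close> is monotone; the block from \<open>a\<close> to \<open>b\<close> contributes
    \<open>S (b - a)\<close> again. Hence the factor 2. The case \<open>a = 0\<close> is separate
    since \<open>a - 1\<close> is truncated.\<close>
  also have "\<nu> * (\<Sum>j\<in>{1..<a}. c (a - j)) - \<nu> * (\<Sum>j\<in>{1..<a}. c (b - j)) + \<nu> * S (b - a) \<le> \<nu> * (2 * S (b - a))"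
  proof (cases "a = 0")
    case True
    then show ?thesis using \<nu>0 Smono[of 0 "b - a"] by (simp add: S_def)
  next
    case False
    then have "(\<Sum>j\<in>{1..<a}. c (a - j)) = S (a - 1)"
      using S[of 0 "a - 1"] by (subst reindex) (auto simp: S_def)
    moreover have "(\<Sum>j\<in>{1..<a}. c (b - j)) = S (b - 1) - S (b - a)"
      using S[of "b - a" "b - 1"] ab False by (subst reindex) auto
    ultimately have "(\<Sum>j\<in>{1..<a}. c (a - j)) - (\<Sum>j\<in>{1..<a}. c (b - j)) + S (b - a) \<le> 2 * S (b - a)"
      using Smono[of "a - 1" "b - 1"] ab by simp
    then show ?thesis using \<nu>0 by (auto simp: right_diff_distrib[symmetric] distrib_left[symmetric] intro!: mult_left_mono simp del: mult_le_cancel_left)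
  qed
  also have "\<nu> * (2 * S (b - a)) \<le> \<nu> * (2 * real (b - a) powr (2 * H))"
    unfolding S_def c_def using \<nu>0 by (intro mult_left_mono sum_powr_le_powr H) auto
  finally have "(\<Sum>j<b. (K j b - K j a)\<^sup>2) / real N \<le> \<nu> * (2 * real (b - a) powr (2 * H)) / real N"
    by (simp add: divide_right_mono)
  also have "\<dots> = 2 * ((real b - real a) / real N) powr (2 * H)"
    using ab N by (simp add: \<nu>_def powr_divide powr_diff of_nat_diff)
  finally show ?thesis unfolding K_def .
qed

subsection \<open>Convergence in probability\<close>

lemma conv_in_prob_subseq:
  assumes "conv_in_prob M S X" "filterlim r at_top sequentially"
  shows "conv_in_prob M (\<lambda>n. S (r n)) X"
  unfolding conv_in_prob_def
proof (intro allI impI)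
  fix \<epsilon> :: real assume "\<epsilon> > 0"
  then have "(\<lambda>n. measure M {\<omega>\<in>space M. \<bar>S n \<omega> - X \<omega>\<bar> > \<epsilon>}) \<longlonglongrightarrow> 0"
    using assms(1) by (auto simp: conv_in_prob_def)
  from filterlim_compose[OF this assms(2)]
  show "(\<lambda>n. measure M {\<omega>\<in>space M. \<bar>S (r n) \<omega> - X \<omega>\<bar> > \<epsilon>}) \<longlonglongrightarrow> 0" .
qed

context prob_space
begin

text \<open>A single subsequence has to serve all indices, because limits are later taken inside
  identities that tie them together. \<open>r k\<close> makes the total exceptional probability less
  than \<open>(1/2)^k\<close>, and the Borel-Cantelli lemma applies.\<close>

lemma conv_in_prob_AE_subseq:
  fixes S :: "'i \<Rightarrow> nat \<Rightarrow> 'a \<Rightarrow> real"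
  assumes I: "finite I"
    and S [measurable]: "\<And>i n. i \<in> I \<Longrightarrow> S i n \<in> borel_measurable M"
    and X [measurable]: "\<And>i. i \<in> I \<Longrightarrow> X i \<in> borel_measurable M"
    and conv: "\<And>i. i \<in> I \<Longrightarrow> conv_in_prob M (S i) (X i)"
  shows "\<exists>r::nat\<Rightarrow>nat. strict_mono r \<and> (AE \<omega> in M. \<forall>i\<in>I. (\<lambda>n. S i (r n) \<omega>) \<longlonglongrightarrow> X i \<omega>)"
proof -
  define B where "B i k n = {\<omega>\<in>space M. \<bar>S i n \<omega> - X i \<omega>\<bar> > (1/2)^k}" for i k n
  define Q where "Q k n \<longleftrightarrow> (\<Sum>i\<in>I. prob (B i k n)) < (1/2)^k" for k n
  have ev: "eventually (Q k) sequentially" for k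
  proof -
    have "(\<lambda>n. \<Sum>i\<in>I. prob (B i k n)) \<longlonglongrightarrow> (\<Sum>i\<in>I. 0)"
      unfolding B_def using conv by (intro tendsto_sum) (auto simp: conv_in_prob_def)
    then show ?thesis unfolding Q_def by (intro order_tendstoD(2)) auto
  qed
  have "\<exists>r. \<forall>k. Q k (r k) \<and> r k < r (Suc k)"
  proof (rule dependent_nat_choice)
    show "\<exists>n. Q 0 n" using eventually_happens[OF ev[of 0]] by auto
    fix m k :: nat
    have "eventually (\<lambda>n. Q (Suc k) n \<and> m < n) sequentially"
      using ev[of "Suc k"] eventually_gt_at_top[of m] by (rule eventually_conj)
    then show "\<exists>n. Q (Suc k) n \<and> m < n" using eventually_happens by force
  qed
  then obtain r where r: "\<And>k. Q k (r k)" "\<And>k. r k < r (Suc k)" by auto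
  have "AE \<omega> in M. (\<lambda>n. S i (r n) \<omega>) \<longlonglongrightarrow> X i \<omega>" if i: "i \<in> I" for i
  proof -
    have meas: "B i k n \<in> sets M" for k n
      unfolding B_def using S[OF i] X[OF i] by measurable
    have le: "prob (B i k (r k)) \<le> (1/2)^k" for k
    proof -
      have "prob (B i k (r k)) \<le> (\<Sum>i\<in>I. prob (B i k (r k)))"
        using i I by (intro member_le_sum) auto
      then show ?thesis using r(1)[of k] by (simp add: Q_def)
    qed
    have "AE \<omega> in M. eventually (\<lambda>k. \<omega> \<in> space M - B i k (r k)) sequentially"
    proof (rule borel_cantelli_AE1)
      show "summable (\<lambda>k. prob (B i k (r k)))"
        by (rule summable_comparison_test'[of "\<lambda>k. (1/2::real)^k"]) (use le in auto)
    qed (use meas in \<open>auto simp: less_top[symmetric]\<close>)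
    then show ?thesis
    proof eventually_elim
      case (elim \<omega>)
      have "(\<lambda>k. S i (r k) \<omega> - X i \<omega>) \<longlonglongrightarrow> 0"
      proof (rule Lim_null_comparison)
        show "eventually (\<lambda>k. norm (S i (r k) \<omega> - X i \<omega>) \<le> (1/2)^k) sequentially"
          using elim by eventually_elim (auto simp: B_def)
        show "(\<lambda>k. (1/2::real)^k) \<longlonglongrightarrow> 0" by (rule LIMSEQ_power_zero) auto
      qed
      then show ?case by (rule LIM_zero_cancel)
    qed
  qed
  then have "AE \<omega> in M. \<forall>i\<in>I. (\<lambda>n. S i (r n) \<omega>) \<longlonglongrightarrow> X i \<omega>"
    using I by (intro AE_finite_allI) auto
  then show ?thesis using r(2) by (auto intro!: exI[of _ r] simp: strict_mono_Suc_iff)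
qed

end

text \<open>By Fatou's lemma a moment bound survives an almost sure limit, with no uniform
  integrability to check.\<close>

lemma nn_integral_power_lim_le:
  fixes Y :: "nat \<Rightarrow> 'a \<Rightarrow> real"
  assumes [measurable]: "\<And>n. Y n \<in> borel_measurable M"
    and lim: "AE \<omega> in M. (\<lambda>n. Y n \<omega>) \<longlonglongrightarrow> Z \<omega>"
    and le: "\<And>n. (\<integral>\<^sup>+\<omega>. ennreal (Y n \<omega> ^ p) \<partial>M) \<le> C"
  shows "(\<integral>\<^sup>+\<omega>. ennreal (Z \<omega> ^ p) \<partial>M) \<le> C"
proof -
  have "(\<integral>\<^sup>+\<omega>. ennreal (Z \<omega> ^ p) \<partial>M) = (\<integral>\<^sup>+\<omega>. liminf (\<lambda>n. ennreal (Y n \<omega> ^ p)) \<partial>M)"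
  proof (rule nn_integral_cong_AE, use lim in eventually_elim)
    case (elim \<omega>)
    then have "(\<lambda>n. ennreal (Y n \<omega> ^ p)) \<longlonglongrightarrow> ennreal (Z \<omega> ^ p)"
      by (intro tendsto_ennrealI tendsto_power)
    then show ?case by (intro lim_imp_Liminf[symmetric]) auto
  qed
  also have "\<dots> \<le> liminf (\<lambda>n. \<integral>\<^sup>+\<omega>. ennreal (Y n \<omega> ^ p) \<partial>M)"
    by (rule nn_integral_liminf) measurable
  also have "\<dots> \<le> C"
    by (rule Liminf_le) (use le in auto)
  finally show ?thesis .
qed

subsection \<open>The dyadic grid of the two Brownian motions\<close>

text \<open>For finitely many variables independence is tested on one event per variable, and such
  an intersection splits into a block for \<open>A\<close> and a block for \<open>B\<close>.\<close>

lemma (in prob_space) indep_vars_append: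
  fixes A B :: "nat \<Rightarrow> 'a \<Rightarrow> real"
  assumes A: "indep_vars (\<lambda>_. borel) A {..<N}" and B: "indep_vars (\<lambda>_. borel) B {..<N}" and N: "N > 0"
    and AB: "\<And>E F. (\<And>j. j < N \<Longrightarrow> E j \<in> sets borel) \<Longrightarrow> (\<And>j. j < N \<Longrightarrow> F j \<in> sets borel) \<Longrightarrow>
       prob ((\<Inter>j<N. A j -` E j \<inter> space M) \<inter> (\<Inter>j<N. B j -` F j \<inter> space M)) =
       prob (\<Inter>j<N. A j -` E j \<inter> space M) * prob (\<Inter>j<N. B j -` F j \<inter> space M)"
  shows "indep_vars (\<lambda>_. borel) (\<lambda>k. if k < N then A k else B (k - N)) {..<2*N}"
proof -
  let ?X = "\<lambda>k. if k < N then A k else B (k - N)"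
  have rv: "A k \<in> borel_measurable M" "B k \<in> borel_measurable M" if "k < N" for k
    using A B that by (auto simp: indep_vars_def)
  have rvX: "?X k \<in> borel_measurable M" if "k < 2*N" for k
    using rv that by auto
  have "indep_sets (\<lambda>i. {?X i -` E \<inter> space M |E. E \<in> sets borel}) {..<2*N}"
  proof (subst indep_sets_finite)
    show "{?X i -` E \<inter> space M |E. E \<in> sets borel} \<subseteq> events" if "i \<in> {..<2*N}" for i
      using rvX[of i] that by (auto intro: measurable_sets)
    show "space M \<in> {?X i -` E \<inter> space M |E. E \<in> sets borel}" for i
      by (rule CollectI, rule exI[of _ UNIV]) auto
    show "\<forall>D\<in>Pi {..<2*N} (\<lambda>i. {?X i -` E \<inter> space M |E. E \<in> sets borel}).
        prob (\<Inter> (D ` {..<2*N})) = (\<Prod>j<2*N. prob (D j))"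
    proof
      fix D assume D: "D \<in> Pi {..<2*N} (\<lambda>i. {?X i -` E \<inter> space M |E. E \<in> sets borel})"
      then have "\<forall>i\<in>{..<2*N}. \<exists>E. D i = ?X i -` E \<inter> space M \<and> E \<in> sets borel"
        by (auto simp: Pi_iff)
      then obtain E where E: "\<And>i. i < 2*N \<Longrightarrow> D i = ?X i -` E i \<inter> space M" "\<And>i. i < 2*N \<Longrightarrow> E i \<in> sets borel"
        using bchoice[of "{..<2*N}"] by (metis lessThan_iff)
      have D1: "D j = A j -` E j \<inter> space M" if "j < N" for j
        using E(1)[of j] that by auto
      have D2: "D (N + j) = B j -` E (N + j) \<inter> space M" if "j < N" for j
        using E(1)[of "N + j"] that by auto
      have split: "{..<2*N} = {..<N} \<union> (\<lambda>j. N + j) ` {..<N}"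
      proof (intro set_eqI iffI)
        fix x assume "x \<in> {..<2*N}"
        then show "x \<in> {..<N} \<union> (\<lambda>j. N + j) ` {..<N}"
          by (cases "x < N") (auto intro!: image_eqI[of _ _ "x - N"])
      qed auto
      have "(\<Inter> (D ` {..<2*N})) = (\<Inter>j<N. A j -` E j \<inter> space M) \<inter> (\<Inter>j<N. B j -` E (N + j) \<inter> space M)"
      proof -
        have "(\<Inter> (D ` {..<2*N})) = (\<Inter>j<N. D j) \<inter> (\<Inter>j<N. D (N + j))" unfolding split by auto
        also have "\<dots> = (\<Inter>j<N. A j -` E j \<inter> space M) \<inter> (\<Inter>j<N. B j -` E (N + j) \<inter> space M)"
          using D1 D2 by (intro arg_cong2[of _ _ _ _ "(\<inter>)"] INF_cong) auto
        finally show ?thesis .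
      qed
      also have "prob \<dots> = prob (\<Inter>j<N. A j -` E j \<inter> space M) * prob (\<Inter>j<N. B j -` E (N + j) \<inter> space M)"
        using E(2) by (intro AB) auto
      also have "prob (\<Inter>j<N. A j -` E j \<inter> space M) = (\<Prod>j<N. prob (A j -` E j \<inter> space M))"
        using N E(2) by (intro indep_varsD_finite[OF A]) auto
      also have "prob (\<Inter>j<N. B j -` E (N + j) \<inter> space M) = (\<Prod>j<N. prob (B j -` E (N + j) \<inter> space M))"
        using N E(2) by (intro indep_varsD_finite[OF B]) auto
      also have "(\<Prod>j<N. prob (A j -` E j \<inter> space M)) * (\<Prod>j<N. prob (B j -` E (N + j) \<inter> space M)) = (\<Prod>j<2*N. prob (D j))"
        unfolding split by (subst prod.union_disjoint) (auto simp: prod.reindex D1 D2 intro!: arg_cong2[of _ _ _ _ "(*)"] prod.cong)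
      finally show "prob (\<Inter> (D ` {..<2*N})) = (\<Prod>j<2*N. prob (D j))" .
    qed
  qed (use N in \<open>auto simp: lessThan_empty_iff\<close>)
  then show ?thesis
    unfolding indep_vars_def2 using rvX by auto
qed

text \<open>The flag \<open>e\<close> selects the driving Brownian motion, \<open>Wb\<close> for
  true and \<open>W\<close> for false, so both families of integrals are treated together. The
  results of this locale concern fixed times; continuity of \<open>Wh\<close> and \<open>WW\<close>
  is added in a later locale.\<close>

locale ito_model = prob_space P for P :: "'a measure" +
  fixes H :: real and M :: nat
    and W Wb Wh :: "real \<Rightarrow> 'a \<Rightarrow> real"
    and WW :: "bool \<Rightarrow> nat \<Rightarrow> real \<Rightarrow> real \<Rightarrow> 'a \<Rightarrow> real"
  assumes H: "0 < H" "H \<le> 1/2"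
    and BM: "std_BM P W" "std_BM P Wb" "indep_processes P W Wb"
    and Wh_meas: "t \<in> {0..1} \<Longrightarrow> Wh t \<in> borel_measurable P"
    and Wh_int: "t \<in> {0..1} \<Longrightarrow> conv_in_prob P (\<lambda>n. riemann_sum (\<lambda>s \<omega>. KH H s t) W 0 t n) (Wh t)"
    and WW_meas: "m \<in> {1..M} \<Longrightarrow> 0 \<le> s \<Longrightarrow> s < t \<Longrightarrow> t \<le> 1 \<Longrightarrow> WW e m s t \<in> borel_measurable P"
    and WW_int: "m \<in> {1..M} \<Longrightarrow> 0 \<le> s \<Longrightarrow> s < t \<Longrightarrow> t \<le> 1 \<Longrightarrow>
      conv_in_prob P (\<lambda>n. riemann_sum (\<lambda>r \<omega>. (Wh r \<omega> - Wh s \<omega>) ^ m) (if e then Wb else W) s t n) (WW e m s t)"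
begin

definition bm :: "bool \<Rightarrow> real \<Rightarrow> 'a \<Rightarrow> real" where
  "bm e = (if e then Wb else W)"

text \<open>The increments of \<open>W\<close> are listed before those of \<open>Wb\<close>, so that the whole path of \<open>W\<close>
  belongs to the past in integrals against \<open>Wb\<close>.\<close>

definition grid_inc :: "nat \<Rightarrow> nat \<Rightarrow> 'a \<Rightarrow> real" where
  "grid_inc n k = (if k < 2^n then (\<lambda>\<omega>. W (real (Suc k) / 2^n) \<omega> - W (real k / 2^n) \<omega>)
     else (\<lambda>\<omega>. Wb (real (Suc (k - 2^n)) / 2^n) \<omega> - Wb (real (k - 2^n) / 2^n) \<omega>))"

definition offset :: "bool \<Rightarrow> nat \<Rightarrow> nat" where
  "offset e n = (if e then 2^n else 0)"

lemma std_BM_bm: "std_BM P (bm e)"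
  using BM by (simp add: bm_def)

lemma bm_meas: "t \<in> {0..1} \<Longrightarrow> bm e t \<in> borel_measurable P"
  using std_BM_bm[of e] by (auto simp: std_BM_def)

lemma grid_inc_offset: "k < 2^n \<Longrightarrow> grid_inc n (offset e n + k) \<omega> = bm e (real (Suc k) / 2^n) \<omega> - bm e (real k / 2^n) \<omega>"
  by (auto simp: grid_inc_def offset_def bm_def)

lemma dyadic_increments:
  assumes "std_BM P X"
  shows "indep_vars (\<lambda>_. borel) (\<lambda>k \<omega>. X (real (Suc k) / 2^n) \<omega> - X (real k / 2^n) \<omega>) {..<2^n}"
    and "k < 2^n \<Longrightarrow> distributed P lborel (\<lambda>\<omega>. X (real (Suc k) / 2^n) \<omega> - X (real k / 2^n) \<omega>)
      (\<lambda>x. ennreal (normal_density 0 (sqrt (1 / 2^n)) x))"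
proof -
  have gen: "\<forall>(N::nat) (tt::nat \<Rightarrow> real). tt 0 \<ge> 0 \<and> tt N \<le> 1 \<and> (\<forall>k<N. tt k < tt (Suc k)) \<longrightarrow>
        indep_vars (\<lambda>_. borel) (\<lambda>k \<omega>. X (tt (Suc k)) \<omega> - X (tt k) \<omega>) {..<N} \<and>
        (\<forall>k<N. distributed P lborel (\<lambda>\<omega>. X (tt (Suc k)) \<omega> - X (tt k) \<omega>)
                 (\<lambda>x. ennreal (normal_density 0 (sqrt (tt (Suc k) - tt k)) x)))"
    using assms unfolding std_BM_def by blast
  let ?tt = "\<lambda>k::nat. real k / 2^n"
  have *: "?tt (Suc k) - ?tt k = 1 / 2^n" for k by (simp add: field_simps)
  have "?tt 0 \<ge> 0 \<and> ?tt (2^n) \<le> 1 \<and> (\<forall>k<2^n. ?tt k < ?tt (Suc k))"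
    by (auto simp: divide_strict_right_mono)
  from gen[rule_format, OF this]
  show "indep_vars (\<lambda>_. borel) (\<lambda>k \<omega>. X (real (Suc k) / 2^n) \<omega> - X (real k / 2^n) \<omega>) {..<2^n}"
    and "k < 2^n \<Longrightarrow> distributed P lborel (\<lambda>\<omega>. X (real (Suc k) / 2^n) \<omega> - X (real k / 2^n) \<omega>)
      (\<lambda>x. ennreal (normal_density 0 (sqrt (1 / 2^n)) x))"
    unfolding * by blast+
qed

lemma distributed_grid_inc:
  assumes "k < 2 * 2^n"
  shows "distributed P lborel (grid_inc n k) (\<lambda>x. ennreal (normal_density 0 (sqrt (1 / 2^n)) x))"
proof (cases "k < 2^n")
  case True
  then show ?thesis using dyadic_increments(2)[OF BM(1), of k n] by (simp add: grid_inc_def)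
next
  case False
  then show ?thesis using dyadic_increments(2)[OF BM(2), of "k - 2^n" n] assms by (simp add: grid_inc_def)
qed

text \<open>Independence of the two path maps is applied to the cylinder sets \<open>?D E\<close>,
  which constrain finitely many coordinates and hence lie in the product sigma-algebra; their
  preimages are the events about increments.\<close>

lemma indep_grid_inc: "indep_vars (\<lambda>_. borel) (grid_inc n) {..<2 * 2^n}"
proof -
  let ?I = "\<lambda>X k \<omega>. X (real (Suc k) / 2^n) \<omega> - X (real k / 2^n) (\<omega>::'a) :: real"
  let ?S = "Pi\<^sub>M UNIV (\<lambda>_::real. borel :: real measure)"
  have "indep_vars (\<lambda>_. borel) (\<lambda>k. if k < 2^n then ?I W k else ?I Wb (k - 2^n)) {..<2 * 2^n}"
  proof (rule indep_vars_append)
    fix E F :: "nat \<Rightarrow> real set"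
    assume [measurable]: "\<And>j. j < 2^n \<Longrightarrow> E j \<in> sets borel" "\<And>j. j < 2^n \<Longrightarrow> F j \<in> sets borel"
    let ?D = "\<lambda>E. {w \<in> space ?S. \<forall>j\<in>{..<2^n}. w (real (Suc j) / 2^n) - w (real j / 2^n) \<in> E j}"
    have D: "?D E \<in> sets ?S" if [measurable]: "\<And>j. j < 2^n \<Longrightarrow> E j \<in> sets borel" for E :: "nat \<Rightarrow> real set"
    proof (rule sets.sets_Collect_finite_All')
      fix j :: nat assume "j \<in> {..<2^n}"
      then have [measurable]: "E j \<in> sets borel" using that by simp
      show "{w \<in> space ?S. w (real (Suc j) / 2^n) - w (real j / 2^n) \<in> E j} \<in> sets ?S"
        by measurable
    qed (auto simp: lessThan_empty_iff)
    have *: "(\<lambda>\<omega> t. X t \<omega>) -` ?D E \<inter> space P = (\<Inter>j<2^n. ?I X j -` E j \<inter> space P)" for X E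
      by (auto simp: space_PiM lessThan_empty_iff)
    have "prob ((\<lambda>\<omega>. (\<lambda>t. W t \<omega>, \<lambda>t. Wb t \<omega>)) -` (?D E \<times> ?D F) \<inter> space P)
        = prob ((\<lambda>\<omega> t. W t \<omega>) -` ?D E \<inter> space P) * prob ((\<lambda>\<omega> t. Wb t \<omega>) -` ?D F \<inter> space P)"
      using BM(3) unfolding indep_processes_def by (intro indep_varD[of ?S _ ?S] D) auto
    also have "(\<lambda>\<omega>. (\<lambda>t. W t \<omega>, \<lambda>t. Wb t \<omega>)) -` (?D E \<times> ?D F) \<inter> space P
        = ((\<lambda>\<omega> t. W t \<omega>) -` ?D E \<inter> space P) \<inter> ((\<lambda>\<omega> t. Wb t \<omega>) -` ?D F \<inter> space P)" by blast
    finally show "prob ((\<Inter>j<2^n. ?I W j -` E j \<inter> space P) \<inter> (\<Inter>j<2^n. ?I Wb j -` F j \<inter> space P)) =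
       prob (\<Inter>j<2^n. ?I W j -` E j \<inter> space P) * prob (\<Inter>j<2^n. ?I Wb j -` F j \<inter> space P)"
      unfolding * .
  qed (use dyadic_increments(1) BM in auto)
  then show ?thesis unfolding grid_inc_def .
qed

text \<open>The Riemann sum with \<open>i\<close> pieces for \<open>Wh\<close> at time
  \<open>i / 2^n\<close>, written in the grid increments so that its adaptedness is visible.\<close>

definition wh_approx :: "nat \<Rightarrow> nat \<Rightarrow> 'a \<Rightarrow> real" where
  "wh_approx n i \<omega> = (\<Sum>j<i. KH H (real j / 2^n) (real i / 2^n) * grid_inc n j \<omega>)"

lemma wh_approx_past: "i \<le> k \<Longrightarrow> wh_approx n i \<in> borel_measurable (past_algebra P (grid_inc n) k)"
  unfolding wh_approx_def
  by (intro borel_measurable_sum borel_measurable_times borel_measurable_const measurable_past_algebra) auto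

lemma grid_inc_meas: "k < 2 * 2^n \<Longrightarrow> grid_inc n k \<in> borel_measurable P"
  using indep_grid_inc[of n] by (auto simp: indep_vars_def)

lemma wh_approx_meas: "i \<le> 2^n \<Longrightarrow> wh_approx n i \<in> borel_measurable P"
  unfolding wh_approx_def
  by (intro borel_measurable_sum borel_measurable_times borel_measurable_const grid_inc_meas) auto

lemma wh_approx_eq_riemann_sum:
  assumes "i \<le> 2^n"
  shows "wh_approx n i = riemann_sum (\<lambda>s \<omega>. KH H s (real i / 2^n)) W 0 (real i / 2^n) i"
proof
  fix \<omega>
  show "wh_approx n i \<omega> = riemann_sum (\<lambda>s \<omega>. KH H s (real i / 2^n)) W 0 (real i / 2^n) i \<omega>"
    unfolding wh_approx_def riemann_sum_def
    using assms by (intro sum.cong) (auto simp: grid_inc_def)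
qed

text \<open>A martingale sum with deterministic coefficients: the kernel at \<open>a\<close>
  vanishes from \<open>j = a\<close> on, so both sums may run up to \<open>b\<close>. The constant 4
  is 2 from \<open>2 q - 1 \<le> 2 q\<close> times 2 from the kernel estimate.\<close>

lemma wh_approx_increment_moment_le:
  assumes ab: "a \<le> b" "b \<le> 2^n" and q: "q \<ge> 1"
  shows "(\<integral>\<^sup>+\<omega>. ennreal ((wh_approx n b \<omega> - wh_approx n a \<omega>)^(2*q)) \<partial>P)
    \<le> ennreal ((4 * real q * (real (b - a) / 2^n) powr (2 * H))^q)"
proof -
  define c where "c j = KH H (real j / 2^n) (real b / 2^n) - KH H (real j / 2^n) (real a / 2^n)" for j
  define T where "T = (real (b - a) / 2^n) powr (2 * H)"
  have eq: "wh_approx n b \<omega> - wh_approx n a \<omega> = (\<Sum>j<b. c j * grid_inc n (0 + j) \<omega>)" for \<omega>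
  proof -
    have "wh_approx n a \<omega> = (\<Sum>j<b. KH H (real j / 2^n) (real a / 2^n) * grid_inc n j \<omega>)"
      unfolding wh_approx_def using ab(1)
      by (intro sum.mono_neutral_left) (auto simp: KH_def field_simps not_less)
    then show ?thesis unfolding wh_approx_def[of n b] c_def by (simp add: sum_subtractf algebra_simps)
  qed
  have "(\<integral>\<^sup>+\<omega>. ennreal ((\<Sum>j<b. c j * grid_inc n (0 + j) \<omega>)^(2*q)) \<partial>P)
     \<le> ennreal (((2 * real q - 1) * (1 / 2^n) * (\<Sum>j<b. (c j)\<^sup>2))^q)"
    using ab q
    by (intro gaussian_martingale_moment_le[OF indep_grid_inc distributed_grid_inc])
       (auto simp: power_mult emeasure_space_1)
  also have "\<dots> \<le> ennreal ((4 * real q * T)^q)"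
  proof (rule ennreal_leI, rule power_mono)
    have "(\<Sum>j<b. (c j)\<^sup>2) / 2^n \<le> 2 * T"
      using KH_increment_square_sum_le[OF H ab(1), of "2^n"] ab(1)
      by (simp add: c_def T_def of_nat_diff)
    then have "(2 * real q - 1) * ((\<Sum>j<b. (c j)\<^sup>2) / 2^n) \<le> (2 * real q) * (2 * T)"
      using q by (intro mult_mono) (auto simp: sum_nonneg T_def)
    then show "(2 * real q - 1) * (1 / 2^n) * (\<Sum>j<b. (c j)\<^sup>2) \<le> 4 * real q * T" by simp
  qed (use q in \<open>auto intro!: divide_nonneg_pos mult_nonneg_nonneg sum_nonneg\<close>)
  finally show ?thesis unfolding eq T_def .
qed

lemma wh_approx_conv:
  assumes "k \<le> 2^l"
  shows "conv_in_prob P (\<lambda>i. wh_approx (l + i) (k * 2^i)) (Wh (real k / 2^l))"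
proof -
  let ?t = "real k / 2^l"
  let ?R = "riemann_sum (\<lambda>s \<omega>. KH H s ?t) W 0 ?t"
  have t: "?t \<in> {0..1}" using assms by (auto simp: field_simps)
  have kl: "k * 2^i \<le> 2^(l + i)" for i using assms by (simp add: power_add)
  have ti: "real (k * 2^i) / 2^(l + i) = ?t" for i by (simp add: power_add)
  have eq: "wh_approx (l + i) (k * 2^i) = ?R (k * 2^i)" for i
    using wh_approx_eq_riemann_sum[OF kl[of i]] unfolding ti .
  show ?thesis
  proof (cases "k = 0")
    \<comment> \<open>For \<open>k = 0\<close> the number \<open>k * 2^i\<close> of pieces does not
      grow, but every Riemann sum is zero, so any number of pieces may be substituted.\<close>
    case True
    have R0: "?R n = (\<lambda>\<omega>. 0)" for n unfolding True by (simp add: riemann_sum_def KH_def fun_eq_iff)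
    have "wh_approx (l + i) (k * 2^i) = ?R i" for i
      unfolding eq R0 ..
    then show ?thesis using Wh_int[OF t] by presburger
  next
    case False
    have "filterlim (\<lambda>i. k * 2^i) at_top sequentially"
      by (rule filterlim_subseq) (use False in \<open>auto simp: strict_mono_Suc_iff\<close>)
    from conv_in_prob_subseq[OF Wh_int[OF t] this] show ?thesis unfolding eq .
  qed
qed

end

subsection \<open>Iterated integrals over dyadic intervals\<close>

lemma dyadic_in_unit: "k \<le> 2^l \<Longrightarrow> real k / 2^l \<in> {0..1}"
  by (auto simp: field_simps)

context ito_model
begin

definition dyadic_sum :: "bool \<Rightarrow> nat \<Rightarrow> nat \<Rightarrow> nat \<Rightarrow> nat \<Rightarrow> 'a \<Rightarrow> real" where
  "dyadic_sum e l m a b \<omega> =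
    (\<Sum>k\<in>{a..<b}. (Wh (real k / 2^l) \<omega> - Wh (real a / 2^l) \<omega>) ^ m
        * (bm e (real (Suc k) / 2^l) \<omega> - bm e (real k / 2^l) \<omega>))"

text \<open>The bound for a squared \<open>L^(2q)\<close> norm: \<open>2 q\<close> comes from the
  integration against the Brownian motion, and \<open>(4 m q)^m\<close> from the \<open>m\<close>-th
  power of an increment of \<open>Wh\<close>, measured in \<open>L^(2mq)\<close>. For
  \<open>m = 0\<close> the power is 1.\<close>

definition moment_const :: "nat \<Rightarrow> nat \<Rightarrow> real" where
  "moment_const m q = 2 * real q * (4 * (real m * real q)) ^ m"

text \<open>\<open>Wh\<close> is only a limit in probability, so its values are not functions of
  finitely many increments. The integrand is therefore replaced by its approximation on a finer
  grid, and each coarse Brownian increment is split into \<open>2^i\<close> fine ones; with respect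
  to these the integrand is adapted.\<close>

lemma approx_sum_moment_le:
  assumes ab: "a \<le> b" "b \<le> 2^l" and q: "q \<ge> 1"
  shows "(\<integral>\<^sup>+\<omega>. ennreal ((\<Sum>k\<in>{a..<b}. (wh_approx (l + i) (k * 2^i) \<omega> - wh_approx (l + i) (a * 2^i) \<omega>) ^ m
        * (bm e (real (Suc k) / 2^l) \<omega> - bm e (real k / 2^l) \<omega>))^(2*q)) \<partial>P)
    \<le> ennreal ((moment_const m q * (real (b - a) / 2^l) powr (2 * H * real m + 1))^q)"
proof -
  define d :: nat where "d = 2^i"
  define n where "n = l + i"
  have d: "d > 0" by (simp add: d_def)
  have dn: "2^l * d = 2^n" by (simp add: d_def n_def power_add)
  define T where "T = real (b - a) / 2^l"
  have T0: "T \<ge> 0" by (simp add: T_def)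
  define f where "f j \<omega> = (wh_approx n ((a + j div d) * d) \<omega> - wh_approx n (a * d) \<omega>) ^ m" for j \<omega>
  define F where "F = (4 * (real m * real q) * T powr (2 * H)) ^ m"
  have F0: "F \<ge> 0" using q by (simp add: F_def)
  have rng: "(a + j div d) * d \<le> 2^n" "a + j div d < b" if "j < (b - a) * d" for j
  proof -
    have "j div d < b - a" using that d by (simp add: div_less_iff_less_mult)
    then show *: "a + j div d < b" by simp
    then have "(a + j div d) * d \<le> 2^l * d" using ab by (intro mult_right_mono) auto
    then show "(a + j div d) * d \<le> 2^n" by (simp add: dn)
  qed
  have binc: "bm e (real (Suc k) / 2^l) \<omega> - bm e (real k / 2^l) \<omega> = (\<Sum>j\<in>{k*d..<k*d+d}. grid_inc n (offset e n + j) \<omega>)"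
    if "k < 2^l" for k \<omega>
  proof -
    have lt: "j < 2^n" if "j < k*d + d" for j
    proof -
      have "Suc k * d \<le> 2^l * d" using \<open>k < 2^l\<close> by (intro mult_right_mono) auto
      then show ?thesis using that dn by (simp add: algebra_simps)
    qed
    have "(\<Sum>j\<in>{k*d..<k*d+d}. grid_inc n (offset e n + j) \<omega>)
       = (\<Sum>j\<in>{k*d..<k*d+d}. bm e (real (Suc j) / 2^n) \<omega> - bm e (real j / 2^n) \<omega>)"
      using lt by (intro sum.cong refl grid_inc_offset) auto
    also have "\<dots> = bm e (real (k*d+d) / 2^n) \<omega> - bm e (real (k*d) / 2^n) \<omega>"
      by (rule sum_Suc_diff') simp
    also have "real (k*d+d) / 2^n = real (Suc k) / 2^l"
      by (simp add: d_def n_def power_add field_simps)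
    also have "real (k*d) / 2^n = real k / 2^l"
      by (simp add: d_def n_def power_add)
    finally show ?thesis by simp
  qed
  have eq: "(\<Sum>k\<in>{a..<b}. (wh_approx n (k * d) \<omega> - wh_approx n (a * d) \<omega>) ^ m
        * (bm e (real (Suc k) / 2^l) \<omega> - bm e (real k / 2^l) \<omega>))
     = (\<Sum>j<(b-a)*d. f j \<omega> * grid_inc n ((offset e n + a*d) + j) \<omega>)" for \<omega>
  proof -
    have "(\<Sum>k\<in>{a..<b}. (wh_approx n (k * d) \<omega> - wh_approx n (a * d) \<omega>) ^ m
        * (bm e (real (Suc k) / 2^l) \<omega> - bm e (real k / 2^l) \<omega>))
      = (\<Sum>k<b-a. (wh_approx n ((a+k) * d) \<omega> - wh_approx n (a * d) \<omega>) ^ m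
        * (bm e (real (Suc (a+k)) / 2^l) \<omega> - bm e (real (a+k) / 2^l) \<omega>))"
      by (rule sum.reindex_bij_witness[of _ "\<lambda>k. a + k" "\<lambda>k. k - a"]) auto
    also have "\<dots> = (\<Sum>k<b-a. \<Sum>j\<in>{k*d..<k*d+d}. f j \<omega> * grid_inc n ((offset e n + a*d) + j) \<omega>)"
    proof (intro sum.cong refl)
      fix k assume k: "k \<in> {..<b-a}"
      have "(bm e (real (Suc (a+k)) / 2^l) \<omega> - bm e (real (a+k) / 2^l) \<omega>)
          = (\<Sum>j\<in>{(a+k)*d..<(a+k)*d+d}. grid_inc n (offset e n + j) \<omega>)"
        using k ab by (intro binc) auto
      also have "\<dots> = (\<Sum>j\<in>{k*d..<k*d+d}. grid_inc n ((offset e n + a*d) + j) \<omega>)"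
        by (rule sum.reindex_bij_witness[of _ "\<lambda>j. a*d + j" "\<lambda>j. j - a*d"]) (auto simp: algebra_simps)
      also have "(wh_approx n ((a+k) * d) \<omega> - wh_approx n (a * d) \<omega>) ^ m * \<dots>
          = (\<Sum>j\<in>{k*d..<k*d+d}. f j \<omega> * grid_inc n ((offset e n + a*d) + j) \<omega>)"
        unfolding sum_distrib_left
      proof (intro sum.cong refl)
        fix j assume "j \<in> {k*d..<k*d+d}"
        then have "j div d = k" using d by (intro div_nat_eqI) (auto simp: algebra_simps)
        then show "(wh_approx n ((a+k) * d) \<omega> - wh_approx n (a * d) \<omega>) ^ m * grid_inc n (offset e n + a * d + j) \<omega>
             = f j \<omega> * grid_inc n (offset e n + a * d + j) \<omega>" by (simp add: f_def)
      qed
      finally show "(wh_approx n ((a+k) * d) \<omega> - wh_approx n (a * d) \<omega>) ^ m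
        * (bm e (real (Suc (a+k)) / 2^l) \<omega> - bm e (real (a+k) / 2^l) \<omega>)
        = (\<Sum>j\<in>{k*d..<k*d+d}. f j \<omega> * grid_inc n ((offset e n + a*d) + j) \<omega>)" .
    qed
    also have "\<dots> = (\<Sum>j<(b-a)*d. f j \<omega> * grid_inc n ((offset e n + a*d) + j) \<omega>)"
      by (rule sum.nat_group)
    finally show ?thesis .
  qed
  have "(\<integral>\<^sup>+\<omega>. ennreal ((\<Sum>j<(b-a)*d. f j \<omega> * grid_inc n ((offset e n + a*d) + j) \<omega>)^(2*q)) \<partial>P)
      \<le> ennreal (((2 * real q - 1) * (1 / 2^n) * (\<Sum>j<(b-a)*d. F))^q)"
  proof (rule gaussian_martingale_moment_le[OF indep_grid_inc distributed_grid_inc])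
    fix j assume j: "j < (b-a)*d"
    \<comment> \<open>Adaptedness: the integrand is frozen at the left end of the coarse cell that
      contains the fine cell \<open>j\<close>, so it only sees earlier fine increments.\<close>
    have "(a + j div d) * d \<le> offset e n + a * d + j" 
      using div_times_less_eq_dividend[of j d] unfolding add_mult_distrib by linarith
    then show "f j \<in> borel_measurable (past_algebra P (grid_inc n) (offset e n + a * d + j))"
      unfolding f_def by (intro borel_measurable_power borel_measurable_diff wh_approx_past) auto
    show "(\<integral>\<^sup>+\<omega>. ennreal (f j \<omega> ^ (2*q)) \<partial>P) \<le> ennreal (F ^ q)"
    proof (cases "m = 0")
      case True
      then show ?thesis by (simp add: f_def F_def emeasure_space_1)
    next
      case False
      \<comment> \<open>The \<open>2q\<close>-th moment of an \<open>m\<close>-th power is a moment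
        of order \<open>2 (m q)\<close>; the estimate for increments needs
        \<open>m q \<ge> 1\<close>, whence the separate case \<open>m = 0\<close>.\<close>
      have "(\<integral>\<^sup>+\<omega>. ennreal (f j \<omega> ^ (2*q)) \<partial>P)
        = (\<integral>\<^sup>+\<omega>. ennreal ((wh_approx n ((a + j div d) * d) \<omega> - wh_approx n (a * d) \<omega>) ^ (2*(m*q))) \<partial>P)"
        by (simp add: f_def power_mult[symmetric] mult_ac)
      also have "\<dots> \<le> ennreal ((4 * real (m*q) * (real ((a + j div d) * d - a * d) / 2^n) powr (2 * H))^(m*q))"
        using False q rng[OF j] by (intro wh_approx_increment_moment_le) auto
      also have "\<dots> \<le> ennreal ((4 * real (m*q) * T powr (2 * H))^(m*q))"
      proof (intro ennreal_leI power_mono mult_left_mono powr_mono2)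
        have "(a + j div d) * d - a * d \<le> (b - a) * d"
        proof -
          have "j div d * d \<le> (b - a) * d" using rng(2)[OF j] by (intro mult_right_mono) auto
          then show ?thesis by (simp add: add_mult_distrib)
        qed
        then have "real ((a + j div d) * d - a * d) \<le> real (b - a) * real d"
          by (metis of_nat_le_iff of_nat_mult)
        then have "real ((a + j div d) * d - a * d) / 2^n \<le> real (b - a) * real d / 2^n"
          by (rule divide_right_mono) simp
        also have "\<dots> = T" by (simp add: T_def d_def n_def power_add)
        finally show "real ((a + j div d) * d - a * d) / 2^n \<le> T" .
        show "0 \<le> real ((a + j div d) * d - a * d) / 2^n" by (intro divide_nonneg_nonneg of_nat_0_le_iff) simp
      qed (use H in auto)
      finally show ?thesis by (simp add: F_def power_mult[symmetric] mult_ac)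
    qed
  next
    have "b * d \<le> 2^l * d" using ab by (intro mult_right_mono) auto
    then have "a * d + (b - a) * d \<le> 2^n"
      unfolding dn using ab by (simp add: add_mult_distrib[symmetric])
    then show "offset e n + a * d + (b - a) * d \<le> 2 * 2^n" by (auto simp: offset_def)
  qed (use q F0 in auto)
  also have "\<dots> \<le> ennreal ((moment_const m q * T powr (2 * H * real m + 1))^q)"
  proof (intro ennreal_leI power_mono)
    have Tm: "T powr (2 * H * real m + 1) = (T powr (2 * H)) ^ m * T"
      using T0 by (cases "T = 0") (auto simp: powr_add powr_powr[symmetric] powr_realpow)
    have "(1 / 2^n) * (\<Sum>j<(b-a)*d. F) = F * T"
      by (simp add: T_def d_def n_def power_add)
    then have "(2 * real q - 1) * (1 / 2^n) * (\<Sum>j<(b-a)*d. F) = (2 * real q - 1) * (F * T)"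
      by (simp only: mult.assoc)
    also have "\<dots> \<le> (2 * real q) * (F * T)"
      using F0 T0 by (intro mult_right_mono) auto
    also have "\<dots> = moment_const m q * T powr (2 * H * real m + 1)"
      unfolding Tm F_def moment_const_def by (simp only: power_mult_distrib mult_ac)
    finally show "(2 * real q - 1) * (1 / 2^n) * (\<Sum>j<(b-a)*d. F) \<le> moment_const m q * T powr (2 * H * real m + 1)" .
  qed (use q F0 in auto)
  finally have *: "(\<integral>\<^sup>+\<omega>. ennreal ((\<Sum>k\<in>{a..<b}. (wh_approx n (k * d) \<omega> - wh_approx n (a * d) \<omega>) ^ m
        * (bm e (real (Suc k) / 2^l) \<omega> - bm e (real k / 2^l) \<omega>))^(2*q)) \<partial>P)
     \<le> ennreal ((moment_const m q * T powr (2 * H * real m + 1))^q)"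
    unfolding eq .
  from *[unfolded d_def n_def T_def] show ?thesis .
qed

lemma dyadic_sum_meas:
  assumes "b \<le> 2^l" "a \<le> b"
  shows "dyadic_sum e l m a b \<in> borel_measurable P"
  unfolding dyadic_sum_def using assms
  by (intro borel_measurable_sum borel_measurable_times borel_measurable_power borel_measurable_diff Wh_meas bm_meas dyadic_in_unit) auto

text \<open>The level \<open>l\<close> stays fixed while the auxiliary refinement tends to infinity.
  Only finitely many values of \<open>Wh\<close> occur, so along one subsequence all of them are
  almost sure limits of \<open>wh_approx\<close>.\<close>

lemma dyadic_sum_moment_le:
  assumes ab: "a \<le> b" "b \<le> 2^l" and q: "q \<ge> 1"
  shows "(\<integral>\<^sup>+\<omega>. ennreal (dyadic_sum e l m a b \<omega> ^ (2*q)) \<partial>P)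
    \<le> ennreal ((moment_const m q * (real (b - a) / 2^l) powr (2 * H * real m + 1))^q)"
proof -
  have kl: "k * 2^i \<le> 2^(l+i)" if "k \<in> {a..b}" for k i using that ab by (simp add: power_add)
  have "\<exists>r. strict_mono r \<and> (AE \<omega> in P. \<forall>k\<in>{a..b}. (\<lambda>i. wh_approx (l + r i) (k * 2^r i) \<omega>) \<longlonglongrightarrow> Wh (real k / 2^l) \<omega>)"
    using ab by (intro conv_in_prob_AE_subseq[where S = "\<lambda>k i. wh_approx (l + i) (k * 2^i)"]
        wh_approx_meas kl Wh_meas dyadic_in_unit wh_approx_conv) auto
  then obtain r where r: "AE \<omega> in P. \<forall>k\<in>{a..b}. (\<lambda>i. wh_approx (l + r i) (k * 2^r i) \<omega>) \<longlonglongrightarrow> Wh (real k / 2^l) \<omega>"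
    by blast
  show ?thesis
  proof (rule nn_integral_power_lim_le[OF _ _ approx_sum_moment_le[OF ab q]])
    show "AE \<omega> in P. (\<lambda>i. \<Sum>k\<in>{a..<b}. (wh_approx (l + r i) (k * 2^r i) \<omega> - wh_approx (l + r i) (a * 2^r i) \<omega>) ^ m
        * (bm e (real (Suc k) / 2^l) \<omega> - bm e (real k / 2^l) \<omega>)) \<longlonglongrightarrow> dyadic_sum e l m a b \<omega>"
      using r
    proof eventually_elim
      case (elim \<omega>)
      then show ?case unfolding dyadic_sum_def
        by (intro tendsto_sum tendsto_mult tendsto_power tendsto_diff tendsto_const) auto
    qed
    show "(\<lambda>\<omega>. \<Sum>k\<in>{a..<b}. (wh_approx (l + r i) (k * 2^r i) \<omega> - wh_approx (l + r i) (a * 2^r i) \<omega>) ^ m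
        * (bm e (real (Suc k) / 2^l) \<omega> - bm e (real k / 2^l) \<omega>)) \<in> borel_measurable P" for i
      using ab kl
      by (intro borel_measurable_sum borel_measurable_times borel_measurable_power borel_measurable_diff
          wh_approx_meas bm_meas dyadic_in_unit) auto
  qed
qed

lemma wh_increment_moment_le:
  assumes ab: "a \<le> b" "b \<le> 2^l" and q: "q \<ge> 1"
  shows "(\<integral>\<^sup>+\<omega>. ennreal ((Wh (real b / 2^l) \<omega> - Wh (real a / 2^l) \<omega>) ^ (2*q)) \<partial>P)
    \<le> ennreal ((4 * real q * (real (b - a) / 2^l) powr (2 * H))^q)"
proof -
  have kl: "k * 2^i \<le> 2^(l+i)" if "k \<in> {a,b}" for k i using that ab by (auto simp: power_add)
  have "\<exists>r. strict_mono r \<and> (AE \<omega> in P. \<forall>k\<in>{a,b}. (\<lambda>i. wh_approx (l + r i) (k * 2^r i) \<omega>) \<longlonglongrightarrow> Wh (real k / 2^l) \<omega>)"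
    using ab by (intro conv_in_prob_AE_subseq[where S = "\<lambda>k i. wh_approx (l + i) (k * 2^i)"]
        wh_approx_meas kl Wh_meas dyadic_in_unit wh_approx_conv) auto
  then obtain r where r: "AE \<omega> in P. \<forall>k\<in>{a,b}. (\<lambda>i. wh_approx (l + r i) (k * 2^r i) \<omega>) \<longlonglongrightarrow> Wh (real k / 2^l) \<omega>"
    by blast
  show ?thesis
  proof (rule nn_integral_power_lim_le)
    show "AE \<omega> in P. (\<lambda>i. wh_approx (l + r i) (b * 2^r i) \<omega> - wh_approx (l + r i) (a * 2^r i) \<omega>)
       \<longlonglongrightarrow> Wh (real b / 2^l) \<omega> - Wh (real a / 2^l) \<omega>"
      using r by eventually_elim (auto intro!: tendsto_diff)
    show "(\<lambda>\<omega>. wh_approx (l + r i) (b * 2^r i) \<omega> - wh_approx (l + r i) (a * 2^r i) \<omega>) \<in> borel_measurable P" for i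
      by (intro borel_measurable_diff wh_approx_meas kl) auto
    have "real (b * 2^i - a * 2^i) / 2^(l + i) = real (b - a) / 2^l" for i
      by (simp add: power_add diff_mult_distrib[symmetric])
    then show "(\<integral>\<^sup>+\<omega>. ennreal ((wh_approx (l + r i) (b * 2^r i) \<omega> - wh_approx (l + r i) (a * 2^r i) \<omega>) ^ (2*q)) \<partial>P)
        \<le> ennreal ((4 * real q * (real (b - a) / 2^l) powr (2 * H))^q)" for i
      using wh_approx_increment_moment_le[of "a * 2^r i" "b * 2^r i" "l + r i" q] ab(1) kl[of b "r i"] q by simp
  qed
qed

text \<open>Binomial expansion of \<open>w k - w a = (w k - w b) + (w b - w a)\<close> in the terms
  with \<open>k \<ge> b\<close>.\<close>

lemma dyadic_sum_chen:
  assumes "a \<le> b" "b \<le> c"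
  shows "dyadic_sum e l m a c \<omega> = dyadic_sum e l m a b \<omega> +
    (\<Sum>j\<le>m. real (m choose j) * (Wh (real b / 2^l) \<omega> - Wh (real a / 2^l) \<omega>) ^ (m - j) * dyadic_sum e l j b c \<omega>)"
proof -
  define w where "w k = Wh (real k / 2^l) \<omega>" for k
  define D where "D k = bm e (real (Suc k) / 2^l) \<omega> - bm e (real k / 2^l) \<omega>" for k
  have "(w k - w a)^m = (\<Sum>j\<le>m. real (m choose j) * (w k - w b)^j * (w b - w a)^(m - j))" for k
    using binomial_ring[of "w k - w b" "w b - w a" m] by simp
  then have "(\<Sum>k\<in>{b..<c}. (w k - w a)^m * D k)
     = (\<Sum>k\<in>{b..<c}. \<Sum>j\<le>m. real (m choose j) * (w b - w a)^(m - j) * ((w k - w b)^j * D k))"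
    by (simp add: sum_distrib_right sum_distrib_left mult_ac)
  also have "\<dots> = (\<Sum>j\<le>m. real (m choose j) * (w b - w a)^(m - j) * (\<Sum>k\<in>{b..<c}. (w k - w b)^j * D k))"
    by (subst sum.swap) (simp add: sum_distrib_left)
  finally have "(\<Sum>k\<in>{a..<c}. (w k - w a)^m * D k) = (\<Sum>k\<in>{a..<b}. (w k - w a)^m * D k)
     + (\<Sum>j\<le>m. real (m choose j) * (w b - w a)^(m - j) * (\<Sum>k\<in>{b..<c}. (w k - w b)^j * D k))"
    using sum.atLeastLessThan_concat[OF assms, of "\<lambda>k. (w k - w a)^m * D k"] by simp
  then show ?thesis unfolding dyadic_sum_def w_def D_def .
qed

lemma riemann_sum_eq_dyadic_sum:
  assumes "a < b"
  shows "riemann_sum (\<lambda>r \<omega>. (Wh r \<omega> - Wh (real a / 2^l) \<omega>) ^ m) (bm e) (real a / 2^l) (real b / 2^l) (b - a)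
    = dyadic_sum e l m a b"
proof
  fix \<omega>
  have pt: "real a / 2^l + real k * (real b / 2^l - real a / 2^l) / real (b - a) = real (a + k) / 2^l" for k
  proof -
    have "real b / 2^l - real a / 2^l = real (b - a) / 2^l"
      using assms by (simp add: of_nat_diff diff_divide_distrib)
    then show ?thesis using assms by (simp add: add_divide_distrib)
  qed
  show "riemann_sum (\<lambda>r \<omega>. (Wh r \<omega> - Wh (real a / 2^l) \<omega>) ^ m) (bm e) (real a / 2^l) (real b / 2^l) (b - a) \<omega>
    = dyadic_sum e l m a b \<omega>"
    unfolding riemann_sum_def dyadic_sum_def pt add_Suc_right
    by (rule sum.reindex_bij_witness[of _ "\<lambda>k. k - a" "\<lambda>k. a + k"]) auto
qed

text \<open>Including the Brownian increments as the case \<open>m = 0\<close> and the value \<open>0\<close> on the diagonal makes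
  Chen's relation hold without exceptions.\<close>

definition lift :: "bool \<Rightarrow> nat \<Rightarrow> real \<Rightarrow> real \<Rightarrow> 'a \<Rightarrow> real" where
  "lift e m s t \<omega> = (if m = 0 then bm e t \<omega> - bm e s \<omega> else if s < t then WW e m s t \<omega> else 0)"

lemma lift_meas:
  assumes "m \<le> M" "0 \<le> s" "s \<le> t" "t \<le> 1"
  shows "lift e m s t \<in> borel_measurable P"
proof -
  have "lift e m s t = (if m = 0 then (\<lambda>\<omega>. bm e t \<omega> - bm e s \<omega>) else if s < t then WW e m s t else (\<lambda>\<omega>. 0))"
    by (auto simp: lift_def fun_eq_iff)
  then show ?thesis using assms by (auto intro!: borel_measurable_diff bm_meas WW_meas)
qed

text \<open>Refining the grid \<open>i\<close> times cuts the interval into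
  \<open>(b - a) * 2^i\<close> pieces, which is a subsequence of the Riemann sums defining
  \<open>WW\<close>. For \<open>m = 0\<close> the sums telescope and do not depend on
  \<open>i\<close>.\<close>

lemma lift_conv:
  assumes m: "m \<le> M" and ab: "a \<le> b" "b \<le> 2^l"
  shows "conv_in_prob P (\<lambda>i. dyadic_sum e (l + i) m (a * 2^i) (b * 2^i)) (lift e m (real a / 2^l) (real b / 2^l))"
proof -
  let ?s = "real a / 2^l" and ?t = "real b / 2^l"
  have pt: "real (c * 2^i) / 2^(l + i) = real c / 2^l" for c i by (simp add: power_add)
  have const: ?thesis if "\<And>i. dyadic_sum e (l + i) m (a * 2^i) (b * 2^i) = lift e m ?s ?t"
    unfolding that conv_in_prob_def by auto
  consider "m = 0" | "m \<noteq> 0" "a = b" | "m \<noteq> 0" "a < b" using ab by linarith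
  then show ?thesis
  proof cases
    case 1
    show ?thesis
    proof (rule const, rule ext)
      fix i \<omega>
      have "dyadic_sum e (l + i) m (a * 2^i) (b * 2^i) \<omega>
          = (\<Sum>k\<in>{a * 2^i..<b * 2^i}. bm e (real (Suc k) / 2^(l+i)) \<omega> - bm e (real k / 2^(l+i)) \<omega>)"
        unfolding 1 dyadic_sum_def by simp
      also have "\<dots> = bm e (real (b * 2^i) / 2^(l+i)) \<omega> - bm e (real (a * 2^i) / 2^(l+i)) \<omega>"
        using ab by (intro sum_Suc_diff') simp
      finally show "dyadic_sum e (l + i) m (a * 2^i) (b * 2^i) \<omega> = lift e m ?s ?t \<omega>"
        unfolding pt by (simp add: lift_def 1)
    qed
  next
    case 2
    show ?thesis by (rule const) (use 2 in \<open>auto simp: dyadic_sum_def lift_def fun_eq_iff\<close>)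
  next
    case 3
    have st: "0 \<le> ?s" "?s < ?t" "?t \<le> 1" using 3 ab dyadic_in_unit[of b l] by (auto simp: divide_strict_right_mono)
    have "filterlim (\<lambda>i. (b - a) * 2^i) at_top sequentially"
      by (rule filterlim_subseq) (use 3 in \<open>auto simp: strict_mono_Suc_iff\<close>)
    moreover have "conv_in_prob P (riemann_sum (\<lambda>r \<omega>. (Wh r \<omega> - Wh ?s \<omega>) ^ m) (bm e) ?s ?t) (WW e m ?s ?t)"
      unfolding bm_def using 3 m st by (intro WW_int) auto
    ultimately have "conv_in_prob P (\<lambda>i. riemann_sum (\<lambda>r \<omega>. (Wh r \<omega> - Wh ?s \<omega>) ^ m) (bm e) ?s ?t ((b - a) * 2^i)) (WW e m ?s ?t)"
      by (rule conv_in_prob_subseq[rotated])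
    moreover have "riemann_sum (\<lambda>r \<omega>. (Wh r \<omega> - Wh ?s \<omega>) ^ m) (bm e) ?s ?t ((b - a) * 2^i)
        = dyadic_sum e (l + i) m (a * 2^i) (b * 2^i)" for i
      using riemann_sum_eq_dyadic_sum[of "a * 2^i" "b * 2^i" "l + i" m e] 3 unfolding pt by (simp add: diff_mult_distrib)
    moreover have "WW e m ?s ?t = lift e m ?s ?t" using 3 st by (auto simp: lift_def fun_eq_iff)
    ultimately show ?thesis by simp
  qed
qed

lemma lift_moment_le:
  assumes m: "m \<le> M" and ab: "a \<le> b" "b \<le> 2^l" and q: "q \<ge> 1"
  shows "(\<integral>\<^sup>+\<omega>. ennreal (lift e m (real a / 2^l) (real b / 2^l) \<omega> ^ (2*q)) \<partial>P)
    \<le> ennreal ((moment_const m q * (real (b - a) / 2^l) powr (2 * H * real m + 1))^q)"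
proof -
  have bl: "b * 2^i \<le> 2^(l+i)" for i using ab by (simp add: power_add)
  have s01: "0 \<le> real a / 2^l" "real a / 2^l \<le> real b / 2^l" "real b / 2^l \<le> 1"
    using ab dyadic_in_unit[of b l] by (auto simp: divide_right_mono)
  \<comment> \<open>Only one sequence is involved, so the index set is the singleton
    \<open>{()}\<close>.\<close>
  have "\<exists>r. strict_mono r \<and> (AE \<omega> in P. \<forall>k\<in>{()}. (\<lambda>i. dyadic_sum e (l + r i) m (a * 2^r i) (b * 2^r i) \<omega>)
      \<longlonglongrightarrow> lift e m (real a / 2^l) (real b / 2^l) \<omega>)"
    using ab m bl s01
    by (intro conv_in_prob_AE_subseq[where S = "\<lambda>_ i. dyadic_sum e (l + i) m (a * 2^i) (b * 2^i)"]
        dyadic_sum_meas lift_meas lift_conv) auto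
  then obtain r where r: "AE \<omega> in P. (\<lambda>i. dyadic_sum e (l + r i) m (a * 2^r i) (b * 2^r i) \<omega>)
      \<longlonglongrightarrow> lift e m (real a / 2^l) (real b / 2^l) \<omega>" by auto
  show ?thesis
  proof (rule nn_integral_power_lim_le[OF _ r])
    show "dyadic_sum e (l + r i) m (a * 2^r i) (b * 2^r i) \<in> borel_measurable P" for i
      using ab bl by (intro dyadic_sum_meas) auto
    have "real (b * 2^i - a * 2^i) / 2^(l + i) = real (b - a) / 2^l" for i
      by (simp add: power_add diff_mult_distrib[symmetric])
    then show "(\<integral>\<^sup>+\<omega>. ennreal (dyadic_sum e (l + r i) m (a * 2^r i) (b * 2^r i) \<omega> ^ (2*q)) \<partial>P)
        \<le> ennreal ((moment_const m q * (real (b - a) / 2^l) powr (2 * H * real m + 1))^q)" for i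
      using dyadic_sum_moment_le[of "a * 2^r i" "b * 2^r i" "l + r i" q] ab(1) bl[of "r i"] q by simp
  qed
qed

text \<open>The relation is exact on every refinement of the grid, with the same increment of
  \<open>Wh\<close> as coefficient throughout. The finitely many sums over pairs from
  \<open>a\<close>, \<open>b\<close>, \<open>c\<close> converge along one subsequence, so the limit
  can be taken term by term.\<close>

lemma lift_chen_AE:
  assumes m: "m \<le> M" and abc: "a \<le> b" "b \<le> c" "c \<le> 2^l"
  shows "AE \<omega> in P. lift e m (real a / 2^l) (real c / 2^l) \<omega> = lift e m (real a / 2^l) (real b / 2^l) \<omega> +
    (\<Sum>j\<le>m. real (m choose j) * (Wh (real b / 2^l) \<omega> - Wh (real a / 2^l) \<omega>) ^ (m - j)
        * lift e j (real b / 2^l) (real c / 2^l) \<omega>)"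
proof -
  define I where "I = {(j, x, y). j \<le> m \<and> x \<in> {a,b,c} \<and> y \<in> {a,b,c} \<and> x \<le> y}"
  define S where "S = (\<lambda>(j, x, y) i. dyadic_sum e (l + i) j (x * 2^i) (y * 2^i))"
  define L where "L = (\<lambda>(j, x, y). lift e j (real x / 2^l) (real y / 2^l))"
  have fin: "finite I"
    by (rule finite_subset[of _ "{..m} \<times> {a,b,c} \<times> {a,b,c}"]) (auto simp: I_def)
  have "\<exists>r. strict_mono r \<and> (AE \<omega> in P. \<forall>k\<in>I. (\<lambda>i. S k (r i) \<omega>) \<longlonglongrightarrow> L k \<omega>)"
  proof (rule conv_in_prob_AE_subseq[OF fin])
    fix k assume "k \<in> I"
    then obtain j x y where k: "k = (j, x, y)" "j \<le> M" "x \<le> y" "y \<le> 2^l" using m abc by (auto simp: I_def)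
    then have y: "y * 2^i \<le> 2^(l+i)" for i by (simp add: power_add)
    show "S k i \<in> borel_measurable P" for i
      using k y[of i] by (auto simp: S_def intro!: dyadic_sum_meas)
    show "L k \<in> borel_measurable P"
      using k dyadic_in_unit[of y l] by (auto simp: L_def divide_right_mono intro!: lift_meas)
    show "conv_in_prob P (S k) (L k)"
      using lift_conv[of j x y l e] k by (simp add: S_def L_def)
  qed
  then obtain r where r: "AE \<omega> in P. \<forall>k\<in>I. (\<lambda>i. S k (r i) \<omega>) \<longlonglongrightarrow> L k \<omega>" by blast
  from r show ?thesis
  proof eventually_elim
    case (elim \<omega>)
    let ?d = "Wh (real b / 2^l) \<omega> - Wh (real a / 2^l) \<omega>"
    have lim: "(\<lambda>i. dyadic_sum e (l + r i) j (x * 2^r i) (y * 2^r i) \<omega>) \<longlonglongrightarrow> lift e j (real x / 2^l) (real y / 2^l) \<omega>"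
      if "(j, x, y) \<in> I" for j x y
      using elim[rule_format, OF that] by (simp add: S_def L_def)
    have pt: "real (c * 2^i) / 2^(l + i) = real c / 2^l" for c i by (simp add: power_add)
    have eq: "dyadic_sum e (l + r i) m (a * 2^r i) (c * 2^r i) \<omega> = dyadic_sum e (l + r i) m (a * 2^r i) (b * 2^r i) \<omega> +
       (\<Sum>j\<le>m. real (m choose j) * ?d ^ (m - j) * dyadic_sum e (l + r i) j (b * 2^r i) (c * 2^r i) \<omega>)" for i
      using dyadic_sum_chen[of "a * 2^r i" "b * 2^r i" "c * 2^r i" e "l + r i" m \<omega>] abc unfolding pt by simp
    have "(\<lambda>i. dyadic_sum e (l + r i) m (a * 2^r i) (c * 2^r i) \<omega>) \<longlonglongrightarrow> lift e m (real a / 2^l) (real b / 2^l) \<omega> +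
       (\<Sum>j\<le>m. real (m choose j) * ?d ^ (m - j) * lift e j (real b / 2^l) (real c / 2^l) \<omega>)"
      unfolding eq using abc by (intro tendsto_add tendsto_sum tendsto_mult tendsto_const lim) (auto simp: I_def)
    moreover have "(\<lambda>i. dyadic_sum e (l + r i) m (a * 2^r i) (c * 2^r i) \<omega>) \<longlonglongrightarrow> lift e m (real a / 2^l) (real c / 2^l) \<omega>"
      using abc by (intro lim) (auto simp: I_def)
    ultimately show ?case by (rule LIMSEQ_unique[rotated])
  qed
qed

end

subsection \<open>Dyadic chaining\<close>

text \<open>Intervals between grid points of level \<open>n\<close> are reduced to level \<open>n - 1\<close> by cutting off at
  most one cell of level \<open>n\<close> at either end.\<close>

lemma dyadic_chaining:
  fixes G :: "nat \<Rightarrow> nat \<Rightarrow> nat \<Rightarrow> real" and \<epsilon> :: "nat \<Rightarrow> real"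
  assumes cons: "\<And>n a b. G (Suc n) (2*a) (2*b) = G n a b"
    and zero: "\<And>n a. a \<le> 2^n \<Longrightarrow> G n a a = 0"
    and base: "\<And>a. a < 2^p \<Longrightarrow> \<bar>G p a (Suc a)\<bar> \<le> \<epsilon> p"
    and left: "\<And>n a b. p < n \<Longrightarrow> a < b \<Longrightarrow> b \<le> 2^n \<Longrightarrow> b - a \<le> 2^(n-p) \<Longrightarrow> \<bar>G n a b\<bar> \<le> \<bar>G n (Suc a) b\<bar> + \<epsilon> n"
    and right: "\<And>n a b. p < n \<Longrightarrow> a \<le> b \<Longrightarrow> Suc b \<le> 2^n \<Longrightarrow> Suc b - a \<le> 2^(n-p) \<Longrightarrow> \<bar>G n a (Suc b)\<bar> \<le> \<bar>G n a b\<bar> + \<epsilon> n"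
    and \<epsilon>: "\<And>n. \<epsilon> n \<ge> 0"
    and n: "p \<le> n" and ab: "a \<le> b" "b \<le> 2^n" "b - a \<le> 2^(n-p)"
  shows "\<bar>G n a b\<bar> \<le> 2 * (\<Sum>l=p..n. \<epsilon> l)"
  using n ab
proof (induction n arbitrary: a b rule: dec_induct)
  case base
  then consider "b = a" | "b = Suc a" by fastforce
  then show ?case
  proof cases
    case 1
    then show ?thesis using zero[of a p] base \<epsilon>[of p] by simp
  next
    case 2
    then show ?thesis using assms(3)[of a] base \<epsilon>[of p] by simp
  qed
next
  case (step n)
  \<comment> \<open>Half of \<open>a\<close> rounded up and half of \<open>b\<close> rounded down;
    for \<open>a < b\<close> the order is preserved, possibly with equality, and the length in cells
    is halved as the induction hypothesis requires.\<close>
  define a' where "a' = (a + 1) div 2"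
  define b' where "b' = b div 2"
  have S: "2 * (\<Sum>l=p..Suc n. \<epsilon> l) = 2 * (\<Sum>l=p..n. \<epsilon> l) + 2 * \<epsilon> (Suc n)"
    using step.hyps by simp
  have S0: "(\<Sum>l=p..n. \<epsilon> l) \<ge> 0" using \<epsilon> by (intro sum_nonneg) auto
  show ?case
  proof (cases "a = b")
    case True
    then show ?thesis using zero[of a "Suc n"] step.prems \<epsilon>[of "Suc n"] S S0 by simp
  next
    case False
    then have ab: "a < b" using step.prems by simp
    have ab': "a' \<le> b'" "2 * a' \<le> b" "a \<le> 2 * a'" using ab by (auto simp: a'_def b'_def)
    have pow: "(2::nat)^(Suc n - p) = 2 * 2^(n-p)" using step.hyps by (simp add: Suc_diff_le)
    have len: "b' - a' \<le> 2^(n-p)"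
      using step.prems(3) unfolding pow a'_def b'_def by arith
    have "b' \<le> 2^n" using step.prems(2) by (simp add: b'_def)
    then have IH: "\<bar>G n a' b'\<bar> \<le> 2 * (\<Sum>l=p..n. \<epsilon> l)"
      using step.IH[of a' b'] ab' len by simp
    have 1: "\<bar>G (Suc n) a b\<bar> \<le> \<bar>G (Suc n) (2*a') b\<bar> + \<epsilon> (Suc n)"
    proof (cases "even a")
      case True
      then have "2 * a' = a" by (auto simp: a'_def)
      then show ?thesis using \<epsilon> by simp
    next
      case odd: False
      then have "2 * a' = Suc a" by (auto simp: a'_def elim!: oddE)
      then show ?thesis using left[of "Suc n" a b] ab step by simp
    qed
    have 2: "\<bar>G (Suc n) (2*a') b\<bar> \<le> \<bar>G (Suc n) (2*a') (2*b')\<bar> + \<epsilon> (Suc n)"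
    proof (cases "even b")
      case True
      then have "2 * b' = b" by (auto simp: b'_def)
      then show ?thesis using \<epsilon> by simp
    next
      case odd: False
      then have "b = Suc (2 * b')" by (auto simp: b'_def elim!: oddE)
      then show ?thesis using right[of "Suc n" "2*a'" "2*b'"] ab' step by simp
    qed
    show ?thesis using 1 2 IH S unfolding cons by linarith
  qed
qed

section \<open>Dyadic weights and chaining along Chen's relation\<close>

definition dyad :: "nat \<Rightarrow> real \<Rightarrow> real" where
  "dyad n \<gamma> = 2 powr (- (real n * \<gamma>))"

lemma dyad_pos: "dyad n \<gamma> > 0" by (simp add: dyad_def)

lemma dyad_split: "p \<le> n \<Longrightarrow> dyad n \<gamma> = dyad p \<gamma> * dyad (n - p) \<gamma>"
  by (simp add: dyad_def powr_add[symmetric] of_nat_diff algebra_simps)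

lemma dyad_add: "dyad n (\<gamma> + \<delta>) = dyad n \<gamma> * dyad n \<delta>"
  by (simp add: dyad_def powr_add[symmetric] algebra_simps)

lemma dyad_mono: "\<delta> \<le> \<gamma> \<Longrightarrow> dyad n \<gamma> \<le> dyad n \<delta>"
  by (simp add: dyad_def mult_left_mono)

lemma dyad_power: "dyad n \<gamma> ^ i = dyad n (real i * \<gamma>)"
  by (simp add: dyad_def powr_power mult_ac)

lemma dyad_eq_power: "dyad n \<gamma> = (2 powr (-\<gamma>)) ^ n"
  by (simp add: dyad_def powr_power mult_ac)

lemma dyad_sum_le:
  assumes "\<delta> > 0"
  shows "(\<Sum>l=p..n. dyad (l - p) \<delta>) \<le> 1 / (1 - 2 powr (-\<delta>))"
proof -
  let ?r = "2 powr (-\<delta>) :: real"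
  have r: "0 \<le> ?r" "?r < 1" using assms by (auto simp: powr_less_one)
  have "(\<Sum>l=p..n. dyad (l - p) \<delta>) = (\<Sum>i\<in>(\<lambda>l. l - p) ` {p..n}. ?r ^ i)"
    by (subst sum.reindex) (auto simp: inj_on_def dyad_eq_power)
  also have "\<dots> \<le> (\<Sum>i. ?r ^ i)"
    using r by (intro sum_le_suminf) (auto intro: summable_geometric)
  also have "\<dots> = 1 / (1 - ?r)" using r by (intro suminf_geometric) auto
  finally show ?thesis .
qed

text \<open>Only points of a common dyadic level occur, hence countably many relations, which can
  hold simultaneously outside one null set.\<close>

definition chen_family :: "nat \<Rightarrow> (real \<Rightarrow> real) \<Rightarrow> (nat \<Rightarrow> real \<Rightarrow> real \<Rightarrow> real) \<Rightarrow> bool" where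
  "chen_family M x A \<longleftrightarrow> (\<forall>m\<le>M. \<forall>n a b c. a \<le> b \<longrightarrow> b \<le> c \<longrightarrow> c \<le> 2^n \<longrightarrow>
     A m (real a / 2^n) (real c / 2^n) = A m (real a / 2^n) (real b / 2^n) +
      (\<Sum>j\<le>m. real (m choose j) * (x (real b / 2^n) - x (real a / 2^n)) ^ (m - j) * A j (real b / 2^n) (real c / 2^n)))"

text \<open>\<open>x\<close> has degree 1 and \<open>A m\<close> degree \<open>m + 1\<close> in the
  size \<open>L\<close>. Chen's relation is homogeneous in this grading, since
  \<open>(m - j) + (j + 1) = m + 1\<close>, so \<open>L\<close> can be scaled to 1.\<close>

definition cell_bounds :: "real \<Rightarrow> real \<Rightarrow> nat \<Rightarrow> real \<Rightarrow> (real \<Rightarrow> real) \<Rightarrow> (nat \<Rightarrow> real \<Rightarrow> real \<Rightarrow> real) \<Rightarrow> bool" where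
  "cell_bounds \<alpha> \<beta> M L x A \<longleftrightarrow> (\<forall>n k. k < 2^n \<longrightarrow>
     \<bar>x (real (Suc k) / 2^n) - x (real k / 2^n)\<bar> \<le> L * dyad n \<alpha> \<and>
     (\<forall>m\<le>M. \<bar>A m (real k / 2^n) (real (Suc k) / 2^n)\<bar> \<le> L^(m+1) * dyad n (real m * \<alpha> + \<beta>)))"

lemma path_chaining:
  assumes \<alpha>: "\<alpha> > 0" and cells: "cell_bounds \<alpha> \<beta> M 1 x A"
    and ab: "p \<le> n" "a \<le> b" "b \<le> 2^n" "b - a \<le> 2^(n-p)"
  shows "\<bar>x (real b / 2^n) - x (real a / 2^n)\<bar> \<le> 2 / (1 - 2 powr (-\<alpha>)) * dyad p \<alpha>"
proof -
  have cell: "\<bar>x (real (Suc k) / 2^n) - x (real k / 2^n)\<bar> \<le> dyad n \<alpha>" if "k < 2^n" for n k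
    using cells that by (auto simp: cell_bounds_def)
  have "\<bar>x (real b / 2^n) - x (real a / 2^n)\<bar> \<le> 2 * (\<Sum>l=p..n. dyad l \<alpha>)"
  proof (rule dyadic_chaining[where G = "\<lambda>n a b. x (real b / 2^n) - x (real a / 2^n)" and \<epsilon> = "\<lambda>n. dyad n \<alpha>"])
    show "\<bar>x (real b / 2^n) - x (real a / 2^n)\<bar> \<le> \<bar>x (real b / 2^n) - x (real (Suc a) / 2^n)\<bar> + dyad n \<alpha>"
      if "a < b" "b \<le> 2^n" for n a b
      using cell[of a n] that by auto
    show "\<bar>x (real (Suc b) / 2^n) - x (real a / 2^n)\<bar> \<le> \<bar>x (real b / 2^n) - x (real a / 2^n)\<bar> + dyad n \<alpha>"
      if "Suc b \<le> 2^n" for n a b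
      using cell[of b n] that by auto
  qed (use ab cell dyad_pos in \<open>auto simp: less_imp_le\<close>)
  also have "(\<Sum>l=p..n. dyad l \<alpha>) = dyad p \<alpha> * (\<Sum>l=p..n. dyad (l - p) \<alpha>)"
    unfolding sum_distrib_left by (intro sum.cong refl dyad_split) auto
  also have "2 * \<dots> \<le> 2 * (dyad p \<alpha> * (1 / (1 - 2 powr (-\<alpha>))))"
    using dyad_sum_le[OF \<alpha>] dyad_pos[of p \<alpha>] by (intro mult_left_mono) auto
  finally show ?thesis by (simp add: field_simps)
qed

text \<open>Cutting off a cell on the left produces cross terms in which a short increment of
  \<open>x\<close>, to a power \<open>m - j \<ge> 1\<close>, multiplies \<open>A j\<close> over the
  long remainder, which the induction hypothesis bounds. Cutting on the right, a long increment of
  \<open>x\<close> multiplies \<open>A j\<close> over a short cell. Either way one factor is small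
  with the cell. The constant is chosen before \<open>x\<close> and \<open>A\<close>, so it is the
  same for all paths.\<close>

lemma lift_chaining:
  assumes \<alpha>: "\<alpha> > 0" and \<beta>: "\<beta> > 0"
  shows "\<exists>C\<ge>0. \<forall>x A n p a b. chen_family M x A \<longrightarrow> cell_bounds \<alpha> \<beta> M 1 x A \<longrightarrow> p \<le> n \<longrightarrow> a \<le> b \<longrightarrow>
     b \<le> 2^n \<longrightarrow> b - a \<le> 2^(n-p) \<longrightarrow> m \<le> M \<longrightarrow> \<bar>A m (real a / 2^n) (real b / 2^n)\<bar> \<le> C * dyad p (real m * \<alpha> + \<beta>)"
proof (induction m rule: less_induct)
  case (less m)
  define good where "good x A C j \<longleftrightarrow> (\<forall>n p a b. p \<le> n \<longrightarrow> a \<le> b \<longrightarrow>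
     b \<le> 2^n \<longrightarrow> b - a \<le> 2^(n-p) \<longrightarrow> j \<le> M \<longrightarrow> \<bar>A j (real a / 2^n) (real b / 2^n)\<bar> \<le> C * dyad p (real j * \<alpha> + \<beta>))"
    for x :: "real \<Rightarrow> real" and A :: "nat \<Rightarrow> real \<Rightarrow> real \<Rightarrow> real" and C :: real and j
  have "\<forall>j\<in>{..<m}. \<exists>C\<ge>0. \<forall>x A. chen_family M x A \<longrightarrow> cell_bounds \<alpha> \<beta> M 1 x A \<longrightarrow> good x A C j"
    using less by (force simp: good_def)
  then obtain C where C: "\<And>j. j < m \<Longrightarrow> C j \<ge> 0"
    "\<And>j x A. j < m \<Longrightarrow> chen_family M x A \<Longrightarrow> cell_bounds \<alpha> \<beta> M 1 x A \<Longrightarrow> good x A (C j) j"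
    using bchoice[of "{..<m}"] by (metis lessThan_iff)
  \<comment> \<open>The guaranteed rate of decay: short increments of \<open>x\<close> give at least
    \<alpha>, short cells of \<open>A j\<close> at least \<beta>.\<close>
  define \<delta> where "\<delta> = min \<alpha> \<beta>"
  have \<delta>: "\<delta> > 0" "\<delta> \<le> \<alpha>" "\<delta> \<le> \<beta>" using \<alpha> \<beta> by (auto simp: \<delta>_def)
  define Cx where "Cx = 2 / (1 - 2 powr (-\<alpha>))"
  define rr where "rr = 1 / (1 - 2 powr (-\<delta>))"
  have Cx0: "Cx \<ge> 0" using \<alpha> by (auto simp: Cx_def powr_less_one less_imp_le)
  have rr0: "rr \<ge> 0" using \<delta> by (auto simp: rr_def powr_less_one less_imp_le)
  \<comment> \<open>\<open>D1\<close> collects the cross terms of a cut on the left,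
    \<open>D2\<close> all terms of a cut on the right; the 1 in \<open>D\<close> is for the cell
    itself.\<close>
  define D1 where "D1 = (\<Sum>j<m. real (m choose j) * C j)"
  define D2 where "D2 = (\<Sum>j\<le>m. real (m choose j) * Cx ^ (m - j))"
  define D where "D = 1 + D1 + D2"
  have D0: "D1 \<ge> 0" "D2 \<ge> 0" "D \<ge> 0" using C(1) Cx0
    by (auto simp: D_def D1_def D2_def intro!: sum_nonneg add_nonneg_nonneg mult_nonneg_nonneg)
  let ?\<gamma> = "\<lambda>j. real j * \<alpha> + \<beta>"
  have "\<bar>A m (real a / 2^n) (real b / 2^n)\<bar> \<le> 2 * D * rr * dyad p (?\<gamma> m)"
    if chen: "chen_family M x A" and cells: "cell_bounds \<alpha> \<beta> M 1 x A" and mM: "m \<le> M"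
      and ab: "p \<le> n" "a \<le> b" "b \<le> 2^n" "b - a \<le> 2^(n-p)" for x A n p a b
  proof -
    \<comment> \<open>For fixed \<open>p\<close> the error per level is the desired bound times a
      decay in the number of levels below \<open>p\<close>, so the sum over the levels is
      geometric.\<close>
    define \<epsilon> where "\<epsilon> n = D * (dyad p (?\<gamma> m) * dyad (n - p) \<delta>)" for n
    let ?X = "\<lambda>n k. x (real k / 2^n)" and ?A = "\<lambda>j n a b. A j (real a / 2^n) (real b / 2^n)"
    have cellx: "\<bar>?X n (Suc k) - ?X n k\<bar> \<le> dyad n \<alpha>" if "k < 2^n" for n k
      using cells that by (auto simp: cell_bounds_def)
    have cellA: "\<bar>?A j n k (Suc k)\<bar> \<le> dyad n (?\<gamma> j)" if "k < 2^n" "j \<le> m" for j n k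
      using cells that mM by (auto simp: cell_bounds_def)
    have ch: "?A m n a c = ?A m n a b + (\<Sum>j\<le>m. real (m choose j) * (?X n b - ?X n a)^(m-j) * ?A j n b c)"
      if "a \<le> b" "b \<le> c" "c \<le> 2^n" for n a b c
      using chen mM that unfolding chen_family_def by blast
    have \<epsilon>0: "\<epsilon> n \<ge> 0" for n using D0 dyad_pos[of p "?\<gamma> m"] dyad_pos[of "n - p" \<delta>] by (simp add: \<epsilon>_def)
    have d1: "dyad n (?\<gamma> m) \<le> dyad p (?\<gamma> m) * dyad (n - p) \<delta>" if "p \<le> n" for n
    proof -
      have "dyad n (?\<gamma> m) = dyad p (?\<gamma> m) * dyad (n - p) (?\<gamma> m)" by (rule dyad_split[OF that])
      also have "\<dots> \<le> dyad p (?\<gamma> m) * dyad (n - p) \<delta>"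
        using \<delta> \<alpha> dyad_pos[of p] by (intro mult_left_mono dyad_mono) (auto simp: less_imp_le add_increasing)
      finally show ?thesis .
    qed
    have "\<bar>?A m n a b\<bar> \<le> 2 * (\<Sum>l=p..n. \<epsilon> l)"
    proof (rule dyadic_chaining[where G = "?A m" and \<epsilon> = \<epsilon>])
      \<comment> \<open>With all three points equal only \<open>j = m\<close> survives, because
        \<open>0^0 = 1\<close>, and Chen's relation reads \<open>A = A + A\<close>.\<close>
      show "?A m n a a = 0" if "a \<le> 2^n" for n a
      proof -
        have "(\<Sum>j\<le>m. real (m choose j) * (?X n a - ?X n a)^(m-j) * ?A j n a a) = (\<Sum>j\<in>{m}. ?A j n a a)"
          by (rule sum.mono_neutral_cong_right) (auto simp: power_0_left)
        then show ?thesis using ch[of a a a n] that by simp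
      qed
      show "\<bar>?A m p a (Suc a)\<bar> \<le> \<epsilon> p" if "a < 2^p" for a
      proof -
        have "\<bar>?A m p a (Suc a)\<bar> \<le> 1 * dyad p (?\<gamma> m)" using cellA[OF that, of m] by simp
        also have "\<dots> \<le> D * dyad p (?\<gamma> m)"
          using D0 dyad_pos[of p] by (intro mult_right_mono) (auto simp: D_def less_imp_le)
        finally show ?thesis by (simp add: \<epsilon>_def dyad_def)
      qed
      show "\<bar>?A m n a b\<bar> \<le> \<bar>?A m n (Suc a) b\<bar> + \<epsilon> n" if h: "p < n" "a < b" "b \<le> 2^n" "b - a \<le> 2^(n-p)" for n a b
      proof -
        have "(\<Sum>j\<le>m. real (m choose j) * (?X n (Suc a) - ?X n a)^(m-j) * ?A j n (Suc a) b)
           = (\<Sum>j<m. real (m choose j) * (?X n (Suc a) - ?X n a)^(m-j) * ?A j n (Suc a) b) + ?A m n (Suc a) b"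
          by (simp add: lessThan_Suc_atMost[symmetric])
        then have "\<bar>?A m n a b\<bar> \<le> \<bar>?A m n a (Suc a)\<bar> + \<bar>\<Sum>j<m. real (m choose j) * (?X n (Suc a) - ?X n a)^(m-j) * ?A j n (Suc a) b\<bar> + \<bar>?A m n (Suc a) b\<bar>"
          using ch[of a "Suc a" b n] h by simp
        also have "\<bar>\<Sum>j<m. real (m choose j) * (?X n (Suc a) - ?X n a)^(m-j) * ?A j n (Suc a) b\<bar>
            \<le> (\<Sum>j<m. real (m choose j) * C j * (dyad p (?\<gamma> m) * dyad (n - p) \<delta>))"
        proof (rule order_trans[OF sum_abs], rule sum_mono)
          fix j assume "j \<in> {..<m}"
          then have j: "j < m" by simp
          have "\<bar>?A j n (Suc a) b\<bar> \<le> C j * dyad p (?\<gamma> j)"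
            using h mM j by (intro C(2)[OF j chen cells, unfolded good_def, rule_format]) auto
          moreover have "\<bar>?X n (Suc a) - ?X n a\<bar>^(m-j) \<le> dyad n \<alpha> ^ (m-j)"
            using cellx[of a n] h by (intro power_mono) auto
          ultimately have "\<bar>?X n (Suc a) - ?X n a\<bar>^(m-j) * \<bar>?A j n (Suc a) b\<bar> \<le> dyad n \<alpha> ^ (m-j) * (C j * dyad p (?\<gamma> j))"
            using dyad_pos[of n \<alpha>] by (intro mult_mono) auto
          also have "dyad n \<alpha> ^ (m-j) = dyad p (real (m-j) * \<alpha>) * dyad (n-p) (real (m-j) * \<alpha>)"
            unfolding dyad_power using h by (intro dyad_split) auto
          also have "\<dots> \<le> dyad p (real (m-j) * \<alpha>) * dyad (n-p) \<delta>"
          proof (intro mult_left_mono dyad_mono)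
            have "1 * \<alpha> \<le> real (m - j) * \<alpha>" using j \<alpha> by (intro mult_right_mono) auto
            then show "\<delta> \<le> real (m - j) * \<alpha>" using \<delta>(2) by linarith
          qed (use dyad_pos[of p] in \<open>auto simp: less_imp_le\<close>)
          also have "dyad p (real (m-j) * \<alpha>) * dyad (n-p) \<delta> * (C j * dyad p (?\<gamma> j)) = C j * (dyad p (?\<gamma> m) * dyad (n - p) \<delta>)"
          proof -
            have "real (m-j) * \<alpha> + ?\<gamma> j = ?\<gamma> m" using j by (simp add: of_nat_diff algebra_simps)
            then have "dyad p (?\<gamma> m) = dyad p (real (m-j) * \<alpha>) * dyad p (?\<gamma> j)" using dyad_add by metis
            then show ?thesis by (simp only:  mult_ac)
          qed
          finally have "\<bar>?X n (Suc a) - ?X n a\<bar>^(m-j) * \<bar>?A j n (Suc a) b\<bar> \<le> C j * (dyad p (?\<gamma> m) * dyad (n - p) \<delta>)"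
            using C(1)[OF j] dyad_pos[of p "?\<gamma> j"] by (simp add: mult_right_mono)
          then have "real (m choose j) * (\<bar>?X n (Suc a) - ?X n a\<bar>^(m-j) * \<bar>?A j n (Suc a) b\<bar>) \<le> real (m choose j) * (C j * (dyad p (?\<gamma> m) * dyad (n - p) \<delta>))"
            by (rule mult_left_mono) simp
          then show "\<bar>real (m choose j) * (?X n (Suc a) - ?X n a)^(m-j) * ?A j n (Suc a) b\<bar> \<le> real (m choose j) * C j * (dyad p (?\<gamma> m) * dyad (n - p) \<delta>)"
            by (simp add: abs_mult power_abs mult_ac)
        qed
        also have "\<dots> = D1 * (dyad p (?\<gamma> m) * dyad (n - p) \<delta>)" by (simp add: D1_def sum_distrib_right)
        also have "\<bar>?A m n a (Suc a)\<bar> \<le> dyad p (?\<gamma> m) * dyad (n - p) \<delta>"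
          using order_trans[OF cellA[of a n m] d1[of n]] h by simp
        finally have "\<bar>?A m n a b\<bar> \<le> \<bar>?A m n (Suc a) b\<bar> + (1 + D1) * (dyad p (?\<gamma> m) * dyad (n - p) \<delta>)"
          by (simp add: algebra_simps)
        also have "(1 + D1) * (dyad p (?\<gamma> m) * dyad (n - p) \<delta>) \<le> \<epsilon> n"
          unfolding \<epsilon>_def using D0 dyad_pos[of p "?\<gamma> m"] dyad_pos[of "n-p" \<delta>] by (intro mult_right_mono) (auto simp: D_def)
        finally show ?thesis by simp
      qed
      show "\<bar>?A m n a (Suc b)\<bar> \<le> \<bar>?A m n a b\<bar> + \<epsilon> n" if h: "p < n" "a \<le> b" "Suc b \<le> 2^n" "Suc b - a \<le> 2^(n-p)" for n a b
      proof -
        have "\<bar>?A m n a (Suc b)\<bar> \<le> \<bar>?A m n a b\<bar> + \<bar>\<Sum>j\<le>m. real (m choose j) * (?X n b - ?X n a)^(m-j) * ?A j n b (Suc b)\<bar>"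
          using ch[of a b "Suc b" n] h by simp
        also have "\<bar>\<Sum>j\<le>m. real (m choose j) * (?X n b - ?X n a)^(m-j) * ?A j n b (Suc b)\<bar>
            \<le> (\<Sum>j\<le>m. real (m choose j) * Cx^(m-j) * (dyad p (?\<gamma> m) * dyad (n - p) \<delta>))"
        proof (rule order_trans[OF sum_abs], rule sum_mono)
          fix j assume "j \<in> {..m}"
          then have j: "j \<le> m" by simp
          have "\<bar>?X n b - ?X n a\<bar> \<le> Cx * dyad p \<alpha>"
            unfolding Cx_def using h by (intro path_chaining[OF \<alpha> cells]) auto
          then have "\<bar>?X n b - ?X n a\<bar>^(m-j) \<le> (Cx * dyad p \<alpha>)^(m-j)" by (rule power_mono) simp
          moreover have "\<bar>?A j n b (Suc b)\<bar> \<le> dyad n (?\<gamma> j)" using cellA[of b n j] h j by simp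
          ultimately have "\<bar>?X n b - ?X n a\<bar>^(m-j) * \<bar>?A j n b (Suc b)\<bar> \<le> (Cx * dyad p \<alpha>)^(m-j) * dyad n (?\<gamma> j)"
            using Cx0 dyad_pos[of p \<alpha>] by (intro mult_mono) auto
          also have "dyad n (?\<gamma> j) = dyad p (?\<gamma> j) * dyad (n - p) (?\<gamma> j)" using h by (intro dyad_split) auto
          also have "\<dots> \<le> dyad p (?\<gamma> j) * dyad (n - p) \<delta>"
            using \<delta> \<alpha> dyad_pos[of p] by (intro mult_left_mono dyad_mono) (auto simp: less_imp_le add_increasing)
          also have "(Cx * dyad p \<alpha>)^(m-j) * (dyad p (?\<gamma> j) * dyad (n - p) \<delta>) = Cx^(m-j) * (dyad p (?\<gamma> m) * dyad (n - p) \<delta>)"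
          proof -
            have "real (m-j) * \<alpha> + ?\<gamma> j = ?\<gamma> m" using j by (simp add: of_nat_diff algebra_simps)
            then have "dyad p (?\<gamma> m) = dyad p (real (m-j) * \<alpha>) * dyad p (?\<gamma> j)" using dyad_add by metis
            then show ?thesis by (simp only: power_mult_distrib dyad_power mult_ac)
          qed
          finally have "\<bar>?X n b - ?X n a\<bar>^(m-j) * \<bar>?A j n b (Suc b)\<bar> \<le> Cx^(m-j) * (dyad p (?\<gamma> m) * dyad (n - p) \<delta>)"
            using Cx0 dyad_pos[of p \<alpha>] by (simp add: mult_left_mono)
          then have "real (m choose j) * (\<bar>?X n b - ?X n a\<bar>^(m-j) * \<bar>?A j n b (Suc b)\<bar>) \<le> real (m choose j) * (Cx^(m-j) * (dyad p (?\<gamma> m) * dyad (n - p) \<delta>))"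
            by (rule mult_left_mono) simp
          then show "\<bar>real (m choose j) * (?X n b - ?X n a)^(m-j) * ?A j n b (Suc b)\<bar> \<le> real (m choose j) * Cx^(m-j) * (dyad p (?\<gamma> m) * dyad (n - p) \<delta>)"
            by (simp add: abs_mult power_abs mult_ac)
        qed
        also have "\<dots> = D2 * (dyad p (?\<gamma> m) * dyad (n - p) \<delta>)" by (simp add: D2_def sum_distrib_right)
        also have "\<dots> \<le> \<epsilon> n"
          unfolding \<epsilon>_def using D0 dyad_pos[of p "?\<gamma> m"] dyad_pos[of "n-p" \<delta>] by (intro mult_right_mono) (auto simp: D_def)
        finally show ?thesis by simp
      qed
    qed (use ab \<epsilon>0 in auto)
    also have "(\<Sum>l=p..n. \<epsilon> l) = D * dyad p (?\<gamma> m) * (\<Sum>l=p..n. dyad (l - p) \<delta>)"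
      by (simp add: \<epsilon>_def sum_distrib_left mult_ac)
    also have "\<dots> \<le> D * dyad p (?\<gamma> m) * rr"
      unfolding rr_def using D0 dyad_pos[of p "?\<gamma> m"] dyad_sum_le[OF \<delta>(1)] by (intro mult_left_mono) auto
    finally show ?thesis by (simp add: mult_ac)
  qed
  moreover have "2 * D * rr \<ge> 0" using D0 rr0 by simp
  ultimately show ?case by blast
qed

subsection \<open>Square-exponential integrability\<close>

lemma enn_exp_sq_measurable [measurable]: "enn_exp_sq \<eta> \<in> borel_measurable borel"
  unfolding enn_exp_sq_def by measurable

lemma enn_exp_sq_mono:
  assumes "x \<le> y" "\<eta> \<ge> 0"
  shows "enn_exp_sq \<eta> x \<le> enn_exp_sq \<eta> y"
proof (cases "y = \<infinity>")
  case True then show ?thesis by (simp add: enn_exp_sq_def)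
next
  case False
  then have "x \<noteq> \<infinity>" using assms by (auto simp: top_unique)
  moreover have "enn2real x \<le> enn2real y"
    using assms False by (intro enn2real_mono) (auto simp: less_top)
  ultimately show ?thesis using False assms
    by (auto simp: enn_exp_sq_def intro!: ennreal_leI mult_left_mono power_mono)
qed

lemma enn_exp_sq_mono_coeff:
  assumes "\<eta> \<le> \<eta>'"
  shows "enn_exp_sq \<eta> x \<le> enn_exp_sq \<eta>' x"
  using assms by (auto simp: enn_exp_sq_def intro!: ennreal_leI mult_right_mono)

lemma enn_exp_sq_cmult:
  assumes "c > 0"
  shows "enn_exp_sq \<eta> (ennreal c * x) = enn_exp_sq (\<eta> * c\<^sup>2) x"
proof (cases "x = \<infinity>")
  case True then show ?thesis using assms by (simp add: enn_exp_sq_def ennreal_mult_top)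
next
  case False
  then have "ennreal c * x \<noteq> \<infinity>" by (simp add: ennreal_mult_eq_top_iff)
  then show ?thesis using False assms
    by (simp add: enn_exp_sq_def enn2real_mult power_mult_distrib mult_ac)
qed

text \<open>From \<open>x + y \<le> 2 max x y\<close>, whose square turns 2 into 4; a smaller \<eta>
  makes up for the loss.\<close>

lemma enn_exp_sq_add_le:
  assumes "\<eta> \<ge> 0"
  shows "enn_exp_sq \<eta> (x + y) \<le> enn_exp_sq (4 * \<eta>) x + enn_exp_sq (4 * \<eta>) y"
proof -
  have "enn_exp_sq \<eta> (x + y) \<le> enn_exp_sq (4 * \<eta>) (max x y)"
  proof -
    have "x + y \<le> max x y + max x y" by (intro add_mono) auto
    also have "\<dots> = ennreal 2 * max x y" by (simp add: mult_2)
    finally have "enn_exp_sq \<eta> (x + y) \<le> enn_exp_sq \<eta> (ennreal 2 * max x y)"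
      using assms by (rule enn_exp_sq_mono)
    also have "\<dots> = enn_exp_sq (4 * \<eta>) (max x y)"
      by (subst enn_exp_sq_cmult) (auto simp: mult_ac)
    finally show ?thesis .
  qed
  also have "\<dots> \<le> enn_exp_sq (4 * \<eta>) x + enn_exp_sq (4 * \<eta>) y"
    by (auto simp: max_def add_increasing add_increasing2)
  finally show ?thesis .
qed

text \<open>Leaving \<eta> free makes the class closed under positive multiples, finite sums and
  almost sure domination of measurable functions, so the pieces of the norm can be estimated
  separately.\<close>

definition exp_sq_integrable :: "'a measure \<Rightarrow> ('a \<Rightarrow> ennreal) \<Rightarrow> bool" where
  "exp_sq_integrable P X \<longleftrightarrow> X \<in> borel_measurable P \<and> (\<exists>\<eta>>0. (\<integral>\<^sup>+\<omega>. enn_exp_sq \<eta> (X \<omega>) \<partial>P) < \<infinity>)"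

lemma exp_sq_integrable_AE_mono:
  assumes "exp_sq_integrable P Y" "X \<in> borel_measurable P" "AE \<omega> in P. X \<omega> \<le> Y \<omega>"
  shows "exp_sq_integrable P X"
proof -
  obtain \<eta> where \<eta>: "\<eta> > 0" "(\<integral>\<^sup>+\<omega>. enn_exp_sq \<eta> (Y \<omega>) \<partial>P) < \<infinity>"
    using assms(1) by (auto simp: exp_sq_integrable_def)
  have "(\<integral>\<^sup>+\<omega>. enn_exp_sq \<eta> (X \<omega>) \<partial>P) \<le> (\<integral>\<^sup>+\<omega>. enn_exp_sq \<eta> (Y \<omega>) \<partial>P)"
    using assms(3) \<eta>(1) by (intro nn_integral_mono_AE) (auto elim!: eventually_mono intro!: enn_exp_sq_mono)
  then show ?thesis using assms(2) \<eta> by (auto simp: exp_sq_integrable_def intro!: exI[of _ \<eta>])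
qed

lemma exp_sq_integrable_add:
  assumes "exp_sq_integrable P X" "exp_sq_integrable P Y"
  shows "exp_sq_integrable P (\<lambda>\<omega>. X \<omega> + Y \<omega>)"
proof -
  obtain a where a: "a > 0" "(\<integral>\<^sup>+\<omega>. enn_exp_sq a (X \<omega>) \<partial>P) < \<infinity>"
    using assms(1) by (auto simp: exp_sq_integrable_def)
  obtain b where b: "b > 0" "(\<integral>\<^sup>+\<omega>. enn_exp_sq b (Y \<omega>) \<partial>P) < \<infinity>"
    using assms(2) by (auto simp: exp_sq_integrable_def)
  have [measurable]: "X \<in> borel_measurable P" "Y \<in> borel_measurable P"
    using assms by (auto simp: exp_sq_integrable_def)
  define \<eta> where "\<eta> = min a b / 4"
  have \<eta>: "\<eta> > 0" "4 * \<eta> \<le> a" "4 * \<eta> \<le> b" using a b by (auto simp: \<eta>_def)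
  have "(\<integral>\<^sup>+\<omega>. enn_exp_sq \<eta> (X \<omega> + Y \<omega>) \<partial>P) \<le> (\<integral>\<^sup>+\<omega>. enn_exp_sq a (X \<omega>) + enn_exp_sq b (Y \<omega>) \<partial>P)"
  proof (rule nn_integral_mono)
    fix \<omega>
    have "enn_exp_sq \<eta> (X \<omega> + Y \<omega>) \<le> enn_exp_sq (4 * \<eta>) (X \<omega>) + enn_exp_sq (4 * \<eta>) (Y \<omega>)"
      using \<eta> by (intro enn_exp_sq_add_le) auto
    also have "\<dots> \<le> enn_exp_sq a (X \<omega>) + enn_exp_sq b (Y \<omega>)"
      using \<eta> by (intro add_mono enn_exp_sq_mono_coeff) auto
    finally show "enn_exp_sq \<eta> (X \<omega> + Y \<omega>) \<le> enn_exp_sq a (X \<omega>) + enn_exp_sq b (Y \<omega>)" .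
  qed
  also have "\<dots> = (\<integral>\<^sup>+\<omega>. enn_exp_sq a (X \<omega>) \<partial>P) + (\<integral>\<^sup>+\<omega>. enn_exp_sq b (Y \<omega>) \<partial>P)"
    by (rule nn_integral_add) measurable
  also have "\<dots> < \<infinity>" using a b by (simp add: ennreal_add_eq_top less_top)
  finally show ?thesis using \<eta>(1) by (auto simp: exp_sq_integrable_def intro!: exI[of _ \<eta>])
qed

lemma exp_sq_integrable_cmult:
  assumes "exp_sq_integrable P X" "c > 0"
  shows "exp_sq_integrable P (\<lambda>\<omega>. ennreal c * X \<omega>)"
proof -
  obtain \<eta> where \<eta>: "\<eta> > 0" "(\<integral>\<^sup>+\<omega>. enn_exp_sq \<eta> (X \<omega>) \<partial>P) < \<infinity>" and [measurable]: "X \<in> borel_measurable P"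
    using assms(1) by (auto simp: exp_sq_integrable_def)
  have "(\<integral>\<^sup>+\<omega>. enn_exp_sq (\<eta> / c\<^sup>2) (ennreal c * X \<omega>) \<partial>P) < \<infinity>"
    using \<eta>(2) assms(2) by (simp add: enn_exp_sq_cmult)
  then show ?thesis using \<eta>(1) assms(2) by (auto simp: exp_sq_integrable_def intro!: exI[of _ "\<eta> / c\<^sup>2"])
qed

lemma (in prob_space) exp_sq_integrable_const: "exp_sq_integrable M (\<lambda>_. ennreal c)"
  unfolding exp_sq_integrable_def
  by (auto intro!: exI[of _ 1] simp: enn_exp_sq_def emeasure_space_1)

lemma (in prob_space) exp_sq_integrable_sum:
  assumes "finite I" "\<And>i. i \<in> I \<Longrightarrow> exp_sq_integrable M (X i)"
  shows "exp_sq_integrable M (\<lambda>\<omega>. \<Sum>i\<in>I. X i \<omega>)"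
  using assms
proof (induction I)
  case empty
  then show ?case using exp_sq_integrable_const[of 0] by simp
next
  case (insert i I)
  then show ?case by (simp add: exp_sq_integrable_add)
qed

section \<open>From moment growth to square-exponential moments\<close>

lemma power_self_le: "real q ^ q \<le> exp 1 ^ q * fact q"
proof -
  have "real q ^ q / fact q \<le> exp (real q)"
  proof -
    have s: "(\<lambda>n. real q ^ n /\<^sub>R fact n) sums exp (real q)" by (rule exp_converges)
    have "(\<Sum>n\<in>{q}. real q ^ n /\<^sub>R fact n) \<le> exp (real q)"
      unfolding sums_unique[OF s] by (intro sum_le_suminf) (use s in \<open>auto simp: sums_iff\<close>)
    then show ?thesis by (simp add: divide_inverse mult.commute)
  qed
  then show ?thesis by (simp add: field_simps exp_of_nat_mult[symmetric])
qed

lemma enn_exp_sq_le_suminf: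
  assumes "\<eta> > 0"
  shows "enn_exp_sq \<eta> x \<le> (\<Sum>q. ennreal (\<eta>^q / fact q) * x^(2*q))"
proof (cases "x = \<infinity>")
  case True
  have "(\<Sum>q\<in>{1}. ennreal (\<eta>^q / fact q) * x^(2*q)) \<le> (\<Sum>q. ennreal (\<eta>^q / fact q) * x^(2*q))"
    by (intro sum_le_suminf) auto
  moreover have "(\<Sum>q\<in>{1}. ennreal (\<eta>^q / fact q) * x^(2*q)) = \<infinity>"
    using assms by (simp add: True power2_eq_square ennreal_mult_eq_top_iff)
  ultimately show ?thesis by (simp add: top_unique)
next
  case False
  define y where "y = enn2real x"
  have y: "x = ennreal y" "y \<ge> 0" using False by (auto simp: y_def less_top)
  have s: "(\<lambda>q. \<eta>^q / fact q * y^(2*q)) sums exp (\<eta> * y\<^sup>2)"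
    using exp_converges[of "\<eta> * y\<^sup>2"]
    by (simp add: power_mult_distrib power_mult[symmetric] divide_inverse mult_ac)
  have "(\<Sum>q. ennreal (\<eta>^q / fact q) * x^(2*q)) = (\<Sum>q. ennreal (\<eta>^q / fact q * y^(2*q)))"
    using assms y by (intro suminf_cong) (simp add: ennreal_mult'[symmetric] ennreal_power)
  also have "\<dots> = ennreal (exp (\<eta> * y\<^sup>2))"
    using s assms y by (subst suminf_ennreal2) (auto simp: sums_iff)
  finally show ?thesis using False by (simp add: enn_exp_sq_def y_def)
qed

lemma power_ennreal_le_one_add:
  fixes x :: ennreal
  assumes "q \<le> q'"
  shows "x ^ q \<le> 1 + x ^ q'"
proof (cases "x \<le> 1")
  case True
  then have "x ^ q \<le> 1" by (simp add: power_le_one)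
  then show ?thesis by (simp add: add_increasing2)
next
  case False
  then have "x ^ q \<le> x ^ q'" using assms by (intro power_increasing) auto
  then show ?thesis by (simp add: add_increasing)
qed

text \<open>Since \<open>q^q \<le> e^q q!\<close>, the factorial in the exponential series cancels
  the growth of the moments and leaves a geometric series, of ratio 1/2 for
  \<open>\<eta> = 1 / (2 D)\<close>. Moments below \<open>q0\<close> are compared with the one at
  \<open>q0\<close>.\<close>

lemma (in prob_space) exp_sq_integrable_moments:
  fixes X :: "'a \<Rightarrow> ennreal"
  assumes X [measurable]: "X \<in> borel_measurable M" and C: "C > 0"
    and mom: "\<And>q. q \<ge> q0 \<Longrightarrow> (\<integral>\<^sup>+\<omega>. X \<omega> ^ (2*q) \<partial>M) \<le> ennreal (2 * (C * real q)^q)"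
  shows "exp_sq_integrable M X"
proof -
  define D where "D = max 1 (C * exp 1)"
  \<comment> \<open>Absorbs the factor 2 of the assumption as well as 1 plus the bound at
    \<open>q0\<close>, which covers all smaller \<open>q\<close>.\<close>
  define B where "B = 3 + 2 * (C * real q0)^q0"
  have D: "D \<ge> 1" "D \<ge> C * exp 1" by (auto simp: D_def)
  have B: "B \<ge> 3" using C by (auto simp: B_def)
  have le: "(\<integral>\<^sup>+\<omega>. X \<omega> ^ (2*q) \<partial>M) \<le> ennreal (B * (D^q * fact q))" for q
  proof (cases "q \<ge> q0")
    case True
    have "(C * real q)^q \<le> C^q * (exp 1 ^ q * fact q)"
      using power_self_le[of q] C by (simp add: power_mult_distrib)
    also have "\<dots> = (C * exp 1)^q * fact q" by (simp add: power_mult_distrib)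
    also have "\<dots> \<le> D^q * fact q"
      using D C by (intro mult_right_mono power_mono) auto
    finally have "2 * (C * real q)^q \<le> B * (D^q * fact q)"
      using B D C by (intro mult_mono) auto
    then show ?thesis using mom[OF True] by (meson ennreal_leI order_trans)
  next
    case False
    have "(\<integral>\<^sup>+\<omega>. X \<omega> ^ (2*q) \<partial>M) \<le> (\<integral>\<^sup>+\<omega>. 1 + X \<omega> ^ (2*q0) \<partial>M)"
      using False by (intro nn_integral_mono power_ennreal_le_one_add) auto
    also have "\<dots> = 1 + (\<integral>\<^sup>+\<omega>. X \<omega> ^ (2*q0) \<partial>M)"
      by (subst nn_integral_add) (auto simp: emeasure_space_1)
    also have "\<dots> \<le> 1 + ennreal (2 * (C * real q0)^q0)"
      by (intro add_left_mono mom) auto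
    also have "\<dots> = ennreal (1 + 2 * (C * real q0)^q0)"
      using C by (subst ennreal_plus) auto
    also have "\<dots> \<le> ennreal (B * (D^q * fact q))"
    proof (rule ennreal_leI)
      have "1 * 1 \<le> D^q * fact q" using D by (intro mult_mono) auto
      then have "B * 1 \<le> B * (D^q * fact q)" using B by (intro mult_left_mono) auto
      then show "1 + 2 * (C * real q0)^q0 \<le> B * (D^q * fact q)" by (simp add: B_def)
    qed
    finally show ?thesis .
  qed
  define \<eta> where "\<eta> = 1 / (2 * D)"
  have \<eta>: "\<eta> > 0" "\<eta> * D = 1/2" using D by (auto simp: \<eta>_def)
  have "(\<integral>\<^sup>+\<omega>. enn_exp_sq \<eta> (X \<omega>) \<partial>M) \<le> (\<integral>\<^sup>+\<omega>. (\<Sum>q. ennreal (\<eta>^q / fact q) * X \<omega> ^ (2*q)) \<partial>M)"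
    using \<eta> by (intro nn_integral_mono enn_exp_sq_le_suminf)
  also have "\<dots> = (\<Sum>q. \<integral>\<^sup>+\<omega>. ennreal (\<eta>^q / fact q) * X \<omega> ^ (2*q) \<partial>M)"
    by (rule nn_integral_suminf) measurable
  also have "\<dots> = (\<Sum>q. ennreal (\<eta>^q / fact q) * (\<integral>\<^sup>+\<omega>. X \<omega> ^ (2*q) \<partial>M))"
    by (subst nn_integral_cmult) auto
  also have "\<dots> \<le> (\<Sum>q. ennreal (\<eta>^q / fact q) * ennreal (B * (D^q * fact q)))"
    by (intro suminf_le mult_left_mono le) auto
  also have "\<dots> = (\<Sum>q. ennreal (B * (1/2)^q))"
  proof (rule suminf_cong)
    fix q
    have "(1/2)^q = \<eta>^q * D^q" unfolding \<eta>(2)[symmetric] by (simp add: power_mult_distrib)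
    then have eq: "\<eta>^q / fact q * (B * (D^q * fact q)) = B * (1/2)^q" by simp
    then show "ennreal (\<eta>^q / fact q) * ennreal (B * (D^q * fact q)) = ennreal (B * (1/2)^q)"
      unfolding eq[symmetric] using \<eta> by (intro ennreal_mult'[symmetric]) auto
  qed
  also have "\<dots> < \<infinity>"
    using B by (subst suminf_ennreal2) (auto intro!: summable_mult summable_geometric)
  finally show ?thesis using \<eta>(1) by (auto simp: exp_sq_integrable_def intro!: exI[of _ \<eta>])
qed

section \<open>Suprema over dyadic cells\<close>

lemma ennreal_SUP_power_le:
  fixes Y :: "'i \<Rightarrow> real"
  assumes p: "p > 0" and Y: "\<And>i. i \<in> I \<Longrightarrow> Y i \<ge> 0" "\<And>i. i \<in> I \<Longrightarrow> ennreal (Y i ^ p) \<le> T"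
  shows "(SUP i\<in>I. ennreal (Y i)) ^ p \<le> T"
proof (cases "T = \<infinity>")
  case False
  define t where "t = enn2real T"
  have t: "T = ennreal t" "t \<ge> 0" using False by (auto simp: t_def less_top)
  have "(SUP i\<in>I. ennreal (Y i)) \<le> ennreal (root p t)"
  proof (rule SUP_least)
    fix i assume i: "i \<in> I"
    then have "Y i ^ p \<le> t" using Y(2)[OF i] t by (simp add: ennreal_le_iff)
    then have "Y i \<le> root p t" using p Y(1)[OF i] by (metis real_root_le_iff real_root_power_cancel)
    then show "ennreal (Y i) \<le> ennreal (root p t)" by (rule ennreal_leI)
  qed
  then have "(SUP i\<in>I. ennreal (Y i)) ^ p \<le> ennreal (root p t) ^ p"
    by (rule power_mono) simp
  also have "\<dots> = T" using t p by (simp add: ennreal_power)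
  finally show ?thesis .
qed simp

definition cells :: "(nat \<times> nat) set" where
  "cells = (SIGMA n:UNIV. {..<2^n})"

text \<open>The power of the supremum is at most the sum over all cells. Level \<open>n\<close>
  contributes \<open>2^n\<close> cells of weight \<open>2^(-2 \<kappa> q n)\<close>, together at
  most \<open>2^(-n)\<close> once \<open>\<kappa> q \<ge> 1\<close>; so only large \<open>q\<close>
  are controlled, and the geometric series gives a factor 2.\<close>

lemma (in prob_space) exp_sq_integrable_cell_SUP:
  fixes Y :: "nat \<times> nat \<Rightarrow> 'a \<Rightarrow> real"
  assumes Y [measurable]: "\<And>i. i \<in> cells \<Longrightarrow> Y i \<in> borel_measurable M"
    and Y0: "\<And>i \<omega>. Y i \<omega> \<ge> 0" and \<kappa>: "\<kappa> > 0" and C: "C > 0"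
    and mom: "\<And>n k q. k < 2^n \<Longrightarrow> q \<ge> 1 \<Longrightarrow>
       (\<integral>\<^sup>+\<omega>. ennreal (Y (n, k) \<omega> ^ (2*q)) \<partial>M) \<le> ennreal ((C * real q)^q * dyad n (2 * \<kappa> * real q))"
  shows "exp_sq_integrable M (\<lambda>\<omega>. SUP i\<in>cells. ennreal (Y i \<omega>))"
proof -
  obtain q0 where q0: "real q0 > 1 / \<kappa>" using reals_Archimedean2 by blast
  show ?thesis
  proof (rule exp_sq_integrable_moments[OF _ C, where ?q0.0 = "Suc q0"])
    have "countable cells" by auto
    then show "(\<lambda>\<omega>. SUP i\<in>cells. ennreal (Y i \<omega>)) \<in> borel_measurable M"
      by (intro borel_measurable_SUP) auto
    fix q :: nat assume q: "q \<ge> Suc q0"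
    then have q1: "q \<ge> 1" by simp
    have "\<kappa> * real q \<ge> 1"
    proof -
      have "1 / \<kappa> \<le> real q" using q q0 by linarith
      then show ?thesis using \<kappa> by (simp add: field_simps)
    qed
    then have dy: "2^n * dyad n (2 * \<kappa> * real q) \<le> (1/2)^n" for n
    proof -
      have "dyad n (2 * \<kappa> * real q) \<le> dyad n 2" using \<open>\<kappa> * real q \<ge> 1\<close> by (intro dyad_mono) simp
      also have "dyad n 2 = (1/4)^n" by (simp add: dyad_eq_power powr_minus)
      finally have "2^n * dyad n (2 * \<kappa> * real q) \<le> 2^n * (1/4)^n" by (intro mult_left_mono) auto
      also have "\<dots> = (1/2)^n" by (simp add: power_mult_distrib[symmetric])
      finally show ?thesis .
    qed
    let ?T = "\<lambda>\<omega>. \<Sum>n. \<Sum>k<2^n. ennreal (Y (n, k) \<omega> ^ (2*q))"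
    have [measurable]: "k < 2^n \<Longrightarrow> Y (n, k) \<in> borel_measurable M" for n k
      using Y[of "(n, k)"] by (simp add: cells_def)
    have "(\<integral>\<^sup>+\<omega>. (SUP i\<in>cells. ennreal (Y i \<omega>)) ^ (2*q) \<partial>M) \<le> (\<integral>\<^sup>+\<omega>. ?T \<omega> \<partial>M)"
    proof (rule nn_integral_mono, rule ennreal_SUP_power_le)
      fix \<omega> i assume "i \<in> cells"
      then obtain n k where i: "i = (n, k)" "k < 2^n" by (auto simp: cells_def)
      have "ennreal (Y (n, k) \<omega> ^ (2*q)) \<le> (\<Sum>k<2^n. ennreal (Y (n, k) \<omega> ^ (2*q)))"
        using i by (intro member_le_sum) auto
      also have "\<dots> \<le> ?T \<omega>"
        using sum_le_suminf[of "\<lambda>n. \<Sum>k<2^n. ennreal (Y (n, k) \<omega> ^ (2*q))" "{n}"] by simp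
      finally show "ennreal (Y i \<omega> ^ (2*q)) \<le> ?T \<omega>" unfolding i .
    qed (use q Y0 in auto)
    also have "\<dots> = (\<Sum>n. \<Sum>k<2^n. \<integral>\<^sup>+\<omega>. ennreal (Y (n, k) \<omega> ^ (2*q)) \<partial>M)"
      by (subst nn_integral_suminf) (auto intro!: suminf_cong nn_integral_sum simp del: sum_ennreal)
    also have "\<dots> \<le> (\<Sum>n. \<Sum>k<(2::nat)^n. ennreal ((C * real q)^q * dyad n (2 * \<kappa> * real q)))"
      using mom q1 by (intro suminf_le sum_mono) auto
    also have "\<dots> \<le> (\<Sum>n. ennreal ((C * real q)^q * (1/2)^n))"
    proof (intro suminf_le)
      fix n :: nat
      have "(\<Sum>k<(2::nat)^n. ennreal ((C * real q)^q * dyad n (2 * \<kappa> * real q))) = ennreal (\<Sum>k<(2::nat)^n. (C * real q)^q * dyad n (2 * \<kappa> * real q))"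
        using C dyad_pos[of n] by (intro sum_ennreal) (auto simp: less_imp_le)
      also have "\<dots> = ennreal ((C * real q)^q * (2^n * dyad n (2 * \<kappa> * real q)))"
        by (simp add: mult_ac)
      also have "\<dots> \<le> ennreal ((C * real q)^q * (1/2)^n)"
        using C dy by (intro ennreal_leI mult_left_mono) auto
      finally show "(\<Sum>k<(2::nat)^n. ennreal ((C * real q)^q * dyad n (2 * \<kappa> * real q))) \<le> ennreal ((C * real q)^q * (1/2)^n)" .
    qed auto
    also have "\<dots> = ennreal (\<Sum>n. (C * real q)^q * (1/2)^n)"
      using C by (intro suminf_ennreal2 summable_mult summable_geometric) auto
    also have "(\<Sum>n. (C * real q)^q * (1/2)^n) = 2 * (C * real q)^q"
      using suminf_geometric[of "1/2::real"] by (subst suminf_mult) (auto intro!: summable_geometric)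
    finally show "(\<integral>\<^sup>+\<omega>. (SUP i\<in>cells. ennreal (Y i \<omega>)) ^ (2*q) \<partial>M) \<le> ennreal (2 * (C * real q)^q)" .
  qed
qed

text \<open>In place of Jensen's inequality for the power \<open>m + 1\<close> stands the pointwise
  bound \<open>u \<le> u^(m+1) / L^m + L\<close>; the factor 2 that it costs is absorbed in
  \<open>2^q\<close>. The root divides the spare exponent \<open>(m + 1) \<kappa>\<close> down to
  \<kappa>.\<close>

lemma (in prob_space) root_moment_le:
  fixes Z :: "'a \<Rightarrow> real"
  assumes Z [measurable]: "Z \<in> borel_measurable M" and q: "q \<ge> 1" and K: "K > 0"
    and mom: "(\<integral>\<^sup>+\<omega>. ennreal (Z \<omega> ^ (2*q)) \<partial>M) \<le> ennreal ((K * real q)^(Suc m * q) * dyad n (2 * real q * (\<gamma> + real (Suc m) * \<kappa>)))"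
  shows "(\<integral>\<^sup>+\<omega>. ennreal (((\<bar>Z \<omega>\<bar> / dyad n \<gamma>) powr (1 / real (Suc m))) ^ (2*q)) \<partial>M)
     \<le> ennreal ((2 * K * real q)^q * dyad n (2 * \<kappa> * real q))"
proof -
  define u where "u \<omega> = ((\<bar>Z \<omega>\<bar> / dyad n \<gamma>) powr (1 / real (Suc m))) ^ (2*q)" for \<omega>
  \<comment> \<open>Chosen so that the hypothesis becomes \<open>E u^(m+1) \<le> L^(m+1)\<close>; it
    also separates the cases of the pointwise bound.\<close>
  define L where "L = (K * real q)^q * dyad n (2 * \<kappa> * real q)"
  have L: "L > 0" using K q dyad_pos[of n] by (simp add: L_def)
  have u0: "u \<omega> \<ge> 0" for \<omega> by (simp add: u_def)
  have um [measurable]: "u \<in> borel_measurable M" unfolding u_def by measurable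
  have up: "u \<omega> ^ Suc m = (1 / dyad n (2 * real q * \<gamma>)) * Z \<omega> ^ (2*q)" for \<omega>
  proof -
    have "((\<bar>Z \<omega>\<bar> / dyad n \<gamma>) powr (1 / real (Suc m))) ^ Suc m = \<bar>Z \<omega>\<bar> / dyad n \<gamma>"
      using dyad_pos[of n \<gamma>] by (cases "Z \<omega> = 0") (auto simp: powr_power simp del: power_Suc)
    moreover have "u \<omega> ^ Suc m = (((\<bar>Z \<omega>\<bar> / dyad n \<gamma>) powr (1 / real (Suc m))) ^ Suc m) ^ (2*q)"
      unfolding u_def by (simp only: power_mult[symmetric] mult_ac)
    ultimately have "u \<omega> ^ Suc m = (\<bar>Z \<omega>\<bar> / dyad n \<gamma>) ^ (2*q)" by simp
    also have "\<dots> = \<bar>Z \<omega>\<bar> ^ (2*q) / dyad n \<gamma> ^ (2*q)" by (rule power_divide)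
    finally show ?thesis by (simp add: dyad_power power_even_abs)
  qed
  have Eu: "(\<integral>\<^sup>+\<omega>. ennreal (u \<omega> ^ Suc m) \<partial>M) \<le> ennreal (L ^ Suc m)"
  proof -
    have "(\<integral>\<^sup>+\<omega>. ennreal (u \<omega> ^ Suc m) \<partial>M) = ennreal (1 / dyad n (2 * real q * \<gamma>)) * (\<integral>\<^sup>+\<omega>. ennreal (Z \<omega> ^ (2*q)) \<partial>M)"
      unfolding up using dyad_pos[of n "2 * real q * \<gamma>"]
      by (subst nn_integral_cmult[symmetric]) (auto intro!: nn_integral_cong simp: ennreal_mult'[symmetric])
    also have "\<dots> \<le> ennreal (1 / dyad n (2 * real q * \<gamma>)) * ennreal ((K * real q)^(Suc m * q) * dyad n (2 * real q * (\<gamma> + real (Suc m) * \<kappa>)))"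
      by (intro mult_left_mono mom) auto
    also have "\<dots> = ennreal (1 / dyad n (2 * real q * \<gamma>) * ((K * real q)^(Suc m * q) * dyad n (2 * real q * (\<gamma> + real (Suc m) * \<kappa>))))"
      using dyad_pos[of n] by (subst ennreal_mult') (auto simp: less_imp_le)
    also have "1 / dyad n (2 * real q * \<gamma>) * ((K * real q)^(Suc m * q) * dyad n (2 * real q * (\<gamma> + real (Suc m) * \<kappa>))) = L ^ Suc m"
    proof -
      have "2 * real q * (\<gamma> + real (Suc m) * \<kappa>) = 2 * real q * \<gamma> + real (Suc m) * (2 * \<kappa> * real q)"
        by (simp only: distrib_left mult_ac)
      then have "dyad n (2 * real q * (\<gamma> + real (Suc m) * \<kappa>)) = dyad n (2 * real q * \<gamma>) * dyad n (2 * \<kappa> * real q) ^ Suc m"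
        by (simp only: dyad_add dyad_power)
      moreover have "(K * real q)^(Suc m * q) = ((K * real q)^q) ^ Suc m"
        by (simp only: power_mult[symmetric] mult_ac)
      ultimately show ?thesis
        using dyad_pos[of n "2 * real q * \<gamma>"] by (simp add: L_def power_mult_distrib del: power_Suc mult_Suc)
    qed
    finally show ?thesis .
  qed
  have "(\<integral>\<^sup>+\<omega>. ennreal (u \<omega>) \<partial>M) \<le> (\<integral>\<^sup>+\<omega>. ennreal (1 / L^m) * ennreal (u \<omega> ^ Suc m) + ennreal L \<partial>M)"
  proof (rule nn_integral_mono)
    fix \<omega>
    have "u \<omega> \<le> 1 / L^m * u \<omega> ^ Suc m + L"
    proof (cases "u \<omega> \<le> L")
      case True
      then show ?thesis using L u0[of \<omega>] by (intro add_increasing) auto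
    next
      case False
      then have "L^m \<le> u \<omega> ^ m" using L by (intro power_mono) auto
      then have "u \<omega> * L^m \<le> u \<omega> * u \<omega> ^ m" using u0 by (intro mult_left_mono) auto
      then have "u \<omega> \<le> 1 / L^m * u \<omega> ^ Suc m" using L by (simp add: field_simps)
      then show ?thesis using L by simp
    qed
    then show "ennreal (u \<omega>) \<le> ennreal (1 / L^m) * ennreal (u \<omega> ^ Suc m) + ennreal L"
      using L u0[of \<omega>] by (simp add: ennreal_mult[symmetric] ennreal_plus[symmetric] ennreal_leI del: ennreal_plus power_Suc)
  qed
  also have "\<dots> = ennreal (1 / L^m) * (\<integral>\<^sup>+\<omega>. ennreal (u \<omega> ^ Suc m) \<partial>M) + ennreal L"
    by (subst nn_integral_add) (auto simp: nn_integral_cmult emeasure_space_1 simp del: power_Suc)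
  also have "\<dots> \<le> ennreal (1 / L^m) * ennreal (L ^ Suc m) + ennreal L"
    by (intro add_right_mono mult_left_mono Eu) auto
  also have "\<dots> = ennreal (2 * L)"
    using L by (simp add: ennreal_mult'[symmetric] ennreal_plus[symmetric] del: ennreal_plus)
  also have "\<dots> \<le> ennreal ((2 * K * real q)^q * dyad n (2 * \<kappa> * real q))"
  proof (rule ennreal_leI)
    have "2 * L \<le> 2^q * L"
      using L q by (intro mult_right_mono self_le_power) auto
    also have "\<dots> = (2 * K * real q)^q * dyad n (2 * \<kappa> * real q)" by (simp add: L_def power_mult_distrib)
    finally show "2 * L \<le> (2 * K * real q)^q * dyad n (2 * \<kappa> * real q)" .
  qed
  finally show ?thesis unfolding u_def .
qed

subsection \<open>From dyadic cells to Hoelder norms\<close>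

lemma chen_family_scale:
  assumes "chen_family M x A" and L: "L > 0"
  shows "chen_family M (\<lambda>t. x t / L) (\<lambda>m s t. A m s t / L^(m+1))"
  unfolding chen_family_def
proof (intro allI impI)
  fix m n a b c :: nat
  assume h: "m \<le> M" "a \<le> b" "b \<le> c" "c \<le> 2^n"
  let ?d = "x (real b / 2^n) - x (real a / 2^n)"
  have "A m (real a / 2^n) (real c / 2^n) = A m (real a / 2^n) (real b / 2^n) +
      (\<Sum>j\<le>m. real (m choose j) * ?d ^ (m - j) * A j (real b / 2^n) (real c / 2^n))"
    using assms(1) h unfolding chen_family_def by blast
  then have "A m (real a / 2^n) (real c / 2^n) / L^(m+1) = A m (real a / 2^n) (real b / 2^n) / L^(m+1) +
      (\<Sum>j\<le>m. real (m choose j) * ?d ^ (m - j) * A j (real b / 2^n) (real c / 2^n) / L^(m+1))"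
    by (simp only: add_divide_distrib sum_divide_distrib)
  also have "(\<Sum>j\<le>m. real (m choose j) * ?d ^ (m - j) * A j (real b / 2^n) (real c / 2^n) / L^(m+1))
    = (\<Sum>j\<le>m. real (m choose j) * (x (real b / 2^n) / L - x (real a / 2^n) / L) ^ (m - j) * (A j (real b / 2^n) (real c / 2^n) / L^(j+1)))"
  proof (intro sum.cong refl)
    fix j assume "j \<in> {..m}"
    then have "L^(m+1) = L^(m-j) * L^(j+1)" by (simp add: power_add[symmetric])
    then show "real (m choose j) * ?d ^ (m - j) * A j (real b / 2^n) (real c / 2^n) / L^(m+1)
      = real (m choose j) * (x (real b / 2^n) / L - x (real a / 2^n) / L) ^ (m - j) * (A j (real b / 2^n) (real c / 2^n) / L^(j+1))"
      by (simp add: diff_divide_distrib[symmetric] power_divide)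
  qed
  finally show "A m (real a / 2^n) (real c / 2^n) / L^(m+1) = A m (real a / 2^n) (real b / 2^n) / L^(m+1) +
     (\<Sum>j\<le>m. real (m choose j) * (x (real b / 2^n) / L - x (real a / 2^n) / L) ^ (m - j) * (A j (real b / 2^n) (real c / 2^n) / L^(j+1)))" .
qed

lemma cell_bounds_scale:
  assumes "cell_bounds \<alpha> \<beta> M L x A" and L: "L > 0"
  shows "cell_bounds \<alpha> \<beta> M 1 (\<lambda>t. x t / L) (\<lambda>m s t. A m s t / L^(m+1))"
  unfolding cell_bounds_def
proof (intro allI impI conjI)
  fix n k :: nat assume k: "k < 2^n"
  have "\<bar>x (real (Suc k) / 2^n) - x (real k / 2^n)\<bar> \<le> L * dyad n \<alpha>"
    using assms(1) k unfolding cell_bounds_def by blast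
  then show "\<bar>x (real (Suc k) / 2^n) / L - x (real k / 2^n) / L\<bar> \<le> 1 * dyad n \<alpha>"
    using L by (simp add: diff_divide_distrib[symmetric] abs_divide pos_divide_le_eq mult.commute)
  fix m assume "m \<le> M"
  then have "\<bar>A m (real k / 2^n) (real (Suc k) / 2^n)\<bar> \<le> L^(m+1) * dyad n (real m * \<alpha> + \<beta>)"
    using assms(1) k unfolding cell_bounds_def by blast
  then show "\<bar>A m (real k / 2^n) (real (Suc k) / 2^n) / L^(m+1)\<bar> \<le> 1^(m+1) * dyad n (real m * \<alpha> + \<beta>)"
    using L by (simp add: abs_divide pos_divide_le_eq mult_ac)
qed

text \<open>With \<open>k\<close> least such that \<open>b - a \<le> 2^k\<close> one has
  \<open>2^k < 2 (b - a)\<close>, so for \<open>p = n - k\<close> the size \<open>2^(-p)\<close> is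
  at least the length of the interval and less than twice that length. This is the origin of
  \<open>2 powr \<gamma>\<close>.\<close>

lemma dyad_scale_exists:
  fixes a b n :: nat
  assumes "a < b" "b \<le> 2^n"
  obtains p where "p \<le> n" "b - a \<le> 2^(n-p)"
    "\<And>\<gamma>. \<gamma> \<ge> 0 \<Longrightarrow> dyad p \<gamma> \<le> 2 powr \<gamma> * (real b / 2^n - real a / 2^n) powr \<gamma>"
proof -
  define k where "k = (LEAST k. b - a \<le> 2^k)"
  have "b - a \<le> 2^n" using assms by simp
  then have k: "b - a \<le> 2^k" "k \<le> n" unfolding k_def by (auto intro: LeastI Least_le)
  have k2: "2^k < 2 * (b - a)"
  proof (cases k)
    case 0 then show ?thesis using assms by simp
  next
    case (Suc j)
    then have "\<not> b - a \<le> 2^j" unfolding k_def using not_less_Least by (metis lessI)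
    then show ?thesis using Suc by simp
  qed
  have "dyad (n - k) \<gamma> \<le> 2 powr \<gamma> * (real b / 2^n - real a / 2^n) powr \<gamma>" if "\<gamma> \<ge> 0" for \<gamma>
  proof -
    have "dyad (n - k) \<gamma> = (2^k / 2^n) powr \<gamma>"
    proof -
      have "(2::real)^k / 2^n = 2 powr (- real (n - k))"
        using k(2) by (simp add: powr_realpow[symmetric] powr_diff[symmetric] of_nat_diff)
      then show ?thesis by (simp add: dyad_def powr_powr)
    qed
    also have "\<dots> \<le> (2 * (real b / 2^n - real a / 2^n)) powr \<gamma>"
    proof (rule powr_mono2[OF that])
      have "real (2^k) \<le> real (2 * (b - a))" using k2 by (intro of_nat_mono) simp
      then have "(2::real)^k \<le> 2 * (real b - real a)" using assms by (simp add: of_nat_diff)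
      then have "(2::real)^k / 2^n \<le> 2 * (real b - real a) / 2^n" by (rule divide_right_mono) simp
      then show "(2::real)^k / 2^n \<le> 2 * (real b / 2^n - real a / 2^n)" by (simp add: diff_divide_distrib)
    qed simp
    also have "\<dots> = 2 powr \<gamma> * (real b / 2^n - real a / 2^n) powr \<gamma>"
      using assms by (subst powr_mult) (auto simp: divide_right_mono)
    finally show ?thesis .
  qed
  with k that[of "n - k"] show thesis by simp
qed

text \<open>Dividing by powers of \<open>L\<close> reduces to \<open>L = 1\<close>, where the
  chaining constants do not depend on the path; undoing the scaling restores \<open>L^(m+1)\<close>.
  Adding up the finitely many constants gives one for all \<open>m \<le> M\<close>.\<close>

lemma chen_family_holder:
  assumes \<alpha>: "\<alpha> > 0" and \<beta>: "\<beta> > 0"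
  shows "\<exists>C\<ge>1. \<forall>x A L n a b. L > 0 \<longrightarrow> chen_family M x A \<longrightarrow> cell_bounds \<alpha> \<beta> M L x A \<longrightarrow> a < b \<longrightarrow> b \<le> 2^n \<longrightarrow>
     \<bar>x (real b / 2^n) - x (real a / 2^n)\<bar> \<le> C * L * (real b / 2^n - real a / 2^n) powr \<alpha> \<and>
     (\<forall>m\<le>M. \<bar>A m (real a / 2^n) (real b / 2^n)\<bar> \<le> C * L^(m+1) * (real b / 2^n - real a / 2^n) powr (real m * \<alpha> + \<beta>))"
proof -
  define \<gamma> where "\<gamma> m = real m * \<alpha> + \<beta>" for m
  have \<gamma>0: "\<gamma> m \<ge> 0" for m using \<alpha> \<beta> by (simp add: \<gamma>_def)
  have "\<forall>m. \<exists>C\<ge>0. \<forall>x A n p a b. chen_family M x A \<longrightarrow> cell_bounds \<alpha> \<beta> M 1 x A \<longrightarrow> p \<le> n \<longrightarrow> a \<le> b \<longrightarrow>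
     b \<le> 2^n \<longrightarrow> b - a \<le> 2^(n-p) \<longrightarrow> m \<le> M \<longrightarrow> \<bar>A m (real a / 2^n) (real b / 2^n)\<bar> \<le> C * dyad p (\<gamma> m)"
    using lift_chaining[OF \<alpha> \<beta>] unfolding \<gamma>_def by blast
  from choice[OF this] obtain C where C: "\<And>m. C m \<ge> 0"
    "\<And>m x A n p a b. chen_family M x A \<Longrightarrow> cell_bounds \<alpha> \<beta> M 1 x A \<Longrightarrow> p \<le> n \<Longrightarrow> a \<le> b \<Longrightarrow>
     b \<le> 2^n \<Longrightarrow> b - a \<le> 2^(n-p) \<Longrightarrow> m \<le> M \<Longrightarrow> \<bar>A m (real a / 2^n) (real b / 2^n)\<bar> \<le> C m * dyad p (\<gamma> m)"
    by blast
  define Cx where "Cx = 2 / (1 - 2 powr (-\<alpha>))"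
  have Cx: "Cx \<ge> 0" using \<alpha> by (auto simp: Cx_def powr_less_one less_imp_le)
  define K where "K = 1 + Cx * 2 powr \<alpha> + (\<Sum>m\<le>M. C m * 2 powr (\<gamma> m))"
  have S0: "(\<Sum>m\<le>M. C m * 2 powr (\<gamma> m)) \<ge> 0" using C(1) by (intro sum_nonneg) auto
  have K: "K \<ge> 1" "Cx * 2 powr \<alpha> \<le> K" "\<And>m. m \<le> M \<Longrightarrow> C m * 2 powr (\<gamma> m) \<le> K"
  proof -
    have "Cx * 2 powr \<alpha> \<ge> 0" using Cx by simp
    then show "K \<ge> 1" "Cx * 2 powr \<alpha> \<le> K" using S0 by (auto simp: K_def)
    fix m assume "m \<le> M"
    then have "C m * 2 powr (\<gamma> m) \<le> (\<Sum>m\<le>M. C m * 2 powr (\<gamma> m))"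
      using C(1) by (intro member_le_sum) auto
    then show "C m * 2 powr (\<gamma> m) \<le> K" using \<open>Cx * 2 powr \<alpha> \<ge> 0\<close> by (simp add: K_def)
  qed
  have "\<bar>x (real b / 2^n) - x (real a / 2^n)\<bar> \<le> K * L * (real b / 2^n - real a / 2^n) powr \<alpha> \<and>
     (\<forall>m\<le>M. \<bar>A m (real a / 2^n) (real b / 2^n)\<bar> \<le> K * L^(m+1) * (real b / 2^n - real a / 2^n) powr (\<gamma> m))"
    if L: "L > 0" and chen: "chen_family M x A" and cb: "cell_bounds \<alpha> \<beta> M L x A" and ab: "a < b" "b \<le> 2^n"
    for x A L n a b
  proof -
    let ?x = "\<lambda>t. x t / L" and ?A = "\<lambda>m s t. A m s t / L^(m+1)"
    let ?\<tau> = "real b / 2^n - real a / 2^n"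
    note ch' = chen_family_scale[OF chen L] and cb' = cell_bounds_scale[OF cb L]
    obtain p where p: "p \<le> n" "b - a \<le> 2^(n-p)"
      "\<And>\<gamma>. \<gamma> \<ge> 0 \<Longrightarrow> dyad p \<gamma> \<le> 2 powr \<gamma> * ?\<tau> powr \<gamma>"
      using dyad_scale_exists[OF ab] by metis
    have "\<bar>?x (real b / 2^n) - ?x (real a / 2^n)\<bar> \<le> Cx * dyad p \<alpha>"
      unfolding Cx_def using ab p by (intro path_chaining[OF \<alpha> cb']) auto
    also have "\<dots> \<le> Cx * (2 powr \<alpha> * ?\<tau> powr \<alpha>)"
      using Cx \<alpha> by (intro mult_left_mono p) auto
    also have "\<dots> = Cx * 2 powr \<alpha> * ?\<tau> powr \<alpha>" by simp
    also have "\<dots> \<le> K * ?\<tau> powr \<alpha>"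
      using K(2) by (intro mult_right_mono) auto
    finally have 1: "\<bar>x (real b / 2^n) - x (real a / 2^n)\<bar> \<le> K * L * ?\<tau> powr \<alpha>"
      using L by (simp add: diff_divide_distrib[symmetric] abs_divide pos_divide_le_eq mult_ac)
    have "\<bar>A m (real a / 2^n) (real b / 2^n)\<bar> \<le> K * L^(m+1) * ?\<tau> powr (\<gamma> m)" if m: "m \<le> M" for m
    proof -
      have "\<bar>?A m (real a / 2^n) (real b / 2^n)\<bar> \<le> C m * dyad p (\<gamma> m)"
        using ab p m by (intro C(2)[OF ch' cb']) auto
      also have "\<dots> \<le> C m * (2 powr \<gamma> m * ?\<tau> powr \<gamma> m)"
        using C(1) \<gamma>0 by (intro mult_left_mono p) auto
      also have "\<dots> = C m * 2 powr \<gamma> m * ?\<tau> powr \<gamma> m" by simp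
      also have "\<dots> \<le> K * ?\<tau> powr \<gamma> m"
        using K(3)[OF m] by (intro mult_right_mono) auto
      finally show ?thesis
        using L by (simp add: abs_divide pos_divide_le_eq mult_ac)
    qed
    with 1 show ?thesis by blast
  qed
  then show ?thesis using K(1) unfolding \<gamma>_def by blast
qed

section \<open>Reduction of two-parameter norms to dyadic times\<close>

definition time_pairs :: "(real \<times> real) set" where
  "time_pairs = {(s,t). 0 \<le> s \<and> s < t \<and> t \<le> 1}"

definition dyadic_pairs :: "(real \<times> real) set" where
  "dyadic_pairs = (\<lambda>(n, a, b). (real a / 2^n, real b / 2^n)) ` {(n, a, b). a < b \<and> b \<le> 2^n}"

lemma dyadic_pairs_subset: "dyadic_pairs \<subseteq> time_pairs"
  using dyadic_in_unit by (auto simp: dyadic_pairs_def time_pairs_def divide_strict_right_mono)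

lemma countable_dyadic_pairs: "countable dyadic_pairs"
  unfolding dyadic_pairs_def by (intro countable_image) auto

lemma dyadic_pairs_dense:
  assumes "(s, t) \<in> time_pairs"
  obtains f where "\<And>n. f n \<in> dyadic_pairs" "f \<longlonglongrightarrow> (s, t)"
proof -
  have st: "0 \<le> s" "s < t" "t \<le> 1" using assms by (auto simp: time_pairs_def)
  define d where "d n u = real (nat \<lfloor>u * 2^n\<rfloor>) / 2^n" for n and u :: real
  have lim: "(\<lambda>n. d n u) \<longlonglongrightarrow> u" if "u \<ge> 0" for u
  proof (rule real_tendsto_sandwich)
    have fl: "real (nat \<lfloor>u * 2^n\<rfloor>) = of_int \<lfloor>u * 2^n\<rfloor>" for n using that by (simp add: of_nat_nat)
    have "u - (1/2)^n \<le> d n u" for n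
    proof -
      have "u * 2^n - 1 \<le> of_int \<lfloor>u * 2^n\<rfloor>" by linarith
      then have "(u * 2^n - 1) / 2^n \<le> d n u" unfolding d_def fl by (rule divide_right_mono) simp
      then show ?thesis by (simp add: diff_divide_distrib power_one_over)
    qed
    then show "eventually (\<lambda>n. u - (1/2)^n \<le> d n u) sequentially" by simp
    have "d n u \<le> u" for n unfolding d_def fl by (simp add: divide_le_eq)
    then show "eventually (\<lambda>n. d n u \<le> u) sequentially" by simp
    have "(\<lambda>n. u - (1/2::real)^n) \<longlonglongrightarrow> u - 0" by (intro tendsto_intros LIMSEQ_power_zero) auto
    then show "(\<lambda>n. u - (1/2::real)^n) \<longlonglongrightarrow> u" by simp
  qed simp
  have lims: "(\<lambda>n. d n s) \<longlonglongrightarrow> s" "(\<lambda>n. d n t) \<longlonglongrightarrow> t" using lim st by auto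
  have "(\<lambda>n. d n t - d n s) \<longlonglongrightarrow> t - s" using lims by (intro tendsto_diff)
  then have "eventually (\<lambda>n. d n t - d n s > 0) sequentially"
    using st by (intro order_tendstoD(1)) auto
  then obtain N where N: "\<And>n. n \<ge> N \<Longrightarrow> d n s < d n t" by (auto simp: eventually_sequentially)
  \<comment> \<open>The shift by \<open>N\<close> skips the coarse levels, on which \<open>s\<close>
    and \<open>t\<close> may be rounded to the same point.\<close>
  define f where "f n = (d (n + N) s, d (n + N) t)" for n
  have "f n \<in> dyadic_pairs" for n
  proof -
    let ?a = "nat \<lfloor>s * 2^(n + N)\<rfloor>" and ?b = "nat \<lfloor>t * 2^(n + N)\<rfloor>"
    have "?a < ?b" using N[of "n + N"] by (simp add: d_def divide_less_cancel)
    moreover have "?b \<le> 2^(n + N)"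
    proof -
      have "\<lfloor>t * 2^(n + N)\<rfloor> \<le> \<lfloor>(2::real)^(n + N)\<rfloor>" using st by (intro floor_mono) simp
      then show ?thesis by (simp add: nat_le_iff)
    qed
    ultimately show ?thesis unfolding dyadic_pairs_def f_def d_def
      by (intro image_eqI[of _ _ "(n + N, ?a, ?b)"]) auto
  qed
  moreover have "f \<longlonglongrightarrow> (s, t)"
    unfolding f_def using lims by (intro tendsto_Pair) (auto intro: LIMSEQ_ignore_initial_segment)
  ultimately show thesis using that by blast
qed

text \<open>By continuity off the diagonal, countably many pairs suffice. This yields both the
  measurability of the norm and its reduction to the chaining bounds.\<close>

lemma holder2_eq_dyadic:
  assumes cont: "continuous_on time_pairs (\<lambda>(s,t). A s t)"
  shows "holder2 \<gamma> A = (SUP st\<in>dyadic_pairs. ennreal (\<bar>A (fst st) (snd st)\<bar> / (snd st - fst st) powr \<gamma>))"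
    (is "_ = (SUP st\<in>_. ennreal (?g st))")
proof (rule antisym)
  have cont': "continuous_on time_pairs (\<lambda>st. A (fst st) (snd st))"
    using cont by (simp add: case_prod_beta)
  have g: "continuous_on time_pairs ?g"
    by (intro continuous_intros cont') (auto simp: time_pairs_def)
  show "holder2 \<gamma> A \<le> (SUP st\<in>dyadic_pairs. ennreal (?g st))"
    unfolding holder2_def
  proof (rule SUP_least)
    fix st :: "real \<times> real" assume "st \<in> {(s,t). 0 \<le> s \<and> s < t \<and> t \<le> 1}"
    then have st: "(fst st, snd st) \<in> time_pairs" by (auto simp: time_pairs_def)
    obtain f where f: "\<And>n. f n \<in> dyadic_pairs" "f \<longlonglongrightarrow> st"
      using dyadic_pairs_dense[OF st] by (metis prod.collapse)
    have "(\<lambda>n. ?g (f n)) \<longlonglongrightarrow> ?g st"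
      using f st dyadic_pairs_subset by (intro continuous_on_tendsto_compose[OF g]) (auto simp: always_eventually subset_eq)
    then have "(\<lambda>n. ennreal (?g (f n))) \<longlonglongrightarrow> ennreal (?g st)" by (rule tendsto_ennrealI)
    then show "ennreal (?g st) \<le> (SUP st\<in>dyadic_pairs. ennreal (?g st))"
      by (rule LIMSEQ_le_const2) (auto intro!: exI[of _ 0] SUP_upper f(1))
  qed
  show "(SUP st\<in>dyadic_pairs. ennreal (?g st)) \<le> holder2 \<gamma> A"
    unfolding holder2_def using dyadic_pairs_subset by (intro SUP_subset_mono) (auto simp: time_pairs_def)
qed

lemma holder2_measurable:
  assumes "\<And>\<omega>. \<omega> \<in> space P \<Longrightarrow> continuous_on time_pairs (\<lambda>(s,t). A s t \<omega>)"
    and "\<And>s t. (s, t) \<in> time_pairs \<Longrightarrow> A s t \<in> borel_measurable P"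
  shows "(\<lambda>\<omega>. holder2 \<gamma> (\<lambda>s t. A s t \<omega>)) \<in> borel_measurable P"
proof -
  have "(\<lambda>\<omega>. SUP st\<in>dyadic_pairs. ennreal (\<bar>A (fst st) (snd st) \<omega>\<bar> / (snd st - fst st) powr \<gamma>)) \<in> borel_measurable P"
  proof (rule borel_measurable_SUP[OF countable_dyadic_pairs])
    fix st assume "st \<in> dyadic_pairs"
    then have [measurable]: "A (fst st) (snd st) \<in> borel_measurable P"
      using assms(2)[of "fst st" "snd st"] dyadic_pairs_subset by auto
    show "(\<lambda>\<omega>. ennreal (\<bar>A (fst st) (snd st) \<omega>\<bar> / (snd st - fst st) powr \<gamma>)) \<in> borel_measurable P"
      by measurable
  qed
  also have "?this \<longleftrightarrow> ?thesis"
    using assms(1) by (intro measurable_cong) (simp add: holder2_eq_dyadic)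
  finally show ?thesis .
qed

lemma holder2_le:
  assumes cont: "continuous_on time_pairs (\<lambda>(s,t). A s t)"
    and le: "\<And>n a b. a < b \<Longrightarrow> b \<le> 2^n \<Longrightarrow> \<bar>A (real a / 2^n) (real b / 2^n)\<bar> \<le> C * (real b / 2^n - real a / 2^n) powr \<gamma>"
  shows "holder2 \<gamma> A \<le> ennreal C"
  unfolding holder2_eq_dyadic[OF cont]
proof (rule SUP_least)
  fix st assume "st \<in> dyadic_pairs"
  then obtain n a b where ab: "st = (real a / 2^n, real b / 2^n)" "a < b" "b \<le> 2^n"
    by (auto simp: dyadic_pairs_def)
  then have "(real b / 2^n - real a / 2^n) powr \<gamma> > 0" by (simp add: divide_strict_right_mono)
  then show "ennreal (\<bar>A (fst st) (snd st)\<bar> / (snd st - fst st) powr \<gamma>) \<le> ennreal C"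
    using le[OF ab(2,3)] by (intro ennreal_leI) (simp add: ab(1) pos_divide_le_eq)
qed

lemma enn_root_measurable [measurable]: "enn_root p \<in> borel_measurable borel"
  unfolding enn_root_def by measurable

text \<open>For \<open>C \<ge> 1\<close> the constant may be raised to \<open>C^p\<close> before
  taking the root, so the same \<open>C\<close> serves every degree.\<close>

lemma enn_root_le:
  assumes "x \<le> ennreal (C * L^p)" "C \<ge> 1" "L \<ge> 0" "p > 0"
  shows "enn_root p x \<le> ennreal (C * L)"
proof -
  have "x \<noteq> \<infinity>" using assms by (auto simp: top_unique)
  have "enn2real x \<le> C * L^p" using assms by (intro enn2real_leI) auto
  also have "\<dots> \<le> C^p * L^p" using assms by (intro mult_right_mono self_le_power) auto
  finally have "enn2real x powr (1 / real p) \<le> ((C * L)^p) powr (1 / real p)"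
    by (intro powr_mono2) (auto simp: power_mult_distrib)
  also have "\<dots> = C * L"
    using assms by (cases "L = 0") (auto simp: powr_powr powr_realpow[symmetric])
  finally show ?thesis using \<open>x \<noteq> \<infinity>\<close> by (simp add: enn_root_def ennreal_leI)
qed

subsection \<open>The homogeneous norm\<close>

locale continuous_ito_model = ito_model +
  fixes \<kappa> :: real
  assumes \<kappa>: "\<kappa> > 0" "\<kappa> < H"
    and Wh_cont: "\<omega> \<in> space P \<Longrightarrow> continuous_on {0..1} (\<lambda>t. Wh t \<omega>)"
    and WW_cont: "m \<in> {1..M} \<Longrightarrow> \<omega> \<in> space P \<Longrightarrow> continuous_on time_pairs (\<lambda>(s,t). WW e m s t \<omega>)"
begin

abbreviation \<alpha> :: real where "\<alpha> \<equiv> H - \<kappa>"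
abbreviation \<beta> :: real where "\<beta> \<equiv> 1/2 - \<kappa>"

lemma exponents_pos: "\<alpha> > 0" "\<beta> > 0"
  using \<kappa> H by auto

lemma increment_cont:
  assumes "continuous_on {0..1} f"
  shows "continuous_on time_pairs (\<lambda>(s,t). f t - f s :: real)"
  unfolding case_prod_beta
  by (intro continuous_on_diff continuous_on_compose2[OF assms] continuous_on_fst continuous_on_snd continuous_on_id)
     (auto simp: time_pairs_def)

lemma lift_cont:
  assumes "m \<le> M" "\<omega> \<in> space P"
  shows "continuous_on time_pairs (\<lambda>(s,t). lift e m s t \<omega>)"
proof (cases "m = 0")
  case True
  have "continuous_on {0..1} (\<lambda>t. bm e t \<omega>)"
    using std_BM_bm[of e] assms by (simp add: std_BM_def)
  from increment_cont[OF this] show ?thesis using True by (simp add: lift_def)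
next
  case False
  then have "continuous_on time_pairs (\<lambda>(s,t). WW e m s t \<omega>)" using assms by (intro WW_cont) auto
  also have "?this \<longleftrightarrow> ?thesis"
    using False by (intro continuous_on_cong) (auto simp: lift_def time_pairs_def)
  finally show ?thesis .
qed

text \<open>When finite, the least \<open>L\<close> for which \<open>Z\<close> is bounded by
  \<open>L^(m+1) * dyad n \<gamma>\<close> on all cells of all levels \<open>n\<close>.\<close>

definition cell_sup :: "(real \<Rightarrow> real \<Rightarrow> 'a \<Rightarrow> real) \<Rightarrow> real \<Rightarrow> nat \<Rightarrow> 'a \<Rightarrow> ennreal" where
  "cell_sup Z \<gamma> m \<omega> = (SUP i\<in>cells.
     ennreal ((\<bar>Z (real (snd i) / 2^fst i) (real (Suc (snd i)) / 2^fst i) \<omega>\<bar> / dyad (fst i) \<gamma>) powr (1 / real (Suc m))))"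

lemma exp_sq_integrable_cell_sup:
  assumes Z: "\<And>n k. k < 2^n \<Longrightarrow> Z (real k / 2^n) (real (Suc k) / 2^n) \<in> borel_measurable P" and K: "K > 0"
    and mom: "\<And>n k q. k < 2^n \<Longrightarrow> q \<ge> 1 \<Longrightarrow>
      (\<integral>\<^sup>+\<omega>. ennreal (Z (real k / 2^n) (real (Suc k) / 2^n) \<omega> ^ (2*q)) \<partial>P)
       \<le> ennreal ((K * real q)^(Suc m * q) * dyad n (2 * real q * (\<gamma> + real (Suc m) * \<kappa>)))"
  shows "exp_sq_integrable P (cell_sup Z \<gamma> m)"
  unfolding cell_sup_def
proof (rule exp_sq_integrable_cell_SUP[OF _ _ \<kappa>(1), where C = "2 * K"])
  fix i assume "i \<in> cells"
  then have [measurable]: "Z (real (snd i) / 2^fst i) (real (Suc (snd i)) / 2^fst i) \<in> borel_measurable P"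
    by (intro Z) (auto simp: cells_def)
  show "(\<lambda>\<omega>. (\<bar>Z (real (snd i) / 2^fst i) (real (Suc (snd i)) / 2^fst i) \<omega>\<bar> / dyad (fst i) \<gamma>) powr (1 / real (Suc m))) \<in> borel_measurable P"
    by measurable
next
  fix n k q :: nat assume kq: "k < 2^n" "q \<ge> 1"
  show "(\<integral>\<^sup>+\<omega>. ennreal (((\<bar>Z (real (snd (n,k)) / 2^fst (n,k)) (real (Suc (snd (n,k))) / 2^fst (n,k)) \<omega>\<bar>
      / dyad (fst (n,k)) \<gamma>) powr (1 / real (Suc m))) ^ (2*q)) \<partial>P)
     \<le> ennreal ((2 * K * real q)^q * dyad n (2 * \<kappa> * real q))"
    unfolding fst_conv snd_conv using kq by (intro root_moment_le[OF Z _ K mom]) auto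
qed (use K in auto)

lemma exp_sq_integrable_lift:
  assumes m: "m \<le> M"
  shows "exp_sq_integrable P (cell_sup (lift e m) (real m * \<alpha> + \<beta>) m)"
proof (rule exp_sq_integrable_cell_sup)
  fix n k :: nat assume k: "k < 2^n"
  show "lift e m (real k / 2^n) (real (Suc k) / 2^n) \<in> borel_measurable P"
    using k m dyadic_in_unit[of "Suc k" n] by (intro lift_meas) (auto simp: divide_right_mono)
  fix q :: nat assume q: "q \<ge> 1"
  \<comment> \<open>Large enough to dominate both \<open>4 m\<close> and 2, so that
    \<open>moment_const\<close> is at most the power \<open>m + 1\<close> of
    \<open>?K * q\<close>.\<close>
  let ?K = "8 * real (Suc m)"
  have "(\<integral>\<^sup>+\<omega>. ennreal (lift e m (real k / 2^n) (real (Suc k) / 2^n) \<omega> ^ (2*q)) \<partial>P)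
     \<le> ennreal ((moment_const m q * (real (Suc k - k) / 2^n) powr (2 * H * real m + 1))^q)"
    using k q m by (intro lift_moment_le) auto
  also have "\<dots> \<le> ennreal ((?K * real q)^(Suc m * q) * dyad n (2 * real q * (real m * \<alpha> + \<beta> + real (Suc m) * \<kappa>)))"
  proof (rule ennreal_leI)
    have "4 * (real m * real q) \<le> ?K * real q" "2 * real q \<le> ?K * real q"
      by (auto simp: algebra_simps)
    then have "moment_const m q \<le> (?K * real q) * (?K * real q)^m"
      unfolding moment_const_def by (intro mult_mono[of "2 * real q"] power_mono) auto
    then have c: "moment_const m q ^ q \<le> ((?K * real q)^Suc m)^q"
      by (intro power_mono) (auto simp: moment_const_def)
    have "(real (Suc k - k) / 2^n) powr (2 * H * real m + 1) = dyad n (2 * H * real m + 1)"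
      by (simp add: dyad_def powr_realpow[symmetric] powr_minus_divide[symmetric] powr_powr)
    then have "(moment_const m q * (real (Suc k - k) / 2^n) powr (2 * H * real m + 1))^q
       = moment_const m q ^ q * dyad n (real q * (2 * H * real m + 1))"
      by (simp only: power_mult_distrib dyad_power)
    also have "\<dots> \<le> ((?K * real q)^Suc m)^q * dyad n (real q * (2 * H * real m + 1))"
      using c dyad_pos[of n] by (intro mult_right_mono) (auto simp: less_imp_le)
    also have "((?K * real q)^Suc m)^q = (?K * real q)^(Suc m * q)" by (simp only: power_mult)
    \<comment> \<open>Restoring \<kappa> in each of the \<open>m + 1\<close> factors turns
      \<open>m (H - \<kappa>) + 1/2 - \<kappa>\<close> back into \<open>m H + 1/2\<close>, the
      exponent of the moment bound.\<close>
    also have "real q * (2 * H * real m + 1) = 2 * real q * (real m * \<alpha> + \<beta> + real (Suc m) * \<kappa>)"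
      by (simp add: algebra_simps)
    finally show "(moment_const m q * (real (Suc k - k) / 2^n) powr (2 * H * real m + 1))^q
       \<le> (?K * real q)^(Suc m * q) * dyad n (2 * real q * (real m * \<alpha> + \<beta> + real (Suc m) * \<kappa>))" .
  qed
  finally show "(\<integral>\<^sup>+\<omega>. ennreal (lift e m (real k / 2^n) (real (Suc k) / 2^n) \<omega> ^ (2*q)) \<partial>P)
     \<le> ennreal ((?K * real q)^(Suc m * q) * dyad n (2 * real q * (real m * \<alpha> + \<beta> + real (Suc m) * \<kappa>)))" .
qed simp

lemma exp_sq_integrable_Wh:
  "exp_sq_integrable P (cell_sup (\<lambda>s t \<omega>. Wh t \<omega> - Wh s \<omega>) \<alpha> 0)"
proof (rule exp_sq_integrable_cell_sup[where K = 4])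
  fix n k :: nat assume k: "k < 2^n"
  show "(\<lambda>\<omega>. Wh (real (Suc k) / 2^n) \<omega> - Wh (real k / 2^n) \<omega>) \<in> borel_measurable P"
    using k by (intro borel_measurable_diff Wh_meas dyadic_in_unit) auto
  fix q :: nat assume q: "q \<ge> 1"
  have "(\<integral>\<^sup>+\<omega>. ennreal ((Wh (real (Suc k) / 2^n) \<omega> - Wh (real k / 2^n) \<omega>) ^ (2*q)) \<partial>P)
     \<le> ennreal ((4 * real q * (real (Suc k - k) / 2^n) powr (2 * H))^q)"
    using k q by (intro wh_increment_moment_le) auto
  also have "(4 * real q * (real (Suc k - k) / 2^n) powr (2 * H))^q
     = (4 * real q)^(Suc 0 * q) * dyad n (2 * real q * (\<alpha> + real (Suc 0) * \<kappa>))"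
  proof -
    have "(real (Suc k - k) / 2^n) powr (2 * H) = dyad n (2 * H)"
      by (simp add: dyad_def powr_realpow[symmetric] powr_minus_divide[symmetric] powr_powr)
    then show ?thesis by (simp add: power_mult_distrib dyad_power mult_ac)
  qed
  finally show "(\<integral>\<^sup>+\<omega>. ennreal ((Wh (real (Suc k) / 2^n) \<omega> - Wh (real k / 2^n) \<omega>) ^ (2*q)) \<partial>P)
     \<le> ennreal ((4 * real q)^(Suc 0 * q) * dyad n (2 * real q * (\<alpha> + real (Suc 0) * \<kappa>)))" .
qed simp

text \<open>The summand 1 keeps the value positive, since paths are divided by powers of it.\<close>

definition size_bound :: "bool \<Rightarrow> 'a \<Rightarrow> ennreal" where
  "size_bound e \<omega> = ennreal 1 + cell_sup (\<lambda>s t \<omega>. Wh t \<omega> - Wh s \<omega>) \<alpha> 0 \<omega>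
     + (\<Sum>m\<le>M. cell_sup (lift e m) (real m * \<alpha> + \<beta>) m \<omega>)"

lemma exp_sq_integrable_size_bound: "exp_sq_integrable P (size_bound e)"
  unfolding size_bound_def
  by (intro exp_sq_integrable_add exp_sq_integrable_const exp_sq_integrable_Wh exp_sq_integrable_sum
      exp_sq_integrable_lift) auto

lemma cell_le_of_cell_sup_le:
  assumes "cell_sup Z \<gamma> m \<omega> \<le> ennreal L" "k < 2^n" "L \<ge> 0"
  shows "\<bar>Z (real k / 2^n) (real (Suc k) / 2^n) \<omega>\<bar> \<le> L^(m+1) * dyad n \<gamma>"
proof -
  define z where "z = \<bar>Z (real k / 2^n) (real (Suc k) / 2^n) \<omega>\<bar> / dyad n \<gamma>"
  have z0: "z \<ge> 0" using dyad_pos[of n \<gamma>] by (simp add: z_def)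
  have "ennreal (z powr (1 / real (Suc m))) \<le> cell_sup Z \<gamma> m \<omega>"
    unfolding cell_sup_def using assms(2)
    by (intro SUP_upper2[of "(n, k)"]) (auto simp: cells_def z_def)
  then have "z powr (1 / real (Suc m)) \<le> L"
    using assms(1,3) by (metis ennreal_le_iff order_trans)
  then have "(z powr (1 / real (Suc m))) ^ Suc m \<le> L ^ Suc m"
    by (intro power_mono) auto
  also have "(z powr (1 / real (Suc m))) ^ Suc m = z"
    using z0 by (cases "z = 0") (auto simp: powr_power simp del: power_Suc)
  finally show ?thesis
    using dyad_pos[of n \<gamma>] by (simp add: z_def pos_divide_le_eq)
qed

lemma cell_bounds_size_bound:
  assumes "size_bound e \<omega> = ennreal L" "L \<ge> 0"
  shows "cell_bounds \<alpha> \<beta> M L (\<lambda>t. Wh t \<omega>) (\<lambda>m s t. lift e m s t \<omega>)"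
proof -
  have 1: "cell_sup (\<lambda>s t \<omega>. Wh t \<omega> - Wh s \<omega>) \<alpha> 0 \<omega> \<le> ennreal L"
    unfolding assms(1)[symmetric] size_bound_def by (simp add: add_increasing add_increasing2)
  have 2: "cell_sup (lift e m) (real m * \<alpha> + \<beta>) m \<omega> \<le> ennreal L" if "m \<le> M" for m
  proof -
    have "cell_sup (lift e m) (real m * \<alpha> + \<beta>) m \<omega> \<le> (\<Sum>m\<le>M. cell_sup (lift e m) (real m * \<alpha> + \<beta>) m \<omega>)"
      using that by (intro member_le_sum) auto
    also have "\<dots> \<le> ennreal L"
      unfolding assms(1)[symmetric] size_bound_def by (simp add: add_increasing)
    finally show ?thesis .
  qed
  show ?thesis
    unfolding cell_bounds_def
    using cell_le_of_cell_sup_le[OF 1 _ assms(2)] cell_le_of_cell_sup_le[OF 2 _ assms(2)] by auto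
qed

text \<open>Degrees, levels and grid points are natural numbers, so the exceptional null sets are
  countably many and unite to one.\<close>

lemma AE_chen_family: "AE \<omega> in P. chen_family M (\<lambda>t. Wh t \<omega>) (\<lambda>m s t. lift e m s t \<omega>)"
  unfolding chen_family_def
  by (subst AE_all_countable, intro allI AE_impI impI)+ (rule lift_chen_AE)

text \<open>A pathwise argument: outside a null set \<open>size_bound\<close>, where finite, is an
  admissible \<open>L\<close> for the deterministic estimate; where it is infinite the claim is
  trivial.\<close>

lemma AE_holder_bounds:
  obtains C where "C > 0"
    "\<And>e. AE \<omega> in P. holder \<alpha> (\<lambda>t. Wh t \<omega>) \<le> ennreal C * size_bound e \<omega>"
    "\<And>e m. m \<le> M \<Longrightarrow> AE \<omega> in P. enn_root (m+1) (holder2 (real m * \<alpha> + \<beta>) (\<lambda>s t. lift e m s t \<omega>)) \<le> ennreal C * size_bound e \<omega>"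
proof -
  obtain C where C: "C \<ge> 1"
    and bd: "\<And>x A L n a b. L > 0 \<Longrightarrow> chen_family M x A \<Longrightarrow> cell_bounds \<alpha> \<beta> M L x A \<Longrightarrow> a < b \<Longrightarrow> b \<le> 2^n \<Longrightarrow>
     \<bar>x (real b / 2^n) - x (real a / 2^n)\<bar> \<le> C * L * (real b / 2^n - real a / 2^n) powr \<alpha> \<and>
     (\<forall>m\<le>M. \<bar>A m (real a / 2^n) (real b / 2^n)\<bar> \<le> C * L^(m+1) * (real b / 2^n - real a / 2^n) powr (real m * \<alpha> + \<beta>))"
    using chen_family_holder[OF exponents_pos, of M] by blast
  have main: "AE \<omega> in P. holder \<alpha> (\<lambda>t. Wh t \<omega>) \<le> ennreal C * size_bound e \<omega> \<and>
     (\<forall>m\<le>M. enn_root (m+1) (holder2 (real m * \<alpha> + \<beta>) (\<lambda>s t. lift e m s t \<omega>)) \<le> ennreal C * size_bound e \<omega>)" for e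
    using AE_chen_family[of e] AE_space
  proof eventually_elim
    case (elim \<omega>)
    show ?case
    proof (cases "size_bound e \<omega> = \<infinity>")
      case True
      then show ?thesis using C by (simp add: ennreal_mult_top)
    next
      case False
      define L where "L = enn2real (size_bound e \<omega>)"
      have L: "size_bound e \<omega> = ennreal L" "L \<ge> 0" using False by (auto simp: L_def less_top)
      have "ennreal 1 \<le> ennreal L"
        unfolding L(1)[symmetric] size_bound_def by (simp add: add.assoc)
      then have L1: "L \<ge> 1" using L(2) by (simp add: ennreal_le_iff2)
      have CL: "ennreal C * size_bound e \<omega> = ennreal (C * L)"
        using C L by (simp add: ennreal_mult)
      have bnd: "\<bar>Wh (real b / 2^n) \<omega> - Wh (real a / 2^n) \<omega>\<bar> \<le> C * L * (real b / 2^n - real a / 2^n) powr \<alpha> \<and>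
        (\<forall>m\<le>M. \<bar>lift e m (real a / 2^n) (real b / 2^n) \<omega>\<bar> \<le> C * L^(m+1) * (real b / 2^n - real a / 2^n) powr (real m * \<alpha> + \<beta>))"
        if "a < b" "b \<le> 2^n" for n a b
        using L1 by (intro bd[OF _ elim(1) cell_bounds_size_bound[OF L] that]) simp
      have "holder \<alpha> (\<lambda>t. Wh t \<omega>) \<le> ennreal (C * L)"
        unfolding holder_def using bnd by (intro holder2_le increment_cont Wh_cont elim) auto
      moreover have "enn_root (m+1) (holder2 (real m * \<alpha> + \<beta>) (\<lambda>s t. lift e m s t \<omega>)) \<le> ennreal (C * L)" if "m \<le> M" for m
        using bnd that C L by (intro enn_root_le holder2_le lift_cont elim) auto
      ultimately show ?thesis unfolding CL by blast
    qed
  qed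
  show thesis
  proof (rule that)
    show "C > 0" using C by simp
    show "AE \<omega> in P. holder \<alpha> (\<lambda>t. Wh t \<omega>) \<le> ennreal C * size_bound e \<omega>" for e
      using main[of e] by eventually_elim simp
    show "AE \<omega> in P. enn_root (m+1) (holder2 (real m * \<alpha> + \<beta>) (\<lambda>s t. lift e m s t \<omega>)) \<le> ennreal C * size_bound e \<omega>"
      if "m \<le> M" for e m
      using main[of e] by eventually_elim (use that in simp)
  qed
qed

theorem exp_sq_integrable_model_norm:
  "exp_sq_integrable P (\<lambda>\<omega>. model_norm H \<kappa> M (\<lambda>t. W t \<omega>) (\<lambda>t. Wb t \<omega>) (\<lambda>t. Wh t \<omega>)
      (\<lambda>m s t. WW False m s t \<omega>) (\<lambda>m s t. WW True m s t \<omega>))"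
proof -
  obtain C where C: "C > 0"
    "\<And>e. AE \<omega> in P. holder \<alpha> (\<lambda>t. Wh t \<omega>) \<le> ennreal C * size_bound e \<omega>"
    "\<And>e m. m \<le> M \<Longrightarrow> AE \<omega> in P. enn_root (m+1) (holder2 (real m * \<alpha> + \<beta>) (\<lambda>s t. lift e m s t \<omega>)) \<le> ennreal C * size_bound e \<omega>"
    using AE_holder_bounds by blast
  note dom = exp_sq_integrable_AE_mono[OF exp_sq_integrable_cmult[OF exp_sq_integrable_size_bound C(1)]]
  have h: "exp_sq_integrable P (\<lambda>\<omega>. holder \<alpha> (\<lambda>t. Wh t \<omega>))"
  proof (rule dom[OF _ C(2)[of False]])
    show "(\<lambda>\<omega>. holder \<alpha> (\<lambda>t. Wh t \<omega>)) \<in> borel_measurable P"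
      unfolding holder_def
      by (intro holder2_measurable increment_cont Wh_cont borel_measurable_diff Wh_meas) (auto simp: time_pairs_def)
  qed
  have hm: "(\<lambda>\<omega>. holder2 \<gamma> (\<lambda>s t. lift e m s t \<omega>)) \<in> borel_measurable P" if "m \<le> M" for e m \<gamma>
    using that by (intro holder2_measurable lift_cont lift_meas) (auto simp: time_pairs_def)
  have r: "exp_sq_integrable P (\<lambda>\<omega>. enn_root (m+1) (holder2 (real m * \<alpha> + \<beta>) (\<lambda>s t. lift e m s t \<omega>)))" if "m \<le> M" for e m
    by (rule dom[OF _ C(3)[OF that]]) (intro measurable_compose[OF hm[OF that] enn_root_measurable])
  have rW: "exp_sq_integrable P (\<lambda>\<omega>. enn_root (m+1) (holder2 (real m * \<alpha> + 1/2 - \<kappa>) (\<lambda>s t. WW e m s t \<omega>)))"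
    if "m \<in> {1..M}" for e m
  proof -
    have "holder2 (real m * \<alpha> + 1/2 - \<kappa>) (\<lambda>s t. WW e m s t \<omega>) = holder2 (real m * \<alpha> + \<beta>) (\<lambda>s t. lift e m s t \<omega>)" for \<omega>
      unfolding holder2_def using that by (intro SUP_cong) (auto simp: lift_def algebra_simps)
    then show ?thesis using r[of m e] that by simp
  qed
  have r0: "exp_sq_integrable P (\<lambda>\<omega>. holder \<beta> (\<lambda>t. bm e t \<omega>))" for e
  proof -
    \<comment> \<open>For \<open>m = 0\<close> the root is the identity, so the norms of the two
      Brownian paths are the degree-one case of the bound for \<open>lift\<close>.\<close>
    have root1: "enn_root (0+1) x = x" for x by (auto simp: enn_root_def less_top)
    have "(\<lambda>s t. lift e 0 s t \<omega>) = (\<lambda>s t. bm e t \<omega> - bm e s \<omega>)" for \<omega> by (simp add: lift_def fun_eq_iff)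
    then show ?thesis using r[of 0 e] unfolding root1 holder_def by simp
  qed
  have "exp_sq_integrable P (\<lambda>\<omega>. holder \<beta> (\<lambda>t. bm False t \<omega>) + holder \<beta> (\<lambda>t. bm True t \<omega>) + holder \<alpha> (\<lambda>t. Wh t \<omega>) +
     (\<Sum>m\<in>{1..M}. enn_root (m+1) (holder2 (real m * \<alpha> + 1/2 - \<kappa>) (\<lambda>s t. WW False m s t \<omega>)) +
                 enn_root (m+1) (holder2 (real m * \<alpha> + 1/2 - \<kappa>) (\<lambda>s t. WW True m s t \<omega>))))"
    by (intro exp_sq_integrable_add exp_sq_integrable_sum r0 h rW) auto
  then show ?thesis unfolding model_norm_def bm_def by simp
qed

end

theorem theoremA4:
  fixes P :: "'a measure"
    and H \<kappa> :: real and M :: nat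
    and W Wb Wh :: "real \<Rightarrow> 'a \<Rightarrow> real"
    and WW WWb :: "nat \<Rightarrow> real \<Rightarrow> real \<Rightarrow> 'a \<Rightarrow> real"
  assumes "prob_space P"
    and H: "0 < H" "H \<le> 1/2"
    and M: "M = (LEAST m::nat. real (m+1) * H - 1/2 > 0)"
    and kappa: "\<kappa> > 0" "real (M+1) * (H - \<kappa>) - 1/2 - \<kappa> > 0"
    and BM: "std_BM P W" "std_BM P Wb" "indep_processes P W Wb"
    and Wh_cont: "\<forall>\<omega>\<in>space P. continuous_on {0..1} (\<lambda>t. Wh t \<omega>)"
    and Wh_meas: "\<forall>t\<in>{0..1}. Wh t \<in> borel_measurable P"
    and Wh_int: "\<forall>t\<in>{0..1}. conv_in_prob P (\<lambda>n. riemann_sum (\<lambda>s \<omega>. KH H s t) W 0 t n) (Wh t)"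
    and WW_cont: "\<forall>m\<in>{1..M}. \<forall>\<omega>\<in>space P.
         continuous_on {(s,t). 0 \<le> s \<and> s < t \<and> t \<le> 1} (\<lambda>(s,t). WW m s t \<omega>) \<and>
         continuous_on {(s,t). 0 \<le> s \<and> s < t \<and> t \<le> 1} (\<lambda>(s,t). WWb m s t \<omega>)"
    and WW_meas: "\<forall>m\<in>{1..M}. \<forall>s t. 0 \<le> s \<and> s < t \<and> t \<le> 1 \<longrightarrow>
         WW m s t \<in> borel_measurable P \<and> WWb m s t \<in> borel_measurable P"
    and WW_int: "\<forall>m\<in>{1..M}. \<forall>s t. 0 \<le> s \<and> s < t \<and> t \<le> 1 \<longrightarrow>
         conv_in_prob P (\<lambda>n. riemann_sum (\<lambda>r \<omega>. (Wh r \<omega> - Wh s \<omega>) ^ m) W s t n) (WW m s t) \<and>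
         conv_in_prob P (\<lambda>n. riemann_sum (\<lambda>r \<omega>. (Wh r \<omega> - Wh s \<omega>) ^ m) Wb s t n) (WWb m s t)"
  shows "(\<lambda>\<omega>. model_norm H \<kappa> M (\<lambda>t. W t \<omega>) (\<lambda>t. Wb t \<omega>) (\<lambda>t. Wh t \<omega>)
                  (\<lambda>m s t. WW m s t \<omega>) (\<lambda>m s t. WWb m s t \<omega>)) \<in> borel_measurable P
       \<and> (\<exists>\<eta>>0. (\<integral>\<^sup>+\<omega>. enn_exp_sq \<eta> (model_norm H \<kappa> M (\<lambda>t. W t \<omega>) (\<lambda>t. Wb t \<omega>) (\<lambda>t. Wh t \<omega>)
                  (\<lambda>m s t. WW m s t \<omega>) (\<lambda>m s t. WWb m s t \<omega>)) \<partial>P) < \<infinity>)"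
proof -
  \<comment> \<open>The smallness of \<kappa> enters as positivity of the exponents
    \<open>H - \<kappa>\<close> and \<open>1/2 - \<kappa>\<close>, which makes the geometric sums of
    the chaining converge.\<close>
  have "\<kappa> < H"
  proof (rule ccontr)
    assume "\<not> \<kappa> < H"
    then have "real (M+1) * (H - \<kappa>) \<le> 0" by (intro mult_nonneg_nonpos) auto
    then show False using kappa by linarith
  qed
  interpret prob_space P by fact
  interpret continuous_ito_model P H M W Wb Wh "\<lambda>e. if e then WWb else WW" \<kappa>
    using H kappa(1) \<open>\<kappa> < H\<close> BM Wh_cont Wh_meas Wh_int WW_cont WW_meas WW_int
    by unfold_locales (auto simp: time_pairs_def)
  show ?thesis
    using exp_sq_integrable_model_norm unfolding exp_sq_integrable_def by simp
qed

end
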